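(* Let $(H,A,C)$ be a monoidal Doi-Hopf datum. For all Doi-Hopf modules $(M,\alpha_M)$ and $(N,\alpha_N)$ over $(H,A,C)$, the pair $(M\otimes N,\alpha_M\otimes\alpha_N)$ is again a Doi-Hopf module over $(H,A,C)$ with the structure $$a\cdot(m\otimes n)=a_1\cdot m\otimes a_2\cdot n,\qquad \rho(m\otimes n)=m_{(0)}\otimes n_{(0)}\otimes\alpha_C^{-2}(m_{(1)}n_{(1)}),$$ for all $a\in A$, $m\in M$, $n\in N$. With this tensor product the category ${}_A\mathcal{M}(H)^C$ is a monoidal category.
   Context: Work over a field $k$, $\otimes=\otimes_k$. All structure maps $\alpha$ below are assumed bijective. Hom-algebra $(A,\alpha_A)$: a linear multiplication, a unit $1_A$ and a linear $\alpha_A:A\to A$ with $\alpha_A(ab)=\alpha_A(a)\alpha_A(b)$, $\alpha_A(1_A)=1_A$, $1_Aa=\alpha_A(a)=a1_A$, $\alpha_A(a)(bc)=(ab)\alpha_A(c)$. Hom-coalgebra $(C,\alpha_C)$: linear $\Delta:C\to C\otimes C$, $\Delta(c)=c_1\otimes c_2$, $\varepsilon:C\to k$ and $\alpha_C$ with $\varepsilon\circ\alpha_C=\varepsilon$, $(\alpha_C\otimes\alpha_C)\Delta=\Delta\alpha_C$, $(\varepsilon\otimes id)\Delta=\alpha_C=(id\otimes\varepsilon)\Delta$, $(\Delta\otimes\alpha_C)\Delta=(\alpha_C\otimes\Delta)\Delta$. Morphisms preserve all structure and commute with the $\alpha$'s. Hom-bialgebra: a Hom-algebra and Hom-coalgebra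 with the same $\alpha$ such that $\Delta,\varepsilon$ are Hom-algebra morphisms. Hom-Hopf algebra: a Hom-bialgebra with a linear $S$, $S\alpha=\alpha S$, $S(h_1)h_2=h_1S(h_2)=\varepsilon(h)1$. Left $A$-module $(M,\alpha_M)$: linear $A\otimes M\to M$ with $1_A\cdot m=\alpha_M(m)$, $\alpha_M(a\cdot m)=\alpha_A(a)\cdot\alpha_M(m)$, $\alpha_A(a)\cdot(b\cdot m)=(ab)\cdot\alpha_M(m)$. Right $C$-comodule $(M,\alpha_M)$: linear $\rho:M\to M\otimes C$, $\rho(m)=m_{(0)}\otimes m_{(1)}$, with $(id\otimes\varepsilon)\rho=\alpha_M$, $(\alpha_M\otimes\alpha_C)\rho=\rho\alpha_M$, $(\rho\otimes\alpha_C)\rho=(\alpha_M\otimes\Delta)\rho$. (Co)module maps are (co)linear and commute with the $\alpha$'s. A (Hom-type) Doi-Hopf datum $(H,A,C)$ consists of a Hom-Hopf algebra $(H,\alpha_H)$, a right $H$-comodule algebra $(A,\alpha_A)$ (a Hom-algebra and right $H$-comodule, $\rho(a)=a_{(0)}\otimes a_{(1)}$, with $\rho(ab)=\rho(a)\rho(b)$, $\rho(1_A)=1_A\otimes1_H$) and a left $H$-module coalgebra $(C,\alpha_C)$ (a Hom-coalgebra and left $H$-module with $\Delta_C(h\cdot c)=h_1\cdot c_1\otimes h_2\cdot c_2$, $\varepsilon_C(h\cdot c)=\varepsilon_H(h)\varepsilon_C(c)$). A Doi-Hopf module over $(H,A,C)$ is $(M,\alpha_M)$ that is a left $A$-module and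 a right $C$-comodule with $\rho(a\cdot m)=a_{(0)}\cdot m_{(0)}\otimes a_{(1)}\cdot m_{(1)}$. ${}_A\mathcal{M}(H)^C$ is the category of these, with $A$-linear $C$-colinear maps. The Doi-Hopf datum is monoidal if $A$ and $C$ are Hom-bialgebras and, for all $a\in A$, $c,d\in C$, $$a_{(0)1}\otimes a_{(0)2}\otimes\alpha_H^2(a_{(1)})\cdot(cd)=a_{1(0)}\otimes a_{2(0)}\otimes(a_{1(1)}\cdot c)(a_{2(1)}\cdot d),\qquad \varepsilon(a)1_C=\varepsilon(a_{(0)})a_{(1)}\cdot1_C .$$ The unit object is $k$ with trivial action $a\cdot\lambda=\varepsilon(a)\lambda$ and coaction $\lambda\mapsto\lambda\otimes1_C$ (structure map the identity); the constraints are $(m\otimes n)\otimes p\mapsto\alpha_M^{-1}(m)\otimes(n\otimes\alpha_P(p))$, $\lambda\otimes m\mapsto\lambda\alpha_M^{-1}(m)$, $m\otimes\lambda\mapsto\lambda\alpha_M^{-1}(m)$. *)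

theory Defs
  imports "HOL-Algebra.Module" "HOL-Library.FuncSet"
begin

section \<open>Monoidal categories\<close>

text \<open>
  Categories are given by hom-families; the hom-sets of different pairs of objects need not be
  disjoint, so composition takes the three objects as arguments:
  \<open>Comp C X Y Z g f\<close> is the composite of \<open>f : X \<rightarrow> Y\<close> and \<open>g : Y \<rightarrow> Z\<close>.
\<close>

record ('o, 'm) category =
  Obj :: "'o set"
  Hom :: "'o \<Rightarrow> 'o \<Rightarrow> 'm set"
  Ident :: "'o \<Rightarrow> 'm"
  Comp :: "'o \<Rightarrow> 'o \<Rightarrow> 'o \<Rightarrow> 'm \<Rightarrow> 'm \<Rightarrow> 'm"

definition category :: "('o, 'm, 'z) category_scheme \<Rightarrow> bool" where
  "category C \<longleftrightarrow>
    (\<forall>X\<in>Obj C. Ident C X \<in> Hom C X X) \<and>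
    (\<forall>X\<in>Obj C. \<forall>Y\<in>Obj C. \<forall>Z\<in>Obj C. \<forall>f\<in>Hom C X Y. \<forall>g\<in>Hom C Y Z.
      Comp C X Y Z g f \<in> Hom C X Z) \<and>
    (\<forall>X\<in>Obj C. \<forall>Y\<in>Obj C. \<forall>f\<in>Hom C X Y.
      Comp C X X Y f (Ident C X) = f \<and> Comp C X Y Y (Ident C Y) f = f) \<and>
    (\<forall>W\<in>Obj C. \<forall>X\<in>Obj C. \<forall>Y\<in>Obj C. \<forall>Z\<in>Obj C.
      \<forall>f\<in>Hom C W X. \<forall>g\<in>Hom C X Y. \<forall>h\<in>Hom C Y Z.
      Comp C W X Z (Comp C X Y Z h g) f = Comp C W Y Z h (Comp C W X Y g f))"

definition cat_iso :: "('o, 'm, 'z) category_scheme \<Rightarrow> 'o \<Rightarrow> 'o \<Rightarrow> 'm \<Rightarrow> bool" where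
  "cat_iso C X Y f \<longleftrightarrow> f \<in> Hom C X Y \<and>
    (\<exists>g\<in>Hom C Y X. Comp C X Y X g f = Ident C X \<and> Comp C Y X Y f g = Ident C Y)"

text \<open>\<open>TArr C X X' Y Y' f g : X \<otimes> Y \<rightarrow> X' \<otimes> Y'\<close> is the tensor product of \<open>f : X \<rightarrow> X'\<close> and \<open>g : Y \<rightarrow> Y'\<close>.\<close>

record ('o, 'm) monoidal_cat = "('o, 'm) category" +
  TObj :: "'o \<Rightarrow> 'o \<Rightarrow> 'o"
  TArr :: "'o \<Rightarrow> 'o \<Rightarrow> 'o \<Rightarrow> 'o \<Rightarrow> 'm \<Rightarrow> 'm \<Rightarrow> 'm"
  UnitObj :: "'o"
  Assoc :: "'o \<Rightarrow> 'o \<Rightarrow> 'o \<Rightarrow> 'm"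
  LUnit :: "'o \<Rightarrow> 'm"
  RUnit :: "'o \<Rightarrow> 'm"

definition tensor_bifunctor :: "('o, 'm, 'z) monoidal_cat_scheme \<Rightarrow> bool" where
  "tensor_bifunctor C \<longleftrightarrow>
    (\<forall>X\<in>Obj C. \<forall>Y\<in>Obj C. TObj C X Y \<in> Obj C) \<and>
    (\<forall>X\<in>Obj C. \<forall>X'\<in>Obj C. \<forall>Y\<in>Obj C. \<forall>Y'\<in>Obj C. \<forall>f\<in>Hom C X X'. \<forall>g\<in>Hom C Y Y'.
      TArr C X X' Y Y' f g \<in> Hom C (TObj C X Y) (TObj C X' Y')) \<and>
    (\<forall>X\<in>Obj C. \<forall>Y\<in>Obj C. TArr C X X Y Y (Ident C X) (Ident C Y) = Ident C (TObj C X Y)) \<and>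
    (\<forall>X\<in>Obj C. \<forall>X'\<in>Obj C. \<forall>X''\<in>Obj C. \<forall>Y\<in>Obj C. \<forall>Y'\<in>Obj C. \<forall>Y''\<in>Obj C.
      \<forall>f\<in>Hom C X X'. \<forall>f'\<in>Hom C X' X''. \<forall>g\<in>Hom C Y Y'. \<forall>g'\<in>Hom C Y' Y''.
      TArr C X X'' Y Y'' (Comp C X X' X'' f' f) (Comp C Y Y' Y'' g' g) =
      Comp C (TObj C X Y) (TObj C X' Y') (TObj C X'' Y'')
        (TArr C X' X'' Y' Y'' f' g') (TArr C X X' Y Y' f g))"

definition constraints_natural_iso :: "('o, 'm, 'z) monoidal_cat_scheme \<Rightarrow> bool" where
  "constraints_natural_iso C \<longleftrightarrow>
    (\<forall>X\<in>Obj C. \<forall>Y\<in>Obj C. \<forall>Z\<in>Obj C.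
      cat_iso C (TObj C (TObj C X Y) Z) (TObj C X (TObj C Y Z)) (Assoc C X Y Z)) \<and>
    (\<forall>X\<in>Obj C. cat_iso C (TObj C (UnitObj C) X) X (LUnit C X)) \<and>
    (\<forall>X\<in>Obj C. cat_iso C (TObj C X (UnitObj C)) X (RUnit C X)) \<and>
    (\<forall>X\<in>Obj C. \<forall>X'\<in>Obj C. \<forall>Y\<in>Obj C. \<forall>Y'\<in>Obj C. \<forall>Z\<in>Obj C. \<forall>Z'\<in>Obj C.
      \<forall>f\<in>Hom C X X'. \<forall>g\<in>Hom C Y Y'. \<forall>h\<in>Hom C Z Z'.
      Comp C (TObj C (TObj C X Y) Z) (TObj C (TObj C X' Y') Z') (TObj C X' (TObj C Y' Z'))
        (Assoc C X' Y' Z')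
        (TArr C (TObj C X Y) (TObj C X' Y') Z Z' (TArr C X X' Y Y' f g) h) =
      Comp C (TObj C (TObj C X Y) Z) (TObj C X (TObj C Y Z)) (TObj C X' (TObj C Y' Z'))
        (TArr C X X' (TObj C Y Z) (TObj C Y' Z') f (TArr C Y Y' Z Z' g h))
        (Assoc C X Y Z)) \<and>
    (\<forall>X\<in>Obj C. \<forall>Y\<in>Obj C. \<forall>f\<in>Hom C X Y.
      Comp C (TObj C (UnitObj C) X) (TObj C (UnitObj C) Y) Y (LUnit C Y)
        (TArr C (UnitObj C) (UnitObj C) X Y (Ident C (UnitObj C)) f) =
      Comp C (TObj C (UnitObj C) X) X Y f (LUnit C X)) \<and>
    (\<forall>X\<in>Obj C. \<forall>Y\<in>Obj C. \<forall>f\<in>Hom C X Y.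
      Comp C (TObj C X (UnitObj C)) (TObj C Y (UnitObj C)) Y (RUnit C Y)
        (TArr C X Y (UnitObj C) (UnitObj C) f (Ident C (UnitObj C))) =
      Comp C (TObj C X (UnitObj C)) X Y f (RUnit C X))"

definition pentagon :: "('o, 'm, 'z) monoidal_cat_scheme \<Rightarrow> bool" where
  "pentagon C \<longleftrightarrow> (\<forall>W\<in>Obj C. \<forall>X\<in>Obj C. \<forall>Y\<in>Obj C. \<forall>Z\<in>Obj C.
    let s = TObj C (TObj C (TObj C W X) Y) Z;
        t = TObj C W (TObj C X (TObj C Y Z))
    in Comp C s (TObj C (TObj C W X) (TObj C Y Z)) t
         (Assoc C W X (TObj C Y Z)) (Assoc C (TObj C W X) Y Z) =
       Comp C s (TObj C W (TObj C (TObj C X Y) Z)) t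
         (TArr C W W (TObj C (TObj C X Y) Z) (TObj C X (TObj C Y Z)) (Ident C W) (Assoc C X Y Z))
         (Comp C s (TObj C (TObj C W (TObj C X Y)) Z) (TObj C W (TObj C (TObj C X Y) Z))
           (Assoc C W (TObj C X Y) Z)
           (TArr C (TObj C (TObj C W X) Y) (TObj C W (TObj C X Y)) Z Z
             (Assoc C W X Y) (Ident C Z))))"

definition triangle :: "('o, 'm, 'z) monoidal_cat_scheme \<Rightarrow> bool" where
  "triangle C \<longleftrightarrow> (\<forall>X\<in>Obj C. \<forall>Y\<in>Obj C.
    Comp C (TObj C (TObj C X (UnitObj C)) Y) (TObj C X (TObj C (UnitObj C) Y)) (TObj C X Y)
      (TArr C X X (TObj C (UnitObj C) Y) Y (Ident C X) (LUnit C Y))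
      (Assoc C X (UnitObj C) Y) =
    TArr C (TObj C X (UnitObj C)) X Y Y (RUnit C X) (Ident C Y))"

definition monoidal_category :: "('o, 'm, 'z) monoidal_cat_scheme \<Rightarrow> bool" where
  "monoidal_category C \<longleftrightarrow> category C \<and> tensor_bifunctor C \<and> UnitObj C \<in> Obj C \<and>
    constraints_natural_iso C \<and> pentagon C \<and> triangle C"


section \<open>Vector spaces with a twist, and their tensor products\<close>

text \<open>
  All vector spaces over \<open>K\<close> have their carrier in one type that is closed under tensor products:
  \<open>Formal [(v\<^sub>1, w\<^sub>1), \<dots>, (v\<^sub>n, w\<^sub>n)]\<close> is the formal sum of the \<open>v\<^sub>i \<otimes> w\<^sub>i\<close>, \<open>Scalar\<close> provides a
  copy of the field, and \<open>Base\<close> embeds the arbitrary type \<open>'b\<close>, so that a vector space on any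
  type has an isomorphic copy on a subset of \<open>('k, 'b) vec\<close>.
\<close>

datatype ('k, 'b) vec =
    Base 'b
  | Scalar (scal: 'k)
  | Formal (summands: "(('k, 'b) vec \<times> ('k, 'b) vec) list")

text \<open>
  A space \<open>(V, \<alpha>)\<close>. The multiplication and unit that the record inherits from
  \<^typ>\<open>('k, 'v) module\<close> are used for Hom-algebras only and are ignored otherwise.
\<close>

record ('k, 'v) hom_space = "('k, 'v) module" +
  twist :: "'v \<Rightarrow> 'v"

definition linear_map ::
  "('k, 'x) ring_scheme \<Rightarrow> ('k, 'v, 'y) module_scheme \<Rightarrow> ('k, 'w, 'z) module_scheme \<Rightarrow>
   ('v \<Rightarrow> 'w) \<Rightarrow> bool" where
  "linear_map K V W f \<longleftrightarrow> f \<in> carrier V \<rightarrow> carrier W \<and>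
    (\<forall>x\<in>carrier V. \<forall>y\<in>carrier V. f (x \<oplus>\<^bsub>V\<^esub> y) = f x \<oplus>\<^bsub>W\<^esub> f y) \<and>
    (\<forall>c\<in>carrier K. \<forall>x\<in>carrier V. f (c \<odot>\<^bsub>V\<^esub> x) = c \<odot>\<^bsub>W\<^esub> f x)"

definition bilinear_map ::
  "('k, 'x) ring_scheme \<Rightarrow> ('k, 'v, 'y) module_scheme \<Rightarrow> ('k, 'w, 'z) module_scheme \<Rightarrow>
   ('k, 'u, 't) module_scheme \<Rightarrow> ('v \<Rightarrow> 'w \<Rightarrow> 'u) \<Rightarrow> bool" where
  "bilinear_map K V W U f \<longleftrightarrow>
    (\<forall>v\<in>carrier V. linear_map K W U (f v)) \<and>
    (\<forall>w\<in>carrier W. linear_map K V U (\<lambda>v. f v w))"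

definition hom_space :: "('k, 'x) ring_scheme \<Rightarrow> ('k, 'v, 'y) hom_space_scheme \<Rightarrow> bool" where
  "hom_space K V \<longleftrightarrow> module K V \<and> linear_map K V V (twist V) \<and>
    bij_betw (twist V) (carrier V) (carrier V)"

definition twist_inv :: "('k, 'v, 'y) hom_space_scheme \<Rightarrow> 'v \<Rightarrow> 'v" where
  "twist_inv V = inv_into (carrier V) (twist V)"

text \<open>Equality of formal sums in \<open>V \<otimes> W\<close>: the congruence that makes \<open>\<otimes>\<close> biadditive and \<open>K\<close>-balanced.\<close>

inductive tensor_eq ::
  "('k, 'x) ring_scheme \<Rightarrow> ('k, 'v, 'y) module_scheme \<Rightarrow> ('k, 'w, 'z) module_scheme \<Rightarrow>
   ('v \<times> 'w) list \<Rightarrow> ('v \<times> 'w) list \<Rightarrow> bool"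
  for K V W where
  refl: "tensor_eq K V W xs xs"
| sym: "tensor_eq K V W xs ys \<Longrightarrow> tensor_eq K V W ys xs"
| trans: "tensor_eq K V W xs ys \<Longrightarrow> tensor_eq K V W ys zs \<Longrightarrow> tensor_eq K V W xs zs"
| append: "tensor_eq K V W xs xs' \<Longrightarrow> tensor_eq K V W ys ys' \<Longrightarrow>
    tensor_eq K V W (xs @ ys) (xs' @ ys')"
| comm: "tensor_eq K V W (xs @ ys) (ys @ xs)"
| zero: "w \<in> carrier W \<Longrightarrow> tensor_eq K V W [(\<zero>\<^bsub>V\<^esub>, w)] []"
| add_left: "v \<in> carrier V \<Longrightarrow> v' \<in> carrier V \<Longrightarrow> w \<in> carrier W \<Longrightarrow>
    tensor_eq K V W [(v \<oplus>\<^bsub>V\<^esub> v', w)] [(v, w), (v', w)]"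
| add_right: "v \<in> carrier V \<Longrightarrow> w \<in> carrier W \<Longrightarrow> w' \<in> carrier W \<Longrightarrow>
    tensor_eq K V W [(v, w \<oplus>\<^bsub>W\<^esub> w')] [(v, w), (v, w')]"
| balanced: "c \<in> carrier K \<Longrightarrow> v \<in> carrier V \<Longrightarrow> w \<in> carrier W \<Longrightarrow>
    tensor_eq K V W [(c \<odot>\<^bsub>V\<^esub> v, w)] [(v, c \<odot>\<^bsub>W\<^esub> w)]"

text \<open>An element of \<open>V \<otimes> W\<close> is a chosen representative of an equivalence class of formal sums.\<close>

definition tensor_of ::
  "('k, 'x) ring_scheme \<Rightarrow> ('k, ('k, 'b) vec, 'y) module_scheme \<Rightarrow>
   ('k, ('k, 'b) vec, 'z) module_scheme \<Rightarrow> (('k, 'b) vec \<times> ('k, 'b) vec) list \<Rightarrow> ('k, 'b) vec" where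
  "tensor_of K V W xs = Formal (SOME ys. tensor_eq K V W xs ys)"

definition pure_tensor ::
  "('k, 'x) ring_scheme \<Rightarrow> ('k, ('k, 'b) vec, 'y) module_scheme \<Rightarrow>
   ('k, ('k, 'b) vec, 'z) module_scheme \<Rightarrow> ('k, 'b) vec \<Rightarrow> ('k, 'b) vec \<Rightarrow> ('k, 'b) vec" where
  "pure_tensor K V W v w = tensor_of K V W [(v, w)]"

text \<open>
  \<open>V \<otimes> W\<close> with the map \<open>\<alpha>\<^sub>V \<otimes> \<alpha>\<^sub>W\<close>, and with the product \<open>(v \<otimes> w) (v' \<otimes> w') = v v' \<otimes> w w'\<close>,
  which is meaningful when \<open>V\<close> and \<open>W\<close> are Hom-algebras.
\<close>

definition tensor ::
  "('k, ('k, 'b) vec, 'y) hom_space_scheme \<Rightarrow> ('k, 'x) ring_scheme \<Rightarrow>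
   ('k, ('k, 'b) vec, 'z) hom_space_scheme \<Rightarrow> ('k, ('k, 'b) vec) hom_space"
  (\<open>(_ \<boxtimes>\<^bsub>_\<^esub> _)\<close> [71, 0, 70] 70) where
  "V \<boxtimes>\<^bsub>K\<^esub> W =
   \<lparr> carrier = {tensor_of K V W xs | xs. set xs \<subseteq> carrier V \<times> carrier W},
     mult = (\<lambda>s t. tensor_of K V W
       [(v \<otimes>\<^bsub>V\<^esub> v', w \<otimes>\<^bsub>W\<^esub> w'). (v, w) \<leftarrow> summands s, (v', w') \<leftarrow> summands t]),
     one = pure_tensor K V W \<one>\<^bsub>V\<^esub> \<one>\<^bsub>W\<^esub>,
     zero = tensor_of K V W [],
     add = (\<lambda>s t. tensor_of K V W (summands s @ summands t)),
     smult = (\<lambda>c t. tensor_of K V W [(c \<odot>\<^bsub>V\<^esub> v, w). (v, w) \<leftarrow> summands t]),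
     twist = (\<lambda>t. tensor_of K V W [(twist V v, twist W w). (v, w) \<leftarrow> summands t]) \<rparr>"

text \<open>
  \<open>sweedler U f t\<close> is the sum of \<open>f t\<^sub>1 t\<^sub>2\<close> in \<open>U\<close>, where \<open>t = t\<^sub>1 \<otimes> t\<^sub>2\<close> in Sweedler notation, i.e.
  the value at \<open>t\<close> of the linear map induced by \<open>f\<close>. For bilinear \<open>f\<close> it does not depend on the
  representative.
\<close>

definition sweedler ::
  "('k, 'u, 'z) module_scheme \<Rightarrow> (('k, 'b) vec \<Rightarrow> ('k, 'b) vec \<Rightarrow> 'u) \<Rightarrow> ('k, 'b) vec \<Rightarrow> 'u" where
  "sweedler U f t = foldr (\<lambda>(v, w) s. f v w \<oplus>\<^bsub>U\<^esub> s) (summands t) \<zero>\<^bsub>U\<^esub>"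

text \<open>\<open>tensor_map K V W f g = f \<otimes> g\<close> for maps into \<open>V\<close> and \<open>W\<close>; \<open>reassoc\<close> is the plain
  identification of \<open>(U \<otimes> V) \<otimes> W\<close> with \<open>U \<otimes> (V \<otimes> W)\<close>.\<close>

definition tensor_map ::
  "('k, 'x) ring_scheme \<Rightarrow> ('k, ('k, 'b) vec, 'y) hom_space_scheme \<Rightarrow>
   ('k, ('k, 'b) vec, 'z) hom_space_scheme \<Rightarrow> (('k, 'b) vec \<Rightarrow> ('k, 'b) vec) \<Rightarrow>
   (('k, 'b) vec \<Rightarrow> ('k, 'b) vec) \<Rightarrow> ('k, 'b) vec \<Rightarrow> ('k, 'b) vec" where
  "tensor_map K V W f g = sweedler (V \<boxtimes>\<^bsub>K\<^esub> W) (\<lambda>x y. pure_tensor K V W (f x) (g y))"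

definition reassoc ::
  "('k, 'x) ring_scheme \<Rightarrow> ('k, ('k, 'b) vec, 'w) hom_space_scheme \<Rightarrow>
   ('k, ('k, 'b) vec, 'y) hom_space_scheme \<Rightarrow> ('k, ('k, 'b) vec, 'z) hom_space_scheme \<Rightarrow>
   ('k, 'b) vec \<Rightarrow> ('k, 'b) vec" where
  "reassoc K U V W = sweedler (U \<boxtimes>\<^bsub>K\<^esub> (V \<boxtimes>\<^bsub>K\<^esub> W)) (\<lambda>s w.
     sweedler (U \<boxtimes>\<^bsub>K\<^esub> (V \<boxtimes>\<^bsub>K\<^esub> W)) (\<lambda>u v.
       pure_tensor K U (V \<boxtimes>\<^bsub>K\<^esub> W) u (pure_tensor K V W v w)) s)"

definition ground :: "('k, 'x) ring_scheme \<Rightarrow> ('k, 'k) hom_space" where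
  "ground K = \<lparr> carrier = carrier K, mult = mult K, one = \<one>\<^bsub>K\<^esub>, zero = \<zero>\<^bsub>K\<^esub>, add = add K,
     smult = mult K, twist = (\<lambda>x. x) \<rparr>"


section \<open>Hom-Hopf algebras\<close>

definition hom_algebra :: "('k, 'x) ring_scheme \<Rightarrow> ('k, 'v, 'y) hom_space_scheme \<Rightarrow> bool" where
  "hom_algebra K A \<longleftrightarrow> hom_space K A \<and> bilinear_map K A A A (mult A) \<and> \<one>\<^bsub>A\<^esub> \<in> carrier A \<and>
    (\<forall>a\<in>carrier A. \<forall>b\<in>carrier A. twist A (a \<otimes>\<^bsub>A\<^esub> b) = twist A a \<otimes>\<^bsub>A\<^esub> twist A b) \<and>
    twist A \<one>\<^bsub>A\<^esub> = \<one>\<^bsub>A\<^esub> \<and>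
    (\<forall>a\<in>carrier A. \<one>\<^bsub>A\<^esub> \<otimes>\<^bsub>A\<^esub> a = twist A a \<and> a \<otimes>\<^bsub>A\<^esub> \<one>\<^bsub>A\<^esub> = twist A a) \<and>
    (\<forall>a\<in>carrier A. \<forall>b\<in>carrier A. \<forall>c\<in>carrier A.
      twist A a \<otimes>\<^bsub>A\<^esub> (b \<otimes>\<^bsub>A\<^esub> c) = (a \<otimes>\<^bsub>A\<^esub> b) \<otimes>\<^bsub>A\<^esub> twist A c)"

definition hom_algebra_map ::
  "('k, 'x) ring_scheme \<Rightarrow> ('k, 'v, 'y) hom_space_scheme \<Rightarrow> ('k, 'w, 'z) hom_space_scheme \<Rightarrow>
   ('v \<Rightarrow> 'w) \<Rightarrow> bool" where
  "hom_algebra_map K A B f \<longleftrightarrow> linear_map K A B f \<and>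
    (\<forall>a\<in>carrier A. f (twist A a) = twist B (f a)) \<and>
    (\<forall>a\<in>carrier A. \<forall>b\<in>carrier A. f (a \<otimes>\<^bsub>A\<^esub> b) = f a \<otimes>\<^bsub>B\<^esub> f b) \<and> f \<one>\<^bsub>A\<^esub> = \<one>\<^bsub>B\<^esub>"

record ('k, 'v) hom_coalgebra = "('k, 'v) hom_space" +
  comult :: "'v \<Rightarrow> 'v"
  counit :: "'v \<Rightarrow> 'k"

definition hom_coalgebra ::
  "('k, 'x) ring_scheme \<Rightarrow> ('k, ('k, 'b) vec, 'y) hom_coalgebra_scheme \<Rightarrow> bool" where
  "hom_coalgebra K C \<longleftrightarrow> hom_space K C \<and>
    linear_map K C (C \<boxtimes>\<^bsub>K\<^esub> C) (comult C) \<and> linear_map K C (ground K) (counit C) \<and>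
    (\<forall>c\<in>carrier C. counit C (twist C c) = counit C c) \<and>
    (\<forall>c\<in>carrier C. tensor_map K C C (twist C) (twist C) (comult C c) = comult C (twist C c)) \<and>
    (\<forall>c\<in>carrier C. sweedler C (\<lambda>c\<^sub>1 c\<^sub>2. counit C c\<^sub>1 \<odot>\<^bsub>C\<^esub> c\<^sub>2) (comult C c) = twist C c) \<and>
    (\<forall>c\<in>carrier C. sweedler C (\<lambda>c\<^sub>1 c\<^sub>2. counit C c\<^sub>2 \<odot>\<^bsub>C\<^esub> c\<^sub>1) (comult C c) = twist C c) \<and>
    (\<forall>c\<in>carrier C.
      reassoc K C C C (tensor_map K (C \<boxtimes>\<^bsub>K\<^esub> C) C (comult C) (twist C) (comult C c)) =
      tensor_map K C (C \<boxtimes>\<^bsub>K\<^esub> C) (twist C) (comult C) (comult C c))"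

definition hom_bialgebra ::
  "('k, 'x) ring_scheme \<Rightarrow> ('k, ('k, 'b) vec, 'y) hom_coalgebra_scheme \<Rightarrow> bool" where
  "hom_bialgebra K B \<longleftrightarrow> hom_algebra K B \<and> hom_coalgebra K B \<and>
    hom_algebra_map K B (B \<boxtimes>\<^bsub>K\<^esub> B) (comult B) \<and> hom_algebra_map K B (ground K) (counit B)"

record ('k, 'v) hom_hopf = "('k, 'v) hom_coalgebra" +
  antipode :: "'v \<Rightarrow> 'v"

definition hom_hopf_algebra ::
  "('k, 'x) ring_scheme \<Rightarrow> ('k, ('k, 'b) vec, 'y) hom_hopf_scheme \<Rightarrow> bool" where
  "hom_hopf_algebra K H \<longleftrightarrow> hom_bialgebra K H \<and> linear_map K H H (antipode H) \<and>
    (\<forall>h\<in>carrier H. antipode H (twist H h) = twist H (antipode H h)) \<and>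
    (\<forall>h\<in>carrier H.
      sweedler H (\<lambda>h\<^sub>1 h\<^sub>2. antipode H h\<^sub>1 \<otimes>\<^bsub>H\<^esub> h\<^sub>2) (comult H h) = counit H h \<odot>\<^bsub>H\<^esub> \<one>\<^bsub>H\<^esub> \<and>
      sweedler H (\<lambda>h\<^sub>1 h\<^sub>2. h\<^sub>1 \<otimes>\<^bsub>H\<^esub> antipode H h\<^sub>2) (comult H h) = counit H h \<odot>\<^bsub>H\<^esub> \<one>\<^bsub>H\<^esub>)"


section \<open>Modules, comodules and Doi-Hopf data\<close>

definition left_hom_module ::
  "('k, 'x) ring_scheme \<Rightarrow> ('k, 'v, 'y) hom_space_scheme \<Rightarrow> ('k, 'w, 'z) hom_space_scheme \<Rightarrow>
   ('v \<Rightarrow> 'w \<Rightarrow> 'w) \<Rightarrow> bool" where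
  "left_hom_module K A M a \<longleftrightarrow> hom_space K M \<and> bilinear_map K A M M a \<and>
    (\<forall>m\<in>carrier M. a \<one>\<^bsub>A\<^esub> m = twist M m) \<and>
    (\<forall>x\<in>carrier A. \<forall>m\<in>carrier M. twist M (a x m) = a (twist A x) (twist M m)) \<and>
    (\<forall>x\<in>carrier A. \<forall>y\<in>carrier A. \<forall>m\<in>carrier M.
      a (twist A x) (a y m) = a (x \<otimes>\<^bsub>A\<^esub> y) (twist M m))"

definition right_hom_comodule ::
  "('k, 'x) ring_scheme \<Rightarrow> ('k, ('k, 'b) vec, 'y) hom_coalgebra_scheme \<Rightarrow>
   ('k, ('k, 'b) vec, 'z) hom_space_scheme \<Rightarrow> (('k, 'b) vec \<Rightarrow> ('k, 'b) vec) \<Rightarrow> bool" where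
  "right_hom_comodule K C M r \<longleftrightarrow> hom_space K M \<and> linear_map K M (M \<boxtimes>\<^bsub>K\<^esub> C) r \<and>
    (\<forall>m\<in>carrier M. sweedler M (\<lambda>m\<^sub>0 m\<^sub>1. counit C m\<^sub>1 \<odot>\<^bsub>M\<^esub> m\<^sub>0) (r m) = twist M m) \<and>
    (\<forall>m\<in>carrier M. tensor_map K M C (twist M) (twist C) (r m) = r (twist M m)) \<and>
    (\<forall>m\<in>carrier M.
      reassoc K M C C (tensor_map K (M \<boxtimes>\<^bsub>K\<^esub> C) C r (twist C) (r m)) =
      tensor_map K M (C \<boxtimes>\<^bsub>K\<^esub> C) (twist M) (comult C) (r m))"

text \<open>
  The algebra \<open>A\<close> of a Doi-Hopf datum carries an \<open>H\<close>-coaction, its coalgebra \<open>C\<close> an \<open>H\<close>-action. Both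
  records have all the operations of a bialgebra, since these are needed for a monoidal datum; a plain
  datum constrains only the algebra operations of \<open>A\<close> and the coalgebra operations of \<open>C\<close>.
\<close>

record ('k, 'v) datum_alg = "('k, 'v) hom_coalgebra" +
  hcoact :: "'v \<Rightarrow> 'v"

record ('k, 'v) datum_coalg = "('k, 'v) hom_coalgebra" +
  hact :: "'v \<Rightarrow> 'v \<Rightarrow> 'v"

definition comodule_algebra ::
  "('k, 'x) ring_scheme \<Rightarrow> ('k, ('k, 'b) vec, 'y) hom_hopf_scheme \<Rightarrow>
   ('k, ('k, 'b) vec, 'z) datum_alg_scheme \<Rightarrow> bool" where
  "comodule_algebra K H A \<longleftrightarrow> hom_algebra K A \<and> right_hom_comodule K H A (hcoact A) \<and>
    (\<forall>a\<in>carrier A. \<forall>b\<in>carrier A.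
      hcoact A (a \<otimes>\<^bsub>A\<^esub> b) = hcoact A a \<otimes>\<^bsub>A \<boxtimes>\<^bsub>K\<^esub> H\<^esub> hcoact A b) \<and>
    hcoact A \<one>\<^bsub>A\<^esub> = pure_tensor K A H \<one>\<^bsub>A\<^esub> \<one>\<^bsub>H\<^esub>"

definition module_coalgebra ::
  "('k, 'x) ring_scheme \<Rightarrow> ('k, ('k, 'b) vec, 'y) hom_hopf_scheme \<Rightarrow>
   ('k, ('k, 'b) vec, 'z) datum_coalg_scheme \<Rightarrow> bool" where
  "module_coalgebra K H C \<longleftrightarrow> hom_coalgebra K C \<and> left_hom_module K H C (hact C) \<and>
    (\<forall>h\<in>carrier H. \<forall>c\<in>carrier C.
      comult C (hact C h c) =
      sweedler (C \<boxtimes>\<^bsub>K\<^esub> C) (\<lambda>h\<^sub>1 h\<^sub>2. sweedler (C \<boxtimes>\<^bsub>K\<^esub> C) (\<lambda>c\<^sub>1 c\<^sub>2.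
        pure_tensor K C C (hact C h\<^sub>1 c\<^sub>1) (hact C h\<^sub>2 c\<^sub>2)) (comult C c)) (comult H h)) \<and>
    (\<forall>h\<in>carrier H. \<forall>c\<in>carrier C. counit C (hact C h c) = counit H h \<otimes>\<^bsub>K\<^esub> counit C c)"

definition doi_hopf_datum ::
  "('k, 'x) ring_scheme \<Rightarrow> ('k, ('k, 'b) vec, 'y) hom_hopf_scheme \<Rightarrow>
   ('k, ('k, 'b) vec, 'z) datum_alg_scheme \<Rightarrow> ('k, ('k, 'b) vec, 't) datum_coalg_scheme \<Rightarrow> bool" where
  "doi_hopf_datum K H A C \<longleftrightarrow>
    hom_hopf_algebra K H \<and> comodule_algebra K H A \<and> module_coalgebra K H C"

definition monoidal_doi_hopf_datum ::
  "('k, 'x) ring_scheme \<Rightarrow> ('k, ('k, 'b) vec, 'y) hom_hopf_scheme \<Rightarrow>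
   ('k, ('k, 'b) vec, 'z) datum_alg_scheme \<Rightarrow> ('k, ('k, 'b) vec, 't) datum_coalg_scheme \<Rightarrow> bool" where
  "monoidal_doi_hopf_datum K H A C \<longleftrightarrow> doi_hopf_datum K H A C \<and>
    hom_bialgebra K A \<and> hom_bialgebra K C \<and>
    (let AAC = A \<boxtimes>\<^bsub>K\<^esub> (A \<boxtimes>\<^bsub>K\<^esub> C);
         t = (\<lambda>x y z. pure_tensor K A (A \<boxtimes>\<^bsub>K\<^esub> C) x (pure_tensor K A C y z))
     in \<forall>a\<in>carrier A. \<forall>c\<in>carrier C. \<forall>d\<in>carrier C.
      sweedler AAC (\<lambda>a\<^sub>0 a\<^sub>1. sweedler AAC (\<lambda>a\<^sub>0\<^sub>1 a\<^sub>0\<^sub>2.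
        t a\<^sub>0\<^sub>1 a\<^sub>0\<^sub>2 (hact C (twist H (twist H a\<^sub>1)) (c \<otimes>\<^bsub>C\<^esub> d))) (comult A a\<^sub>0)) (hcoact A a) =
      sweedler AAC (\<lambda>a\<^sub>1 a\<^sub>2. sweedler AAC (\<lambda>a\<^sub>1\<^sub>0 a\<^sub>1\<^sub>1. sweedler AAC (\<lambda>a\<^sub>2\<^sub>0 a\<^sub>2\<^sub>1.
        t a\<^sub>1\<^sub>0 a\<^sub>2\<^sub>0 (hact C a\<^sub>1\<^sub>1 c \<otimes>\<^bsub>C\<^esub> hact C a\<^sub>2\<^sub>1 d)) (hcoact A a\<^sub>2)) (hcoact A a\<^sub>1)) (comult A a)) \<and>
    (\<forall>a\<in>carrier A. counit A a \<odot>\<^bsub>C\<^esub> \<one>\<^bsub>C\<^esub> =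
      sweedler C (\<lambda>a\<^sub>0 a\<^sub>1. counit A a\<^sub>0 \<odot>\<^bsub>C\<^esub> hact C a\<^sub>1 \<one>\<^bsub>C\<^esub>) (hcoact A a))"


section \<open>The category of Doi-Hopf modules\<close>

record ('k, 'v) dh_module = "('k, 'v) hom_space" +
  act :: "'v \<Rightarrow> 'v \<Rightarrow> 'v"
  coact :: "'v \<Rightarrow> 'v"

text \<open>\<open>H\<close> enters only through the \<open>H\<close>-coaction of \<open>A\<close> and the \<open>H\<close>-action on \<open>C\<close>.\<close>

definition doi_hopf_module ::
  "('k, 'x) ring_scheme \<Rightarrow> ('k, ('k, 'b) vec, 'y) datum_alg_scheme \<Rightarrow>
   ('k, ('k, 'b) vec, 'z) datum_coalg_scheme \<Rightarrow> ('k, ('k, 'b) vec) dh_module \<Rightarrow> bool" where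
  "doi_hopf_module K A C M \<longleftrightarrow>
    left_hom_module K A M (act M) \<and> right_hom_comodule K C M (coact M) \<and>
    (\<forall>a\<in>carrier A. \<forall>m\<in>carrier M.
      coact M (act M a m) =
      sweedler (M \<boxtimes>\<^bsub>K\<^esub> C) (\<lambda>a\<^sub>0 a\<^sub>1. sweedler (M \<boxtimes>\<^bsub>K\<^esub> C) (\<lambda>m\<^sub>0 m\<^sub>1.
        pure_tensor K M C (act M a\<^sub>0 m\<^sub>0) (hact C a\<^sub>1 m\<^sub>1)) (coact M m)) (hcoact A a))"

text \<open>Morphisms are extensional, so that they are determined by their values on the carrier.\<close>

definition dh_hom ::
  "('k, 'x) ring_scheme \<Rightarrow> ('k, ('k, 'b) vec, 'y) datum_alg_scheme \<Rightarrow>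
   ('k, ('k, 'b) vec, 'z) datum_coalg_scheme \<Rightarrow> ('k, ('k, 'b) vec) dh_module \<Rightarrow>
   ('k, ('k, 'b) vec) dh_module \<Rightarrow> (('k, 'b) vec \<Rightarrow> ('k, 'b) vec) set" where
  "dh_hom K A C M N = {f \<in> extensional (carrier M). linear_map K M N f \<and>
    (\<forall>m\<in>carrier M. f (twist M m) = twist N (f m)) \<and>
    (\<forall>a\<in>carrier A. \<forall>m\<in>carrier M. f (act M a m) = act N a (f m)) \<and>
    (\<forall>m\<in>carrier M. coact N (f m) = tensor_map K N C f (\<lambda>c. c) (coact M m))}"

text \<open>The tensor product, with the formulas for pure tensors extended linearly.\<close>

definition dh_tensor ::
  "('k, 'x) ring_scheme \<Rightarrow> ('k, ('k, 'b) vec, 'y) datum_alg_scheme \<Rightarrow>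
   ('k, ('k, 'b) vec, 'z) datum_coalg_scheme \<Rightarrow> ('k, ('k, 'b) vec) dh_module \<Rightarrow>
   ('k, ('k, 'b) vec) dh_module \<Rightarrow> ('k, ('k, 'b) vec) dh_module" where
  "dh_tensor K A C M N = (let MN = M \<boxtimes>\<^bsub>K\<^esub> N; MNC = MN \<boxtimes>\<^bsub>K\<^esub> C in
    hom_space.extend MN (dh_module.fields
      (\<lambda>a. sweedler MN (\<lambda>m n. sweedler MN (\<lambda>a\<^sub>1 a\<^sub>2.
        pure_tensor K M N (act M a\<^sub>1 m) (act N a\<^sub>2 n)) (comult A a)))
      (sweedler MNC (\<lambda>m n. sweedler MNC (\<lambda>m\<^sub>0 m\<^sub>1. sweedler MNC (\<lambda>n\<^sub>0 n\<^sub>1.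
        pure_tensor K MN C (pure_tensor K M N m\<^sub>0 n\<^sub>0) (twist_inv C (twist_inv C (m\<^sub>1 \<otimes>\<^bsub>C\<^esub> n\<^sub>1))))
          (coact N n)) (coact M m)))))"

definition unit_space :: "('k, 'x) ring_scheme \<Rightarrow> ('k, ('k, 'b) vec) hom_space" where
  "unit_space K =
   \<lparr> carrier = Scalar ` carrier K,
     mult = (\<lambda>s t. Scalar (scal s \<otimes>\<^bsub>K\<^esub> scal t)),
     one = Scalar \<one>\<^bsub>K\<^esub>,
     zero = Scalar \<zero>\<^bsub>K\<^esub>,
     add = (\<lambda>s t. Scalar (scal s \<oplus>\<^bsub>K\<^esub> scal t)),
     smult = (\<lambda>c t. Scalar (c \<otimes>\<^bsub>K\<^esub> scal t)),
     twist = (\<lambda>t. t) \<rparr>"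

definition dh_unit ::
  "('k, 'x) ring_scheme \<Rightarrow> ('k, ('k, 'b) vec, 'y) datum_alg_scheme \<Rightarrow>
   ('k, ('k, 'b) vec, 'z) datum_coalg_scheme \<Rightarrow> ('k, ('k, 'b) vec) dh_module" where
  "dh_unit K A C = hom_space.extend (unit_space K) (dh_module.fields
     (\<lambda>a t. counit A a \<odot>\<^bsub>unit_space K\<^esub> t)
     (\<lambda>t. pure_tensor K (unit_space K) C t \<one>\<^bsub>C\<^esub>))"

definition dh_category ::
  "('k, 'x) ring_scheme \<Rightarrow> ('k, ('k, 'b) vec, 'y) datum_alg_scheme \<Rightarrow>
   ('k, ('k, 'b) vec, 'z) datum_coalg_scheme \<Rightarrow>
   (('k, ('k, 'b) vec) dh_module, ('k, 'b) vec \<Rightarrow> ('k, 'b) vec) monoidal_cat" where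
  "dh_category K A C =
   \<lparr> Obj = {M. doi_hopf_module K A C M},
     Hom = dh_hom K A C,
     Ident = (\<lambda>M. restrict (\<lambda>m. m) (carrier M)),
     Comp = (\<lambda>L M N g f. compose (carrier L) g f),
     TObj = dh_tensor K A C,
     TArr = (\<lambda>M M' N N' f g. restrict (tensor_map K M' N' f g) (carrier (M \<boxtimes>\<^bsub>K\<^esub> N))),
     UnitObj = dh_unit K A C,
     Assoc = (\<lambda>M N P. restrict
       (sweedler (M \<boxtimes>\<^bsub>K\<^esub> (N \<boxtimes>\<^bsub>K\<^esub> P)) (\<lambda>t p. sweedler (M \<boxtimes>\<^bsub>K\<^esub> (N \<boxtimes>\<^bsub>K\<^esub> P)) (\<lambda>m n.
         pure_tensor K M (N \<boxtimes>\<^bsub>K\<^esub> P) (twist_inv M m) (pure_tensor K N P n (twist P p))) t))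
       (carrier ((M \<boxtimes>\<^bsub>K\<^esub> N) \<boxtimes>\<^bsub>K\<^esub> P))),
     LUnit = (\<lambda>M. restrict (sweedler M (\<lambda>l m. scal l \<odot>\<^bsub>M\<^esub> twist_inv M m))
       (carrier (dh_unit K A C \<boxtimes>\<^bsub>K\<^esub> M))),
     RUnit = (\<lambda>M. restrict (sweedler M (\<lambda>m l. scal l \<odot>\<^bsub>M\<^esub> twist_inv M m))
       (carrier (M \<boxtimes>\<^bsub>K\<^esub> dh_unit K A C))) \<rparr>"

end

theory Submission
  imports Defs
begin

text \<open>
  Write \<open>\<phi>(c, d) = \<alpha>\<^sup>-\<^sup>2(c d)\<close> for \<open>c\<close>, \<open>d\<close> in the Hom-bialgebra \<open>C\<close>. Apart from the powers of the
  structure maps, \<open>M \<otimes> N\<close> is a module because it is a module over \<open>A \<otimes> A\<close> and \<open>\<Delta>\<close> is an algebra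
  map, and it is a comodule because it is a comodule over \<open>C \<otimes> C\<close> and \<open>\<phi>\<close> is a coalgebra map (\<open>\<Delta>\<close> and
  \<open>\<epsilon>\<close> of \<open>C\<close> are multiplicative and commute with \<open>\<alpha>\<close>). For the compatibility of action and coaction,
  \<open>\<rho>(a \<cdot> (m \<otimes> n)) = a\<^sub>1\<^sub>0 \<cdot> m\<^sub>0 \<otimes> a\<^sub>2\<^sub>0 \<cdot> n\<^sub>0 \<otimes> \<phi>(a\<^sub>1\<^sub>1 \<cdot> m\<^sub>1, a\<^sub>2\<^sub>1 \<cdot> n\<^sub>1)\<close>,
  and the first axiom of a monoidal datum, with \<open>c\<close>, \<open>d\<close> the coefficients of \<open>m\<close>, \<open>n\<close>, turns the last factor into
  \<open>\<alpha>\<^sup>-\<^sup>2(\<alpha>\<^sup>2(h) \<cdot> (c d)) = h \<cdot> \<phi>(c, d)\<close>: the exponent in \<open>\<phi>\<close> is chosen to cancel the \<open>\<alpha>\<^sup>2\<close> of that axiom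
  (\<open>coact_act_tensor_pure\<close>). The second axiom is exactly the compatibility for the unit object.

  The associativity constraint is \<open>A\<close>-linear by the coassociativity of \<open>A\<close> and \<open>C\<close>-colinear by the
  Hom-associativity of \<open>C\<close>; the unit constraints use the counit of \<open>A\<close> and the unit of \<open>C\<close>. Naturality
  holds because morphisms commute with the structure maps, and pentagon and triangle are comparisons of
  powers of \<open>\<alpha>\<close> on pure tensors.

  What remains is to give a meaning to such calculations with elements. Tensor products are spaces of
  representatives of formal sums, so the universal property comes first (\<open>sweedler_tensor_eq\<close>,
  \<open>module_tensor\<close>). An iterated Sweedler sum is then an iterated application of induced linear maps
  \<open>tensor_lift\<close>, and three rules suffice: linear maps pass under the sum (\<open>linear_tensor_lift\<close>),
  independent sums commute (\<open>tensor_lift_swap\<close>), and linear maps that agree on pure tensors are equal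
  (\<open>linear_map_eq_on_tensor\<close>). The axioms of comodules, coalgebras and data enter in the form obtained
  by applying the map induced by an arbitrary multilinear expression to both sides.
\<close>

section \<open>Linear maps\<close>

lemma linear_map_closed:
  "linear_map K V W f \<Longrightarrow> x \<in> carrier V \<Longrightarrow> f x \<in> carrier W"
  by (auto simp: linear_map_def)

lemma linear_map_add:
  "linear_map K V W f \<Longrightarrow> x \<in> carrier V \<Longrightarrow> y \<in> carrier V \<Longrightarrow>
   f (x \<oplus>\<^bsub>V\<^esub> y) = f x \<oplus>\<^bsub>W\<^esub> f y"
  by (auto simp: linear_map_def)

lemma linear_map_smult:
  "linear_map K V W f \<Longrightarrow> c \<in> carrier K \<Longrightarrow> x \<in> carrier V \<Longrightarrow>
   f (c \<odot>\<^bsub>V\<^esub> x) = c \<odot>\<^bsub>W\<^esub> f x"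
  by (auto simp: linear_map_def)

lemma module_zero_smult:
  assumes "module K V" "v \<in> carrier V"
  shows "\<zero>\<^bsub>K\<^esub> \<odot>\<^bsub>V\<^esub> v = \<zero>\<^bsub>V\<^esub>"
  using module.smult_l_null[OF assms] .

lemma module_zero_closed: "module K V \<Longrightarrow> \<zero>\<^bsub>V\<^esub> \<in> carrier V"
  by (simp add: abelian_group.axioms(1) abelian_monoid.zero_closed module.axioms(2))

lemma module_scalar_zero_closed: "module K V \<Longrightarrow> \<zero>\<^bsub>K\<^esub> \<in> carrier K"
  by (simp add: cring.cring_simprules(2) module.axioms(1))

lemma module_add_closed:
  "module K V \<Longrightarrow> v \<in> carrier V \<Longrightarrow> w \<in> carrier V \<Longrightarrow> v \<oplus>\<^bsub>V\<^esub> w \<in> carrier V"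
  by (simp add: abelian_group.axioms(1) abelian_monoid.a_closed module.axioms(2))

lemma linear_map_zero:
  assumes "module K V" "module K W" "linear_map K V W f"
  shows "f \<zero>\<^bsub>V\<^esub> = \<zero>\<^bsub>W\<^esub>"
proof -
  have z: "\<zero>\<^bsub>V\<^esub> \<in> carrier V" "\<zero>\<^bsub>K\<^esub> \<in> carrier K"
    using assms by (auto intro: module_zero_closed module_scalar_zero_closed)
  then have "f \<zero>\<^bsub>V\<^esub> = \<zero>\<^bsub>K\<^esub> \<odot>\<^bsub>W\<^esub> f \<zero>\<^bsub>V\<^esub>"
    using linear_map_smult[OF assms(3), of "\<zero>\<^bsub>K\<^esub>" "\<zero>\<^bsub>V\<^esub>"]
    by (simp add: module_zero_smult[OF assms(1)])
  also have "\<dots> = \<zero>\<^bsub>W\<^esub>"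
    using linear_map_closed[OF assms(3) z(1)] by (rule module_zero_smult[OF assms(2)])
  finally show ?thesis .
qed

lemma bilinear_mapD1: "bilinear_map K V W U f \<Longrightarrow> v \<in> carrier V \<Longrightarrow> linear_map K W U (f v)"
  by (auto simp: bilinear_map_def)

lemma bilinear_mapD2:
  "bilinear_map K V W U f \<Longrightarrow> w \<in> carrier W \<Longrightarrow> linear_map K V U (\<lambda>v. f v w)"
  by (auto simp: bilinear_map_def)

lemma bilinear_map_closed:
  "bilinear_map K V W U f \<Longrightarrow> v \<in> carrier V \<Longrightarrow> w \<in> carrier W \<Longrightarrow> f v w \<in> carrier U"
  by (auto dest: bilinear_mapD1 linear_map_closed)

section \<open>Tensor products\<close>

lemma sweedler_Nil [simp]: "sweedler U f (Formal []) = \<zero>\<^bsub>U\<^esub>"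
  and sweedler_Cons [simp]:
    "sweedler U f (Formal ((v, w) # xs)) = f v w \<oplus>\<^bsub>U\<^esub> sweedler U f (Formal xs)"
  by (auto simp: sweedler_def)

lemma sweedler_formal_closed:
  assumes "module K U" "\<And>v w. v \<in> carrier V \<Longrightarrow> w \<in> carrier W \<Longrightarrow> f v w \<in> carrier U"
    "set xs \<subseteq> carrier V \<times> carrier W"
  shows "sweedler U f (Formal xs) \<in> carrier U"
  using assms(3) by (induction xs) (auto intro!: module_zero_closed module_add_closed[OF assms(1)] assms)

lemma sweedler_append:
  assumes U: "module K U" and f: "\<And>v w. v \<in> carrier V \<Longrightarrow> w \<in> carrier W \<Longrightarrow> f v w \<in> carrier U"
    and "set xs \<subseteq> carrier V \<times> carrier W" and ys: "set ys \<subseteq> carrier V \<times> carrier W"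
  shows "sweedler U f (Formal (xs @ ys)) = sweedler U f (Formal xs) \<oplus>\<^bsub>U\<^esub> sweedler U f (Formal ys)"
proof -
  interpret U: abelian_group U using U by (rule module.axioms)
  have cl: "sweedler U f (Formal zs) \<in> carrier U" if "set zs \<subseteq> carrier V \<times> carrier W" for zs
    by (rule sweedler_formal_closed[OF U _ that]) (rule f)
  show ?thesis using assms(3)
  proof (induction xs)
    case Nil
    then show ?case using U.l_zero[OF cl[OF ys]] by simp
  next
    case (Cons p xs)
    obtain v w where p: "p = (v, w)" by (cases p)
    then show ?case
      using Cons cl[of xs] cl[OF ys] f[of v w] by (simp add: U.a_assoc)
  qed
qed

lemma sweedler_formal_cong:
  assumes "set xs \<subseteq> carrier V \<times> carrier W"
    "\<And>v w. v \<in> carrier V \<Longrightarrow> w \<in> carrier W \<Longrightarrow> f v w = g v w"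
  shows "sweedler U f (Formal xs) = sweedler U g (Formal xs)"
  using assms(1) by (induction xs) (auto simp: assms(2))

lemma linear_map_sweedler_formal:
  assumes U: "module K U" "module K U'" and g: "linear_map K U U' g"
    and f: "\<And>v w. v \<in> carrier V \<Longrightarrow> w \<in> carrier W \<Longrightarrow> f v w \<in> carrier U"
    and "set xs \<subseteq> carrier V \<times> carrier W"
  shows "g (sweedler U f (Formal xs)) = sweedler U' (\<lambda>v w. g (f v w)) (Formal xs)"
  using assms(5)
proof (induction xs)
  case Nil
  then show ?case using linear_map_zero[OF U g] by simp
next
  case (Cons p xs)
  then have "sweedler U f (Formal xs) \<in> carrier U"
    by (intro sweedler_formal_closed[OF U(1)]) (auto intro: f)
  with Cons show ?case
    using f by (cases p) (simp add: linear_map_add[OF g])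
qed

text \<open>
  Each relation has both of its sides over \<open>V \<times> W\<close> or neither. Hence the representative chosen by
  \<open>tensor_of\<close> for a sum over \<open>V \<times> W\<close> is again over \<open>V \<times> W\<close>, although the choice ranges over all
  equivalent lists.
\<close>

lemma tensor_eq_carrier:
  assumes "module K V" "module K W" "tensor_eq K V W xs ys"
  shows "set xs \<subseteq> carrier V \<times> carrier W \<longleftrightarrow> set ys \<subseteq> carrier V \<times> carrier W"
  using assms(3)
  by (induction rule: tensor_eq.induct)
    (auto intro: module_zero_closed[OF assms(1)] module_add_closed[OF assms(1)]
      module_add_closed[OF assms(2)] module.smult_closed[OF assms(1)]
      module.smult_closed[OF assms(2)])

text \<open>The relations imposed on formal sums are exactly those which a bilinear map respects.\<close>

lemma sweedler_tensor_eq: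
  assumes V: "module K V" and W: "module K W" and U: "module K U"
    and f: "bilinear_map K V W U f"
    and "tensor_eq K V W xs ys" "set xs \<subseteq> carrier V \<times> carrier W"
  shows "sweedler U f (Formal xs) = sweedler U f (Formal ys)"
  using assms(5,6)
proof (induction rule: tensor_eq.induct)
  interpret U: abelian_group U using U by (rule module.axioms)
  note cl = bilinear_map_closed[OF f]
  have fcl: "sweedler U f (Formal zs) \<in> carrier U" if "set zs \<subseteq> carrier V \<times> carrier W" for zs
    by (rule sweedler_formal_closed[OF U _ that]) (rule cl)
  have app: "sweedler U f (Formal (xs @ ys)) =
      sweedler U f (Formal xs) \<oplus>\<^bsub>U\<^esub> sweedler U f (Formal ys)"
    if "set xs \<subseteq> carrier V \<times> carrier W" "set ys \<subseteq> carrier V \<times> carrier W" for xs ys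
    by (rule sweedler_append[OF U _ that]) (rule cl)
  note carr = tensor_eq_carrier[OF V W]
  {
    case (refl xs)
    show ?case by simp
  next
    case (sym xs ys)
    then show ?case using carr[of xs ys] by simp
  next
    case (trans xs ys zs)
    then show ?case using carr[of xs ys] carr[of ys zs] by simp
  next
    case (append xs xs' ys ys')
    then have "set xs' \<subseteq> carrier V \<times> carrier W" "set ys' \<subseteq> carrier V \<times> carrier W"
      using carr[of xs xs'] carr[of ys ys'] by auto
    then show ?case using append by (simp add: app)
  next
    case (comm xs ys)
    then show ?case using fcl[of xs] fcl[of ys] by (simp add: app U.a_comm)
  next
    case (zero w)
    then show ?case using linear_map_zero[OF V U bilinear_mapD2[OF f]] by simp
  next
    case (add_left v v' w)
    then show ?case using linear_map_add[OF bilinear_mapD2[OF f]]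
      by (simp add: cl U.a_assoc)
  next
    case (add_right v w w')
    then show ?case using linear_map_add[OF bilinear_mapD1[OF f]]
      by (simp add: cl U.a_assoc)
  next
    case (balanced c v w)
    then show ?case using linear_map_smult[OF bilinear_mapD1[OF f]]
        linear_map_smult[OF bilinear_mapD2[OF f]]
      by (simp add: cl)
  }
qed

lemma summands_tensor_of: "tensor_eq K V W xs (summands (tensor_of K V W xs))"
  by (simp add: tensor_of_def) (rule someI, rule tensor_eq.refl)

lemma tensor_of_cong: "tensor_eq K V W xs ys \<Longrightarrow> tensor_of K V W xs = tensor_of K V W ys"
proof -
  assume "tensor_eq K V W xs ys"
  then have "tensor_eq K V W xs = tensor_eq K V W ys"
    by (intro ext iffI) (blast intro: tensor_eq.sym tensor_eq.trans)+
  then show ?thesis by (simp add: tensor_of_def)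
qed

lemma carrier_tensor:
  "carrier (V \<boxtimes>\<^bsub>K\<^esub> W) = {tensor_of K V W xs | xs. set xs \<subseteq> carrier V \<times> carrier W}"
  by (simp add: tensor_def)

lemma tensor_of_closed:
  "set xs \<subseteq> carrier V \<times> carrier W \<Longrightarrow> tensor_of K V W xs \<in> carrier (V \<boxtimes>\<^bsub>K\<^esub> W)"
  by (auto simp: carrier_tensor)

lemma tensor_carrierE:
  assumes "t \<in> carrier (V \<boxtimes>\<^bsub>K\<^esub> W)"
  obtains xs where "set xs \<subseteq> carrier V \<times> carrier W" "t = tensor_of K V W xs"
  using assms by (auto simp: carrier_tensor)

lemma tensor_carrierD:
  assumes "module K V" "module K W" "t \<in> carrier (V \<boxtimes>\<^bsub>K\<^esub> W)"
  shows "set (summands t) \<subseteq> carrier V \<times> carrier W"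
  using assms tensor_eq_carrier[OF assms(1,2) summands_tensor_of] by (auto simp: carrier_tensor)

text \<open>
  This makes scalar multiplication and the structure map of \<open>V \<otimes> W\<close>, which are defined on
  representatives, independent of the representative.
\<close>

lemma tensor_eq_map:
  assumes "module K V" "module K W" "module K V'" "module K W'"
    and f: "linear_map K V V' f" and g: "linear_map K W W' g"
    and "tensor_eq K V W xs ys"
  shows "tensor_eq K V' W' (map (\<lambda>(v, w). (f v, g w)) xs) (map (\<lambda>(v, w). (f v, g w)) ys)"
  using assms(7)
proof (induction rule: tensor_eq.induct)
  case (sym xs ys)
  show ?case by (rule tensor_eq.sym[OF sym.IH])
next
  case (trans xs ys zs)
  show ?case by (rule tensor_eq.trans[OF trans.IH])
next
  case (comm xs ys)
  show ?case by (simp add: tensor_eq.comm del: map_append add: map_append[of _ xs ys] map_append[of _ ys xs])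
next
  case (append xs xs' ys ys')
  then show ?case by (simp add: tensor_eq.append)
next
  case (refl xs)
  show ?case by (rule tensor_eq.refl)
next
  case (zero w)
  then show ?case
    using linear_map_zero[OF assms(1,3) f] linear_map_closed[OF g] by (simp add: tensor_eq.zero)
qed (use linear_map_closed[OF f] linear_map_closed[OF g] in
    \<open>simp_all add: tensor_eq.add_left tensor_eq.add_right tensor_eq.balanced linear_map_add[OF f] linear_map_smult[OF f]
      linear_map_add[OF g] linear_map_smult[OF g]\<close>)

lemma tensor_add:
  "tensor_of K V W xs \<oplus>\<^bsub>V \<boxtimes>\<^bsub>K\<^esub> W\<^esub> tensor_of K V W ys = tensor_of K V W (xs @ ys)"
proof -
  have "tensor_eq K V W (xs @ ys) (summands (tensor_of K V W xs) @ summands (tensor_of K V W ys))"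
    by (intro tensor_eq.append summands_tensor_of)
  then show ?thesis by (simp add: tensor_def tensor_of_cong)
qed

lemma tensor_zero: "\<zero>\<^bsub>V \<boxtimes>\<^bsub>K\<^esub> W\<^esub> = tensor_of K V W []"
  by (simp add: tensor_def)

lemma linear_map_ident: "linear_map K V V (\<lambda>x. x)"
  by (simp add: linear_map_def)

lemma linear_map_smult_const:
  assumes "module K V" "c \<in> carrier K"
  shows "linear_map K V V (\<lambda>x. c \<odot>\<^bsub>V\<^esub> x)"
proof -
  interpret module K V by fact
  show ?thesis using assms(2)
    by (auto simp: linear_map_def smult_r_distr smult_assoc1[symmetric] R.m_comm)
qed

lemma tensor_smult:
  assumes "module K V" "module K W" "c \<in> carrier K"
  shows "c \<odot>\<^bsub>V \<boxtimes>\<^bsub>K\<^esub> W\<^esub> tensor_of K V W xs = tensor_of K V W (map (\<lambda>(v, w). (c \<odot>\<^bsub>V\<^esub> v, w)) xs)"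
proof -
  have "tensor_eq K V W (map (\<lambda>(v, w). (c \<odot>\<^bsub>V\<^esub> v, w)) xs)
     (map (\<lambda>(v, w). (c \<odot>\<^bsub>V\<^esub> v, w)) (summands (tensor_of K V W xs)))"
    by (rule tensor_eq_map[OF assms(1,2,1,2) linear_map_smult_const[OF assms(1,3)]
          linear_map_ident summands_tensor_of])
  moreover have "map (\<lambda>(v, w). (c \<odot>\<^bsub>V\<^esub> v, w)) ys = [(c \<odot>\<^bsub>V\<^esub> v, w). (v, w) \<leftarrow> ys]" for ys
    by (induction ys) auto
  ultimately show ?thesis by (simp add: tensor_def tensor_of_cong)
qed

lemma tensor_twist:
  assumes "module K V" "module K W" "linear_map K V V (twist V)" "linear_map K W W (twist W)"
  shows "twist (V \<boxtimes>\<^bsub>K\<^esub> W) (tensor_of K V W xs) =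
    tensor_of K V W (map (\<lambda>(v, w). (twist V v, twist W w)) xs)"
proof -
  have "tensor_eq K V W (map (\<lambda>(v, w). (twist V v, twist W w)) xs)
     (map (\<lambda>(v, w). (twist V v, twist W w)) (summands (tensor_of K V W xs)))"
    by (rule tensor_eq_map[OF assms(1,2,1,2) assms(3,4) summands_tensor_of])
  moreover have "map (\<lambda>(v, w). (twist V v, twist W w)) ys = [(twist V v, twist W w). (v, w) \<leftarrow> ys]" for ys
    by (induction ys) auto
  ultimately show ?thesis by (simp add: tensor_def tensor_of_cong)
qed

text \<open>In \<open>(a + b) t\<close> the two copies of the formal sum have to be shuffled together, one summand at a time.\<close>

lemma tensor_eq_smult_distrib:
  assumes V: "module K V" and "a \<in> carrier K" "b \<in> carrier K" "set xs \<subseteq> carrier V \<times> carrier W"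
  shows "tensor_eq K V W (map (\<lambda>(v, w). ((a \<oplus>\<^bsub>K\<^esub> b) \<odot>\<^bsub>V\<^esub> v, w)) xs)
    (map (\<lambda>(v, w). (a \<odot>\<^bsub>V\<^esub> v, w)) xs @ map (\<lambda>(v, w). (b \<odot>\<^bsub>V\<^esub> v, w)) xs)"
  using assms(4)
proof (induction xs)
  case Nil
  then show ?case by (simp add: tensor_eq.refl)
next
  case (Cons p xs)
  interpret module K V by fact
  obtain v w where p: "p = (v, w)" by (cases p)
  let ?A = "map (\<lambda>(v, w). (a \<odot>\<^bsub>V\<^esub> v, w)) xs" and ?B = "map (\<lambda>(v, w). (b \<odot>\<^bsub>V\<^esub> v, w)) xs"
  have "tensor_eq K V W [((a \<oplus>\<^bsub>K\<^esub> b) \<odot>\<^bsub>V\<^esub> v, w)] [(a \<odot>\<^bsub>V\<^esub> v, w), (b \<odot>\<^bsub>V\<^esub> v, w)]"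
    using Cons.prems assms p by (auto simp: smult_l_distr intro: tensor_eq.add_left)
  with Cons have "tensor_eq K V W (map (\<lambda>(v, w). ((a \<oplus>\<^bsub>K\<^esub> b) \<odot>\<^bsub>V\<^esub> v, w)) (p # xs))
      ([(a \<odot>\<^bsub>V\<^esub> v, w)] @ (([(b \<odot>\<^bsub>V\<^esub> v, w)] @ ?A) @ ?B))"
    using tensor_eq.append[of K V W "[((a \<oplus>\<^bsub>K\<^esub> b) \<odot>\<^bsub>V\<^esub> v, w)]" "[(a \<odot>\<^bsub>V\<^esub> v, w), (b \<odot>\<^bsub>V\<^esub> v, w)]"]
    by (simp add: p)
  also have "tensor_eq K V W \<dots> ([(a \<odot>\<^bsub>V\<^esub> v, w)] @ ((?A @ [(b \<odot>\<^bsub>V\<^esub> v, w)]) @ ?B))"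
    by (intro tensor_eq.append tensor_eq.refl tensor_eq.comm)
  finally (tensor_eq.trans) show ?case by (simp add: p)
qed

text \<open>
  Negatives need no construction of their own: \<open>(-1) t + 1 t = 0 t = 0\<close> by distributivity.
\<close>

lemma module_tensor:
  assumes V: "module K V" and W: "module K W"
  shows "module K (V \<boxtimes>\<^bsub>K\<^esub> W)"
proof -
  interpret V: module K V by fact
  interpret W: module K W by fact
  let ?T = "V \<boxtimes>\<^bsub>K\<^esub> W"
  note [elim] = tensor_carrierE
  have sc: "set (map (\<lambda>(v, w). (c \<odot>\<^bsub>V\<^esub> v, w)) xs) \<subseteq> carrier V \<times> carrier W"
    if "c \<in> carrier K" "set xs \<subseteq> carrier V \<times> carrier W" for c xs
    using that by auto
  have l_distr: "(a \<oplus>\<^bsub>K\<^esub> b) \<odot>\<^bsub>?T\<^esub> x = a \<odot>\<^bsub>?T\<^esub> x \<oplus>\<^bsub>?T\<^esub> b \<odot>\<^bsub>?T\<^esub> x"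
    if "a \<in> carrier K" "b \<in> carrier K" "x \<in> carrier ?T" for a b x
    using that(3) by (elim tensor_carrierE)
      (use that(1,2) in \<open>simp add: tensor_smult[OF V W] tensor_add tensor_of_cong[OF tensor_eq_smult_distrib[OF V]]\<close>)
  have one: "\<one>\<^bsub>K\<^esub> \<odot>\<^bsub>?T\<^esub> x = x" if "x \<in> carrier ?T" for x
    using that
  proof (elim tensor_carrierE)
    fix xs assume "set xs \<subseteq> carrier V \<times> carrier W" and x: "x = tensor_of K V W xs"
    then have "map (\<lambda>(v, w). (\<one>\<^bsub>K\<^esub> \<odot>\<^bsub>V\<^esub> v, w)) xs = xs" by (induction xs arbitrary: x) auto
    then show ?thesis by (simp add: x tensor_smult[OF V W])
  qed
  have zero: "\<zero>\<^bsub>K\<^esub> \<odot>\<^bsub>?T\<^esub> x = \<zero>\<^bsub>?T\<^esub>" if "x \<in> carrier ?T" for x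
    using that
  proof (elim tensor_carrierE)
    fix xs assume xs: "set xs \<subseteq> carrier V \<times> carrier W" and x: "x = tensor_of K V W xs"
    have "tensor_eq K V W (map (\<lambda>(v, w). (\<zero>\<^bsub>K\<^esub> \<odot>\<^bsub>V\<^esub> v, w)) xs) []"
      using xs
    proof (induction xs)
      case (Cons p xs)
      obtain v w where p: "p = (v, w)" by (cases p)
      then show ?case
        using Cons tensor_eq.append[of K V W "[(\<zero>\<^bsub>V\<^esub>, w)]" "[]" _ "[]", OF tensor_eq.zero]
        by simp
    qed (simp add: tensor_eq.refl)
    then show ?thesis by (simp add: x tensor_smult[OF V W] tensor_zero tensor_of_cong)
  qed
  have cl: "c \<odot>\<^bsub>?T\<^esub> x \<in> carrier ?T" if "c \<in> carrier K" "x \<in> carrier ?T" for c x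
    using that(2) by (elim tensor_carrierE)
      (use that(1) sc in \<open>simp add: tensor_smult[OF V W] tensor_of_closed\<close>)
  show ?thesis
  proof (rule moduleI)
    show "cring K" by (rule V.is_cring)
    show "abelian_group ?T"
    proof (rule abelian_groupI)
      fix x y z assume x: "x \<in> carrier ?T" and y: "y \<in> carrier ?T" and z: "z \<in> carrier ?T"
      show "x \<oplus>\<^bsub>?T\<^esub> y \<in> carrier ?T"
        using x y by (elim tensor_carrierE) (simp add: tensor_add tensor_of_closed)
      show "(x \<oplus>\<^bsub>?T\<^esub> y) \<oplus>\<^bsub>?T\<^esub> z = x \<oplus>\<^bsub>?T\<^esub> (y \<oplus>\<^bsub>?T\<^esub> z)"
        using x y z by (elim tensor_carrierE) (simp add: tensor_add)
      show "x \<oplus>\<^bsub>?T\<^esub> y = y \<oplus>\<^bsub>?T\<^esub> x"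
        using x y by (elim tensor_carrierE) (simp add: tensor_add tensor_of_cong[OF tensor_eq.comm])
    next
      fix x assume x: "x \<in> carrier ?T"
      then show "\<zero>\<^bsub>?T\<^esub> \<oplus>\<^bsub>?T\<^esub> x = x"
        by (elim tensor_carrierE) (simp add: tensor_add tensor_zero)
      have "(\<ominus>\<^bsub>K\<^esub> \<one>\<^bsub>K\<^esub>) \<odot>\<^bsub>?T\<^esub> x \<oplus>\<^bsub>?T\<^esub> x = (\<ominus>\<^bsub>K\<^esub> \<one>\<^bsub>K\<^esub>) \<odot>\<^bsub>?T\<^esub> x \<oplus>\<^bsub>?T\<^esub> \<one>\<^bsub>K\<^esub> \<odot>\<^bsub>?T\<^esub> x"
        by (simp add: one x)
      also have "\<dots> = \<zero>\<^bsub>?T\<^esub>"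
        using x by (simp add: l_distr[symmetric] V.R.l_neg zero)
      finally show "\<exists>y\<in>carrier ?T. y \<oplus>\<^bsub>?T\<^esub> x = \<zero>\<^bsub>?T\<^esub>"
        using x cl by blast
    qed (simp add: tensor_zero tensor_of_closed)
  next
    fix a x y assume "a \<in> carrier K" "x \<in> carrier ?T" "y \<in> carrier ?T"
    then show "a \<odot>\<^bsub>?T\<^esub> (x \<oplus>\<^bsub>?T\<^esub> y) = a \<odot>\<^bsub>?T\<^esub> x \<oplus>\<^bsub>?T\<^esub> a \<odot>\<^bsub>?T\<^esub> y"
      by (elim tensor_carrierE) (simp add: tensor_add tensor_smult[OF V W])
  next
    fix a b x assume a: "a \<in> carrier K" "b \<in> carrier K" and "x \<in> carrier ?T"
    from this(3) show "(a \<otimes>\<^bsub>K\<^esub> b) \<odot>\<^bsub>?T\<^esub> x = a \<odot>\<^bsub>?T\<^esub> (b \<odot>\<^bsub>?T\<^esub> x)"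
    proof (elim tensor_carrierE)
      fix xs assume "set xs \<subseteq> carrier V \<times> carrier W" and x: "x = tensor_of K V W xs"
      then have m: "map (\<lambda>(v, w). ((a \<otimes>\<^bsub>K\<^esub> b) \<odot>\<^bsub>V\<^esub> v, w)) xs =
          map (\<lambda>(v, w). (a \<odot>\<^bsub>V\<^esub> v, w)) (map (\<lambda>(v, w). (b \<odot>\<^bsub>V\<^esub> v, w)) xs)"
        using a by (induction xs arbitrary: x) (auto simp: V.smult_assoc1)
      show ?thesis using a by (simp add: x tensor_smult[OF V W] m del: map_map)
    qed
  qed (use l_distr one cl in auto)
qed

lemma pure_tensor_closed:
  "v \<in> carrier V \<Longrightarrow> w \<in> carrier W \<Longrightarrow> pure_tensor K V W v w \<in> carrier (V \<boxtimes>\<^bsub>K\<^esub> W)"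
  by (simp add: pure_tensor_def tensor_of_closed)

lemma bilinear_pure_tensor:
  assumes V: "module K V" and W: "module K W"
  shows "bilinear_map K V W (V \<boxtimes>\<^bsub>K\<^esub> W) (pure_tensor K V W)"
  unfolding bilinear_map_def linear_map_def
  by (auto simp: pure_tensor_closed)
    (simp_all add: pure_tensor_def tensor_add tensor_smult[OF V W] tensor_of_cong[OF tensor_eq.add_left]
      tensor_of_cong[OF tensor_eq.add_right] tensor_of_cong[OF tensor_eq.balanced])

lemma tensor_of_eq_sweedler:
  "tensor_of K V W xs = sweedler (V \<boxtimes>\<^bsub>K\<^esub> W) (pure_tensor K V W) (Formal xs)"
proof (induction xs)
  case (Cons p xs)
  obtain v w where p: "p = (v, w)" by (cases p)
  have "tensor_of K V W (p # xs) = pure_tensor K V W v w \<oplus>\<^bsub>V \<boxtimes>\<^bsub>K\<^esub> W\<^esub> tensor_of K V W xs"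
    by (simp add: p pure_tensor_def tensor_add)
  then show ?case by (simp add: p Cons)
qed (simp add: tensor_zero)

text \<open>The universal property, stated for a chosen formal sum.\<close>

lemma sweedler_tensor_of:
  assumes "module K V" "module K W" "module K U" "bilinear_map K V W U f"
    "set xs \<subseteq> carrier V \<times> carrier W"
  shows "sweedler U f (tensor_of K V W xs) = sweedler U f (Formal xs)"
  using sweedler_tensor_eq[OF assms(1-4) summands_tensor_of assms(5)]
  by (simp add: sweedler_def)

section \<open>Maps out of a tensor product\<close>

lemma hom_space_module: "hom_space K V \<Longrightarrow> module K V"
  and hom_space_twist: "hom_space K V \<Longrightarrow> linear_map K V V (twist V)"
  and hom_space_bij: "hom_space K V \<Longrightarrow> bij_betw (twist V) (carrier V) (carrier V)"
  by (auto simp: hom_space_def)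

text \<open>
  The linear map \<open>V \<otimes> W \<rightarrow> U\<close> induced by \<open>f\<close>. It agrees with \<^const>\<open>sweedler\<close>, but names the factors
  \<open>V\<close> and \<open>W\<close>, so that the hypotheses of the calculation rules can be read off from the term, and the
  variables of \<open>f\<close> are known to range over \<open>V\<close> and \<open>W\<close>. With the default value zero,
  linear maps pass under the sum for every argument.
\<close>

definition tensor_lift ::
  "('k, 'x) ring_scheme \<Rightarrow> ('k, ('k, 'b) vec, 'y) hom_space_scheme \<Rightarrow>
   ('k, ('k, 'b) vec, 'z) hom_space_scheme \<Rightarrow> ('k, 'u, 't) module_scheme \<Rightarrow>
   (('k, 'b) vec \<Rightarrow> ('k, 'b) vec \<Rightarrow> 'u) \<Rightarrow> ('k, 'b) vec \<Rightarrow> 'u" where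
  "tensor_lift K V W U f t = (if t \<in> carrier (V \<boxtimes>\<^bsub>K\<^esub> W) \<and> module K V \<and> module K W then sweedler U f t else \<zero>\<^bsub>U\<^esub>)"

lemma sweedler_eq_tensor_lift:
  "t \<in> carrier (V \<boxtimes>\<^bsub>K\<^esub> W) \<Longrightarrow> module K V \<Longrightarrow> module K W \<Longrightarrow> sweedler U f t = tensor_lift K V W U f t"
  by (simp add: tensor_lift_def)

lemma tensor_lift_cong:
  assumes "t = t'" "\<And>v w. v \<in> carrier V \<Longrightarrow> w \<in> carrier W \<Longrightarrow> f v w = g v w"
  shows "tensor_lift K V W U f t = tensor_lift K V W U g t'"
proof (cases "t' \<in> carrier (V \<boxtimes>\<^bsub>K\<^esub> W) \<and> module K V \<and> module K W")
  case True
  then have "set (summands t') \<subseteq> carrier V \<times> carrier W"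
    using tensor_carrierD by blast
  from sweedler_formal_cong[OF this assms(2), where U = U] assms(1) show ?thesis
    by (simp add: tensor_lift_def sweedler_def)
qed (auto simp: tensor_lift_def assms(1))

lemma tensor_lift_space_cong [cong]:
  assumes "V = V'" "W = W'" "U = U'" "t = t'"
    "\<And>v w. v \<in> carrier V' \<Longrightarrow> w \<in> carrier W' \<Longrightarrow> f v w = g v w"
  shows "tensor_lift K V W U f t = tensor_lift K V' W' U' g t'"
  using tensor_lift_cong[of t t' V' W' f g] assms by simp

lemma tensor_lift_tensor_of:
  assumes "module K V" "module K W" "module K U" "bilinear_map K V W U f"
    "set xs \<subseteq> carrier V \<times> carrier W"
  shows "tensor_lift K V W U f (tensor_of K V W xs) = sweedler U f (Formal xs)"
  using assms sweedler_tensor_of[OF assms] by (simp add: tensor_lift_def tensor_of_closed)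

lemma tensor_lift_pure:
  assumes "module K V" "module K W" "module K U" "v \<in> carrier V" "w \<in> carrier W"
    "bilinear_map K V W U f"
  shows "tensor_lift K V W U f (pure_tensor K V W v w) = f v w"
proof -
  interpret U: abelian_group U using assms(3) by (rule module.axioms)
  show ?thesis using assms tensor_lift_tensor_of[of K V W U f "[(v, w)]"] bilinear_map_closed[OF assms(6), of v w]
    by (simp add: pure_tensor_def)
qed

lemma tensor_lift_closed:
  assumes "module K U" "\<And>v w. v \<in> carrier V \<Longrightarrow> w \<in> carrier W \<Longrightarrow> f v w \<in> carrier U"
  shows "tensor_lift K V W U f t \<in> carrier U"
proof (cases "t \<in> carrier (V \<boxtimes>\<^bsub>K\<^esub> W) \<and> module K V \<and> module K W")
  case True
  then have "set (summands t) \<subseteq> carrier V \<times> carrier W"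
    using tensor_carrierD by blast
  with assms True sweedler_formal_closed[of K U V W f "summands t"] show ?thesis
    by (simp add: tensor_lift_def sweedler_def)
next
  case False
  then show ?thesis using module_zero_closed[OF assms(1)] by (auto simp: tensor_lift_def)
qed

text \<open>
  A linear map passes under a Sweedler sum, because both sides sum over the same representative of \<open>t\<close>.
\<close>

lemma linear_tensor_lift:
  assumes U: "module K U" "module K U'" and g: "linear_map K U U' g"
    and f: "\<And>v w. v \<in> carrier V \<Longrightarrow> w \<in> carrier W \<Longrightarrow> f v w \<in> carrier U"
  shows "g (tensor_lift K V W U f t) = tensor_lift K V W U' (\<lambda>v w. g (f v w)) t"
proof (cases "t \<in> carrier (V \<boxtimes>\<^bsub>K\<^esub> W) \<and> module K V \<and> module K W")
  case True
  then have "set (summands t) \<subseteq> carrier V \<times> carrier W"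
    using tensor_carrierD by blast
  from linear_map_sweedler_formal[OF U g f this] True show ?thesis
    by (simp add: tensor_lift_def sweedler_def)
qed (auto simp: tensor_lift_def linear_map_zero[OF U g])

lemma sweedler_formal_map:
  "sweedler U f (Formal (map (\<lambda>(v, w). (g v, h w)) xs)) = sweedler U (\<lambda>v w. f (g v) (h w)) (Formal xs)"
  by (induction xs) auto

lemma linear_map_tensor_lift:
  assumes V: "module K V" and W: "module K W" and U: "module K U" and f: "bilinear_map K V W U f"
  shows "linear_map K (V \<boxtimes>\<^bsub>K\<^esub> W) U (tensor_lift K V W U f)"
  unfolding linear_map_def
proof (intro conjI ballI funcsetI)
  note T = tensor_lift_tensor_of[OF V W U f]
  note fc = bilinear_map_closed[OF f]
  show "tensor_lift K V W U f t \<in> carrier U" for t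
    by (rule tensor_lift_closed[OF U]) (rule fc)
  fix s t assume "s \<in> carrier (V \<boxtimes>\<^bsub>K\<^esub> W)" "t \<in> carrier (V \<boxtimes>\<^bsub>K\<^esub> W)"
  then show "tensor_lift K V W U f (s \<oplus>\<^bsub>V \<boxtimes>\<^bsub>K\<^esub> W\<^esub> t) = tensor_lift K V W U f s \<oplus>\<^bsub>U\<^esub> tensor_lift K V W U f t"
    by (elim tensor_carrierE) (simp add: tensor_add T sweedler_append[OF U fc, of V W "\<lambda>x _. x" "\<lambda>_ x. x"])
next
  note T = tensor_lift_tensor_of[OF V W U f]
  note fc = bilinear_map_closed[OF f]
  fix c t assume c: "c \<in> carrier K" and "t \<in> carrier (V \<boxtimes>\<^bsub>K\<^esub> W)"
  from this(2) show "tensor_lift K V W U f (c \<odot>\<^bsub>V \<boxtimes>\<^bsub>K\<^esub> W\<^esub> t) = c \<odot>\<^bsub>U\<^esub> tensor_lift K V W U f t"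
  proof (elim tensor_carrierE)
    fix xs assume xs: "set xs \<subseteq> carrier V \<times> carrier W" and t: "t = tensor_of K V W xs"
    from xs have m: "set (map (\<lambda>(v, w). (c \<odot>\<^bsub>V\<^esub> v, w)) xs) \<subseteq> carrier V \<times> carrier W"
      using c module.smult_closed[OF V] by auto
    have "tensor_lift K V W U f (c \<odot>\<^bsub>V \<boxtimes>\<^bsub>K\<^esub> W\<^esub> t) = sweedler U (\<lambda>v w. f (c \<odot>\<^bsub>V\<^esub> v) w) (Formal xs)"
      by (simp only: t tensor_smult[OF V W c] T[OF m] sweedler_formal_map)
    also have "\<dots> = sweedler U (\<lambda>v w. c \<odot>\<^bsub>U\<^esub> f v w) (Formal xs)"
      by (rule sweedler_formal_cong[OF xs]) (rule linear_map_smult[OF bilinear_mapD2[OF f] c])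
    also have "\<dots> = c \<odot>\<^bsub>U\<^esub> sweedler U f (Formal xs)"
      by (rule linear_map_sweedler_formal[OF U U linear_map_smult_const[OF U c] _ xs, symmetric])
         (rule fc)
    finally show ?thesis by (simp only: t T[OF xs])
  qed
qed

lemma tensor_lift_pure_ident:
  assumes V: "module K V" and W: "module K W" and "t \<in> carrier (V \<boxtimes>\<^bsub>K\<^esub> W)"
  shows "tensor_lift K V W (V \<boxtimes>\<^bsub>K\<^esub> W) (pure_tensor K V W) t = t"
  using assms(3)
  by (elim tensor_carrierE) (simp add: tensor_lift_tensor_of[OF V W module_tensor[OF V W]
       bilinear_pure_tensor[OF V W]] tensor_of_eq_sweedler[symmetric])

text \<open>
  Pure tensors span: \<open>t\<close> is the image of itself under the map induced by \<open>(v, w) \<mapsto> v \<otimes> w\<close>, and \<open>F\<close> and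
  \<open>G\<close> pass under that sum.
\<close>

lemma linear_map_eq_on_tensor:
  assumes V: "module K V" and W: "module K W" and U: "module K U"
    and F: "linear_map K (V \<boxtimes>\<^bsub>K\<^esub> W) U F" and G: "linear_map K (V \<boxtimes>\<^bsub>K\<^esub> W) U G"
    and eq: "\<And>v w. v \<in> carrier V \<Longrightarrow> w \<in> carrier W \<Longrightarrow> F (pure_tensor K V W v w) = G (pure_tensor K V W v w)"
    and t: "t \<in> carrier (V \<boxtimes>\<^bsub>K\<^esub> W)"
  shows "F t = G t"
proof -
  let ?p = "tensor_lift K V W (V \<boxtimes>\<^bsub>K\<^esub> W) (pure_tensor K V W) t"
  note VW = module_tensor[OF V W]
  have "F ?p = tensor_lift K V W U (\<lambda>v w. F (pure_tensor K V W v w)) t"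
    by (rule linear_tensor_lift[OF VW U F]) (rule pure_tensor_closed)
  also have "\<dots> = tensor_lift K V W U (\<lambda>v w. G (pure_tensor K V W v w)) t"
    by (simp add: eq cong: tensor_lift_cong)
  also have "\<dots> = G ?p"
    by (rule linear_tensor_lift[OF VW U G, symmetric]) (rule pure_tensor_closed)
  finally show ?thesis by (simp only: tensor_lift_pure_ident[OF V W t])
qed

lemma linear_map_comp:
  "linear_map K V W g \<Longrightarrow> linear_map K U V f \<Longrightarrow> linear_map K U W (\<lambda>x. g (f x))"
  by (auto simp: linear_map_def Pi_iff)

lemma sweedler_formal_add:
  assumes "module K U" "set xs \<subseteq> carrier V \<times> carrier W"
    "\<And>v w. v \<in> carrier V \<Longrightarrow> w \<in> carrier W \<Longrightarrow> f v w \<in> carrier U"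
    "\<And>v w. v \<in> carrier V \<Longrightarrow> w \<in> carrier W \<Longrightarrow> g v w \<in> carrier U"
  shows "sweedler U (\<lambda>v w. f v w \<oplus>\<^bsub>U\<^esub> g v w) (Formal xs) =
    sweedler U f (Formal xs) \<oplus>\<^bsub>U\<^esub> sweedler U g (Formal xs)"
proof -
  interpret U: abelian_group U using assms(1) by (rule module.axioms)
  show ?thesis using assms(2)
  proof (induction xs)
    case (Cons p xs)
    have "sweedler U f (Formal xs) \<in> carrier U" "sweedler U g (Formal xs) \<in> carrier U"
      by (rule sweedler_formal_closed[OF assms(1)]; use Cons.prems assms(3,4) in auto)+
    then show ?case using Cons assms(3,4)
      by (cases p) (simp add: U.a_ac)
  qed simp
qed

lemma tensor_lift_add:
  assumes U: "module K U"
    and f: "\<And>v w. v \<in> carrier V \<Longrightarrow> w \<in> carrier W \<Longrightarrow> f v w \<in> carrier U"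
    and g: "\<And>v w. v \<in> carrier V \<Longrightarrow> w \<in> carrier W \<Longrightarrow> g v w \<in> carrier U"
  shows "tensor_lift K V W U (\<lambda>v w. f v w \<oplus>\<^bsub>U\<^esub> g v w) t =
    tensor_lift K V W U f t \<oplus>\<^bsub>U\<^esub> tensor_lift K V W U g t"
proof (cases "t \<in> carrier (V \<boxtimes>\<^bsub>K\<^esub> W) \<and> module K V \<and> module K W")
  case True
  then have "set (summands t) \<subseteq> carrier V \<times> carrier W"
    using tensor_carrierD by blast
  from sweedler_formal_add[OF U this f g] True show ?thesis
    by (simp add: tensor_lift_def sweedler_def)
next
  case False
  interpret U: abelian_group U using U by (rule module.axioms)
  show ?thesis using False by (auto simp: tensor_lift_def)
qed

text \<open>Sums of linear maps are linear; this gives the linearity of an iterated sum in a variable of its body.\<close>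

lemma linear_map_tensor_lift_param:
  assumes U: "module K U"
    and f: "\<And>v w. v \<in> carrier V \<Longrightarrow> w \<in> carrier W \<Longrightarrow> linear_map K X U (\<lambda>x. f x v w)"
  shows "linear_map K X U (\<lambda>x. tensor_lift K V W U (f x) t)"
  unfolding linear_map_def
proof (intro conjI ballI funcsetI)
  fix x assume x: "x \<in> carrier X"
  note fx = linear_map_closed[OF f x]
  show "tensor_lift K V W U (f x) t \<in> carrier U"
    by (rule tensor_lift_closed[OF U]) (rule fx)
  {
    fix y assume y: "y \<in> carrier X"
    note fy = linear_map_closed[OF f y]
    have "tensor_lift K V W U (f (x \<oplus>\<^bsub>X\<^esub> y)) t =
        tensor_lift K V W U (\<lambda>v w. f x v w \<oplus>\<^bsub>U\<^esub> f y v w) t"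
      by (rule tensor_lift_cong) (simp_all add: linear_map_add[OF f x y])
    also have "\<dots> = tensor_lift K V W U (f x) t \<oplus>\<^bsub>U\<^esub> tensor_lift K V W U (f y) t"
      by (rule tensor_lift_add[OF U]) (rule fx fy; assumption)+
    finally show "tensor_lift K V W U (f (x \<oplus>\<^bsub>X\<^esub> y)) t =
        tensor_lift K V W U (f x) t \<oplus>\<^bsub>U\<^esub> tensor_lift K V W U (f y) t" .
  next
    fix c assume c: "c \<in> carrier K"
    have "tensor_lift K V W U (f (c \<odot>\<^bsub>X\<^esub> x)) t =
        tensor_lift K V W U (\<lambda>v w. c \<odot>\<^bsub>U\<^esub> f x v w) t"
      by (rule tensor_lift_cong) (simp_all add: linear_map_smult[OF f c x])
    also have "\<dots> = c \<odot>\<^bsub>U\<^esub> tensor_lift K V W U (f x) t"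
      by (rule linear_tensor_lift[OF U U linear_map_smult_const[OF U c], symmetric]) (rule fx)
    finally show "tensor_lift K V W U (f (c \<odot>\<^bsub>X\<^esub> x)) t = c \<odot>\<^bsub>U\<^esub> tensor_lift K V W U (f x) t" .
  }
qed

lemma tensor_lift_zero:
  assumes U: "module K U"
  shows "tensor_lift K V W U (\<lambda>_ _. \<zero>\<^bsub>U\<^esub>) t = \<zero>\<^bsub>U\<^esub>"
proof -
  have "linear_map K U U (\<lambda>_. \<zero>\<^bsub>U\<^esub>)"
    using linear_map_smult_const[OF U module_scalar_zero_closed[OF U]]
    by (simp add: linear_map_def module_zero_smult[OF U] Pi_iff module_add_closed[OF U]
       module.smult_closed[OF U])
  from linear_tensor_lift[OF U U this, of V W "\<lambda>_ _. \<zero>\<^bsub>U\<^esub>" t] module_zero_closed[OF U]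
  show ?thesis by simp
qed

text \<open>
  Two Sweedler sums whose arguments are independent may be exchanged. Sweedler notation does this
  tacitly whenever the legs of different elements are written in a different order.
\<close>

lemma tensor_lift_swap:
  assumes U: "module K U"
    and f: "\<And>v w x y. v \<in> carrier V \<Longrightarrow> w \<in> carrier W \<Longrightarrow> x \<in> carrier X \<Longrightarrow> y \<in> carrier Y \<Longrightarrow>
      f v w x y \<in> carrier U"
  shows "tensor_lift K V W U (\<lambda>v w. tensor_lift K X Y U (\<lambda>x y. f v w x y) t) s =
    tensor_lift K X Y U (\<lambda>x y. tensor_lift K V W U (\<lambda>v w. f v w x y) s) t"
proof (cases "s \<in> carrier (V \<boxtimes>\<^bsub>K\<^esub> W) \<and> module K V \<and> module K W")
  case True
  interpret U: abelian_group U using U by (rule module.axioms)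
  have "sweedler U (\<lambda>v w. tensor_lift K X Y U (\<lambda>x y. f v w x y) t) (Formal ps) =
      tensor_lift K X Y U (\<lambda>x y. sweedler U (\<lambda>v w. f v w x y) (Formal ps)) t"
    if "set ps \<subseteq> carrier V \<times> carrier W" for ps
    using that
  proof (induction ps)
    case Nil
    then show ?case by (simp add: tensor_lift_zero[OF U])
  next
    case (Cons p ps)
    obtain v w where p: "p = (v, w)" by (cases p)
    have v: "v \<in> carrier V" "w \<in> carrier W" "set ps \<subseteq> carrier V \<times> carrier W"
      using Cons.prems p by auto
    have "tensor_lift K X Y U (\<lambda>x y. f v w x y \<oplus>\<^bsub>U\<^esub> sweedler U (\<lambda>v w. f v w x y) (Formal ps)) t =
      tensor_lift K X Y U (\<lambda>x y. f v w x y) t \<oplus>\<^bsub>U\<^esub>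
      tensor_lift K X Y U (\<lambda>x y. sweedler U (\<lambda>v w. f v w x y) (Formal ps)) t"
      using v by (intro tensor_lift_add[OF U]) (auto intro!: f sweedler_formal_closed[OF U, of V W])
    then show ?case
      using Cons.IH v by (simp add: p)
  qed
  from this[of "summands s"] True tensor_carrierD[of K V W s] show ?thesis
    by (simp add: tensor_lift_def[of K V W] sweedler_def)
next
  case False
  then have "tensor_lift K V W U g s = \<zero>\<^bsub>U\<^esub>" for g by (auto simp: tensor_lift_def)
  then show ?thesis by (simp add: tensor_lift_zero[OF U])
qed

section \<open>Calculating with multilinear maps\<close>

text \<open>
  The rules of this section prove the linearity of a Sweedler expression in a variable by recursion on
  the expression. For an operation they speak of its composite with a further linear map, so that they apply
  when the variable occurs deep inside the expression. The remaining rules evaluate sums over pure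
  tensors and move sums outward, which turns an expression into an iterated sum over the coproducts and
  coactions of the given elements.
\<close>

declare linear_map_ident [simp]

lemma bilinear_map_iff [simp]:
  "bilinear_map K V W U (\<lambda>v w. f v w) \<longleftrightarrow>
    (\<forall>v. v \<in> carrier V \<longrightarrow> linear_map K W U (\<lambda>w. f v w)) \<and>
    (\<forall>w. w \<in> carrier W \<longrightarrow> linear_map K V U (\<lambda>v. f v w))"
  by (auto simp: bilinear_map_def)

declare hom_space_module [simp] module_tensor [simp] pure_tensor_closed [simp]

lemma linear_map_pure_tensor1 [simp]:
  assumes "module K V" "module K W" "linear_map K X V f" "w \<in> carrier W"
  shows "linear_map K X (V \<boxtimes>\<^bsub>K\<^esub> W) (\<lambda>x. pure_tensor K V W (f x) w)"
  using linear_map_comp[OF bilinear_mapD2[OF bilinear_pure_tensor[OF assms(1,2)] assms(4)] assms(3)] .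

lemma linear_map_pure_tensor2 [simp]:
  assumes "module K V" "module K W" "linear_map K X W f" "v \<in> carrier V"
  shows "linear_map K X (V \<boxtimes>\<^bsub>K\<^esub> W) (\<lambda>x. pure_tensor K V W v (f x))"
  using linear_map_comp[OF bilinear_mapD1[OF bilinear_pure_tensor[OF assms(1,2)] assms(4)] assms(3)] .

lemma linear_map_tensor_lift_arg [simp]:
  assumes "module K V" "module K W" "module K U" "linear_map K X (V \<boxtimes>\<^bsub>K\<^esub> W) g" "bilinear_map K V W U f"
  shows "linear_map K X U (\<lambda>x. tensor_lift K V W U f (g x))"
  using linear_map_comp[OF linear_map_tensor_lift[OF assms(1-3,5)] assms(4)] .

declare linear_map_tensor_lift_param [simp]

declare tensor_lift_closed [simp]

declare tensor_lift_pure [simp]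

lemma tensor_lift_tensor_lift [simp]:
  assumes "module K V" "module K W" "module K U" "bilinear_map K V W U f"
    "\<And>x y. x \<in> carrier X \<Longrightarrow> y \<in> carrier Y \<Longrightarrow> h x y \<in> carrier (V \<boxtimes>\<^bsub>K\<^esub> W)"
  shows "tensor_lift K V W U f (tensor_lift K X Y (V \<boxtimes>\<^bsub>K\<^esub> W) h t) =
    tensor_lift K X Y U (\<lambda>x y. tensor_lift K V W U f (h x y)) t"
  by (rule linear_tensor_lift[OF module_tensor[OF assms(1,2)] assms(3) linear_map_tensor_lift[OF assms(1-4)]])
    (rule assms(5))

lemma pure_tensor_lift1 [simp]:
  assumes "module K V" "module K W" "w \<in> carrier W"
    "\<And>x y. x \<in> carrier X \<Longrightarrow> y \<in> carrier Y \<Longrightarrow> h x y \<in> carrier V"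
  shows "pure_tensor K V W (tensor_lift K X Y V h t) w =
    tensor_lift K X Y (V \<boxtimes>\<^bsub>K\<^esub> W) (\<lambda>x y. pure_tensor K V W (h x y) w) t"
  by (rule linear_tensor_lift[OF assms(1) module_tensor[OF assms(1,2)]
     bilinear_mapD2[OF bilinear_pure_tensor[OF assms(1,2)] assms(3)]]) (rule assms(4))

lemma pure_tensor_lift2 [simp]:
  assumes "module K V" "module K W" "v \<in> carrier V"
    "\<And>x y. x \<in> carrier X \<Longrightarrow> y \<in> carrier Y \<Longrightarrow> h x y \<in> carrier W"
  shows "pure_tensor K V W v (tensor_lift K X Y W h t) =
    tensor_lift K X Y (V \<boxtimes>\<^bsub>K\<^esub> W) (\<lambda>x y. pure_tensor K V W v (h x y)) t"
  by (rule linear_tensor_lift[OF assms(2) module_tensor[OF assms(1,2)]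
     bilinear_mapD1[OF bilinear_pure_tensor[OF assms(1,2)] assms(3)]]) (rule assms(4))

lemma tensor_map_eq_lift:
  assumes "module K X" "module K Y" "t \<in> carrier (X \<boxtimes>\<^bsub>K\<^esub> Y)"
  shows "tensor_map K V W f g t =
    tensor_lift K X Y (V \<boxtimes>\<^bsub>K\<^esub> W) (\<lambda>x y. pure_tensor K V W (f x) (g y)) t"
  using assms by (simp add: tensor_map_def sweedler_eq_tensor_lift)

lemma reassoc_eq_lift:
  assumes UVW: "module K U" "module K V" "module K W" and t: "t \<in> carrier ((U \<boxtimes>\<^bsub>K\<^esub> V) \<boxtimes>\<^bsub>K\<^esub> W)"
  shows "reassoc K U V W t = tensor_lift K (U \<boxtimes>\<^bsub>K\<^esub> V) W (U \<boxtimes>\<^bsub>K\<^esub> (V \<boxtimes>\<^bsub>K\<^esub> W)) (\<lambda>s w.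
     tensor_lift K U V (U \<boxtimes>\<^bsub>K\<^esub> (V \<boxtimes>\<^bsub>K\<^esub> W)) (\<lambda>u v.
       pure_tensor K U (V \<boxtimes>\<^bsub>K\<^esub> W) u (pure_tensor K V W v w)) s) t"
  unfolding reassoc_def
  by (subst sweedler_eq_tensor_lift[OF t]) (simp_all add: UVW sweedler_eq_tensor_lift)

section \<open>The structure map and its inverse\<close>

text \<open>
  With \<open>K\<close> fixed, \<open>hom_space K V\<close> is a usable hypothesis for statements that do not mention \<open>K\<close>, such as
  \<open>\<alpha>(v) \<in> V\<close>.
\<close>

locale scalars =
  fixes K :: "('k, 'x) ring_scheme"
  assumes cring: "cring K"
begin

lemmas module_smult_closed [simp] = module.smult_closed[where R = K]

lemma bij_betw_twist_inv:
  assumes "hom_space K V"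
  shows twist_inv_closed [simp]: "v \<in> carrier V \<Longrightarrow> twist_inv V v \<in> carrier V"
    and twist_twist_inv [simp]: "v \<in> carrier V \<Longrightarrow> twist V (twist_inv V v) = v"
    and twist_inv_twist [simp]: "v \<in> carrier V \<Longrightarrow> twist_inv V (twist V v) = v"
    and twist_closed [simp]: "v \<in> carrier V \<Longrightarrow> twist V v \<in> carrier V"
  using hom_space_bij[OF assms]
  by (auto simp: twist_inv_def bij_betw_inv_into_left bij_betw_inv_into_right
      inv_into_into bij_betw_def)

lemma linear_map_twist_inv:
  assumes V: "hom_space K V"
  shows "linear_map K V V (twist_inv V)"
  unfolding linear_map_def
proof (intro conjI ballI funcsetI)
  note t = hom_space_twist[OF V]
  note [simp] = bij_betw_twist_inv[OF V] and m = hom_space_module[OF V]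
  fix x y assume x: "x \<in> carrier V" and y: "y \<in> carrier V"
  have "twist_inv V (x \<oplus>\<^bsub>V\<^esub> y) = twist_inv V (twist V (twist_inv V x \<oplus>\<^bsub>V\<^esub> twist_inv V y))"
    using x y by (simp add: linear_map_add[OF t])
  then show "twist_inv V (x \<oplus>\<^bsub>V\<^esub> y) = twist_inv V x \<oplus>\<^bsub>V\<^esub> twist_inv V y"
    using x y by (simp add: module_add_closed[OF m])
next
  note t = hom_space_twist[OF V]
  note [simp] = bij_betw_twist_inv[OF V] and m = hom_space_module[OF V]
  fix c x assume c: "c \<in> carrier K" and x: "x \<in> carrier V"
  have "twist_inv V (c \<odot>\<^bsub>V\<^esub> x) = twist_inv V (twist V (c \<odot>\<^bsub>V\<^esub> twist_inv V x))"
    using c x by (simp add: linear_map_smult[OF t])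
  then show "twist_inv V (c \<odot>\<^bsub>V\<^esub> x) = c \<odot>\<^bsub>V\<^esub> twist_inv V x"
    using c x by (simp add: module.smult_closed[OF m])
qed (use bij_betw_twist_inv[OF V] in auto)

lemma linear_map_twist_arg [simp]:
  "hom_space K V \<Longrightarrow> linear_map K X V f \<Longrightarrow> linear_map K X V (\<lambda>x. twist V (f x))"
  by (rule linear_map_comp[OF hom_space_twist])

lemma linear_map_twist_inv_arg [simp]:
  "hom_space K V \<Longrightarrow> linear_map K X V f \<Longrightarrow> linear_map K X V (\<lambda>x. twist_inv V (f x))"
  by (rule linear_map_comp[OF linear_map_twist_inv])

lemma twist_tensor_lift [simp]:
  assumes V: "hom_space K V" and h: "\<And>x y. x \<in> carrier X \<Longrightarrow> y \<in> carrier Y \<Longrightarrow> h x y \<in> carrier V"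
  shows "twist V (tensor_lift K X Y V h t) = tensor_lift K X Y V (\<lambda>x y. twist V (h x y)) t"
  using V by (intro linear_tensor_lift[OF _ _ hom_space_twist[OF V] h]) auto

lemma twist_tensor:
  assumes V: "hom_space K V" and W: "hom_space K W" and t: "t \<in> carrier (V \<boxtimes>\<^bsub>K\<^esub> W)"
  shows "twist (V \<boxtimes>\<^bsub>K\<^esub> W) t =
    tensor_lift K V W (V \<boxtimes>\<^bsub>K\<^esub> W) (\<lambda>v w. pure_tensor K V W (twist V v) (twist W w)) t"
  using t
proof (elim tensor_carrierE)
  fix xs assume xs: "set xs \<subseteq> carrier V \<times> carrier W" and t: "t = tensor_of K V W xs"
  have "twist (V \<boxtimes>\<^bsub>K\<^esub> W) t =
      sweedler (V \<boxtimes>\<^bsub>K\<^esub> W) (pure_tensor K V W) (Formal (map (\<lambda>(v, w). (twist V v, twist W w)) xs))"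
    using V W by (simp add: t tensor_twist hom_space_twist tensor_of_eq_sweedler[symmetric])
  also have "\<dots> = sweedler (V \<boxtimes>\<^bsub>K\<^esub> W) (\<lambda>v w. pure_tensor K V W (twist V v) (twist W w)) (Formal xs)"
    by (rule sweedler_formal_map)
  also have "\<dots> = tensor_lift K V W (V \<boxtimes>\<^bsub>K\<^esub> W) (\<lambda>v w. pure_tensor K V W (twist V v) (twist W w)) t"
    unfolding t using V W by (subst tensor_lift_tensor_of[OF _ _ _ _ xs]) simp_all
  finally show ?thesis .
qed

lemma twist_pure_tensor [simp]:
  assumes "hom_space K V" "hom_space K W" "v \<in> carrier V" "w \<in> carrier W"
  shows "twist (V \<boxtimes>\<^bsub>K\<^esub> W) (pure_tensor K V W v w) = pure_tensor K V W (twist V v) (twist W w)"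
  using assms by (simp add: twist_tensor)

lemma linear_map_eqI:
  "linear_map K V W f \<Longrightarrow> (\<And>x. x \<in> carrier V \<Longrightarrow> g x = f x) \<Longrightarrow> module K V \<Longrightarrow> linear_map K V W g"
  by (auto simp: linear_map_def Pi_iff module_add_closed module.smult_closed)

text \<open>
  The inverse of \<open>\<alpha> \<otimes> \<alpha>\<close> is the map induced by \<open>(v, w) \<mapsto> \<alpha>\<^sup>-\<^sup>1(v) \<otimes> \<alpha>\<^sup>-\<^sup>1(w)\<close>.
\<close>

lemma hom_space_tensor [simp]:
  assumes V: "hom_space K V" and W: "hom_space K W"
  shows "hom_space K (V \<boxtimes>\<^bsub>K\<^esub> W)"
proof -
  let ?T = "V \<boxtimes>\<^bsub>K\<^esub> W"
  note [simp] = V W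
  define F where "F = tensor_lift K V W ?T (\<lambda>v w. pure_tensor K V W (twist V v) (twist W w))"
  define G where "G = tensor_lift K V W ?T (\<lambda>v w. pure_tensor K V W (twist_inv V v) (twist_inv W w))"
  have F: "linear_map K ?T ?T F" and G: "linear_map K ?T ?T G"
    unfolding F_def G_def by (rule linear_map_tensor_lift; simp)+
  have pure: "F (pure_tensor K V W v w) = pure_tensor K V W (twist V v) (twist W w)"
    "G (pure_tensor K V W v w) = pure_tensor K V W (twist_inv V v) (twist_inv W w)"
    if "v \<in> carrier V" "w \<in> carrier W" for v w
    using that by (simp_all add: F_def G_def)
  have FG: "F (G t) = t" if "t \<in> carrier ?T" for t
    by (rule linear_map_eq_on_tensor[OF _ _ _ linear_map_comp[OF F G] linear_map_ident _ that])
      (simp_all add: pure)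
  have GF: "G (F t) = t" if "t \<in> carrier ?T" for t
    by (rule linear_map_eq_on_tensor[OF _ _ _ linear_map_comp[OF G F] linear_map_ident _ that])
      (simp_all add: pure)
  have tw: "twist ?T t = F t" if "t \<in> carrier ?T" for t
    unfolding F_def by (rule twist_tensor[OF V W that])
  have "linear_map K ?T ?T (twist ?T)"
    by (rule linear_map_eqI[OF F]) (simp_all add: tw)
  moreover have "bij_betw (twist ?T) (carrier ?T) (carrier ?T)"
    by (rule bij_betw_byWitness[where f' = G])
      (auto simp: tw FG GF linear_map_closed[OF F] linear_map_closed[OF G])
  ultimately show ?thesis unfolding hom_space_def using V W by (intro conjI) simp_all
qed

lemma twist_inv_pure_tensor [simp]:
  assumes V: "hom_space K V" and W: "hom_space K W" and vw: "v \<in> carrier V" "w \<in> carrier W"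
  shows "twist_inv (V \<boxtimes>\<^bsub>K\<^esub> W) (pure_tensor K V W v w) = pure_tensor K V W (twist_inv V v) (twist_inv W w)"
proof -
  note [simp] = V W vw
  have "twist_inv (V \<boxtimes>\<^bsub>K\<^esub> W) (twist (V \<boxtimes>\<^bsub>K\<^esub> W) (pure_tensor K V W (twist_inv V v) (twist_inv W w))) =
     pure_tensor K V W (twist_inv V v) (twist_inv W w)"
    by (rule twist_inv_twist[OF hom_space_tensor[OF V W]]) simp
  then show ?thesis by simp
qed

section \<open>Comodules and coalgebras\<close>

lemma carrier_ground [simp]: "carrier (ground K) = carrier K"
  by (simp add: ground_def)

lemma linear_map_smult1 [simp]:
  assumes V: "module K V" and f: "linear_map K X (ground K) f" and v: "v \<in> carrier V"
  shows "linear_map K X V (\<lambda>x. f x \<odot>\<^bsub>V\<^esub> v)"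
proof -
  interpret module K V by (rule V)
  from f v show ?thesis
    by (auto simp: linear_map_def ground_def Pi_iff smult_l_distr smult_assoc1)
qed

lemma linear_map_smult2 [simp]:
  "module K V \<Longrightarrow> linear_map K X V f \<Longrightarrow> c \<in> carrier K \<Longrightarrow> linear_map K X V (\<lambda>x. c \<odot>\<^bsub>V\<^esub> f x)"
  by (rule linear_map_comp[OF linear_map_smult_const])

lemma pure_tensor_smult1 [simp]:
  assumes "module K V" "module K W" "c \<in> carrier K" "v \<in> carrier V" "w \<in> carrier W"
  shows "pure_tensor K V W (c \<odot>\<^bsub>V\<^esub> v) w = c \<odot>\<^bsub>V \<boxtimes>\<^bsub>K\<^esub> W\<^esub> pure_tensor K V W v w"
  using linear_map_smult[OF bilinear_mapD2[OF bilinear_pure_tensor[OF assms(1,2)] assms(5)] assms(3,4)] .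

lemma pure_tensor_smult2 [simp]:
  assumes "module K V" "module K W" "c \<in> carrier K" "v \<in> carrier V" "w \<in> carrier W"
  shows "pure_tensor K V W v (c \<odot>\<^bsub>W\<^esub> w) = c \<odot>\<^bsub>V \<boxtimes>\<^bsub>K\<^esub> W\<^esub> pure_tensor K V W v w"
  using linear_map_smult[OF bilinear_mapD1[OF bilinear_pure_tensor[OF assms(1,2)] assms(4)] assms(3,5)] .

lemma twist_smult [simp]:
  "hom_space K V \<Longrightarrow> c \<in> carrier K \<Longrightarrow> v \<in> carrier V \<Longrightarrow> twist V (c \<odot>\<^bsub>V\<^esub> v) = c \<odot>\<^bsub>V\<^esub> twist V v"
  by (rule linear_map_smult[OF hom_space_twist])

lemma comodule_facts:
  assumes "right_hom_comodule K C M r"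
  shows comodule_hom_space: "hom_space K M"
    and comodule_linear: "linear_map K M (M \<boxtimes>\<^bsub>K\<^esub> C) r"
    and comodule_closed: "m \<in> carrier M \<Longrightarrow> r m \<in> carrier (M \<boxtimes>\<^bsub>K\<^esub> C)"
  using assms linear_map_closed by (auto simp: right_hom_comodule_def)

text \<open>
  A linear map applied to both sides of an axiom gives the axiom in the form in which Sweedler notation
  uses it, with an arbitrary multilinear expression in the components. Here the map is induced by
  \<open>x \<otimes> (y \<otimes> z) \<mapsto> f x y z\<close>.
\<close>

lemma comodule_coassoc:
  assumes r: "right_hom_comodule K C M r" and C: "hom_space K C" "linear_map K C (C \<boxtimes>\<^bsub>K\<^esub> C) (comult C)"
    and U [simp]: "module K U"
    and f: "\<And>y z. y \<in> carrier C \<Longrightarrow> z \<in> carrier C \<Longrightarrow> linear_map K M U (\<lambda>x. f x y z)"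
      "\<And>x z. x \<in> carrier M \<Longrightarrow> z \<in> carrier C \<Longrightarrow> linear_map K C U (\<lambda>y. f x y z)"
      "\<And>x y. x \<in> carrier M \<Longrightarrow> y \<in> carrier C \<Longrightarrow> linear_map K C U (\<lambda>z. f x y z)"
    and m: "m \<in> carrier M"
  shows "tensor_lift K M C U (\<lambda>m\<^sub>0 m\<^sub>1. tensor_lift K M C U (\<lambda>x y. f x y (twist C m\<^sub>1)) (r m\<^sub>0)) (r m) =
    tensor_lift K M C U (\<lambda>m\<^sub>0 m\<^sub>1. tensor_lift K C C U (\<lambda>x y. f (twist M m\<^sub>0) x y) (comult C m\<^sub>1)) (r m)"
proof -
  note [simp] = comodule_hom_space[OF r] C(1) comodule_closed[OF r] linear_map_closed[OF C(2)] m
    linear_map_comp[OF comodule_linear[OF r]] linear_map_comp[OF C(2)]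
    linear_map_comp[OF f(1)] linear_map_comp[OF f(2)] linear_map_comp[OF f(3)]
  define G where "G = tensor_lift K M (C \<boxtimes>\<^bsub>K\<^esub> C) U (\<lambda>u s. tensor_lift K C C U (f u) s)"
  have "G (reassoc K M C C (tensor_map K (M \<boxtimes>\<^bsub>K\<^esub> C) C r (twist C) (r m))) =
      G (tensor_map K M (C \<boxtimes>\<^bsub>K\<^esub> C) (twist M) (comult C) (r m))"
    using r m by (simp add: right_hom_comodule_def)
  then show ?thesis
    by (simp add: G_def tensor_map_eq_lift[of K M C] reassoc_eq_lift)
qed

lemma comodule_twist:
  assumes r: "right_hom_comodule K C M r" and C: "hom_space K C" and [simp]: "module K U"
    and f: "bilinear_map K M C U f" and m: "m \<in> carrier M"
  shows "tensor_lift K M C U f (r (twist M m)) =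
    tensor_lift K M C U (\<lambda>x y. f (twist M x) (twist C y)) (r m)"
proof -
  note [simp] = comodule_hom_space[OF r] C(1) comodule_closed[OF r] m
    linear_map_comp[OF bilinear_mapD1[OF f]] linear_map_comp[OF bilinear_mapD2[OF f]]
  have "r (twist M m) = tensor_map K M C (twist M) (twist C) (r m)"
    using r m by (simp add: right_hom_comodule_def)
  then show ?thesis by (simp add: tensor_map_eq_lift[of K M C])
qed

lemma comodule_twist_inv:
  assumes r: "right_hom_comodule K C M r" and C: "hom_space K C" and U: "module K U"
    and f: "bilinear_map K M C U f" and m: "m \<in> carrier M"
  shows "tensor_lift K M C U f (r (twist_inv M m)) =
    tensor_lift K M C U (\<lambda>x y. f (twist_inv M x) (twist_inv C y)) (r m)"
proof -
  note M = comodule_hom_space[OF r]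
  note [simp] = M C m
  have "bilinear_map K M C U (\<lambda>x y. f (twist_inv M x) (twist_inv C y))"
    by (auto intro!: linear_map_comp[OF bilinear_mapD1[OF f]] linear_map_comp[OF bilinear_mapD2[OF f]])
  from comodule_twist[OF r C U this, of "twist_inv M m"] show ?thesis by simp
qed

lemma comodule_counit:
  assumes r: "right_hom_comodule K C M r" and C: "hom_space K C"
    and c: "linear_map K C (ground K) (counit C)"
    and U: "module K U" and g: "linear_map K M U g" and m: "m \<in> carrier M"
  shows "tensor_lift K M C U (\<lambda>m\<^sub>0 m\<^sub>1. counit C m\<^sub>1 \<odot>\<^bsub>U\<^esub> g m\<^sub>0) (r m) = g (twist M m)"
proof -
  note [simp] = comodule_hom_space[OF r] C(1) comodule_closed[OF r] m
  have c': "counit C x \<in> carrier K" if "x \<in> carrier C" for x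
    using linear_map_closed[OF c that] by simp
  have "sweedler M (\<lambda>m\<^sub>0 m\<^sub>1. counit C m\<^sub>1 \<odot>\<^bsub>M\<^esub> m\<^sub>0) (r m) = twist M m"
    using r m unfolding right_hom_comodule_def by blast
  then have "twist M m = tensor_lift K M C M (\<lambda>m\<^sub>0 m\<^sub>1. counit C m\<^sub>1 \<odot>\<^bsub>M\<^esub> m\<^sub>0) (r m)"
    by (simp add: sweedler_eq_tensor_lift[of "r m" M K C])
  then have "g (twist M m) = g (tensor_lift K M C M (\<lambda>m\<^sub>0 m\<^sub>1. counit C m\<^sub>1 \<odot>\<^bsub>M\<^esub> m\<^sub>0) (r m))"
    by simp
  also have "\<dots> = tensor_lift K M C U (\<lambda>m\<^sub>0 m\<^sub>1. g (counit C m\<^sub>1 \<odot>\<^bsub>M\<^esub> m\<^sub>0)) (r m)"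
    by (rule linear_tensor_lift[OF _ U g]) (simp_all add: c')
  also have "\<dots> = tensor_lift K M C U (\<lambda>m\<^sub>0 m\<^sub>1. counit C m\<^sub>1 \<odot>\<^bsub>U\<^esub> g m\<^sub>0) (r m)"
    by (simp add: c' linear_map_smult[OF g])
  finally show ?thesis ..
qed

text \<open>
  A Hom-coalgebra is a comodule over itself, so coassociativity and the right counit law of a coalgebra
  are instances of the corresponding statements on comodules.
\<close>

lemma coalgebra_comodule:
  "hom_coalgebra K C \<Longrightarrow> right_hom_comodule K C C (comult C)"
  by (simp add: hom_coalgebra_def right_hom_comodule_def)

lemma coalgebra_counit_left:
  assumes "hom_coalgebra K C" and U: "module K U" and g: "linear_map K C U g" and c: "c \<in> carrier C"
  shows "tensor_lift K C C U (\<lambda>c\<^sub>1 c\<^sub>2. counit C c\<^sub>1 \<odot>\<^bsub>U\<^esub> g c\<^sub>2) (comult C c) = g (twist C c)"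
proof -
  have C [simp]: "hom_space K C" and \<Delta>: "comult C c \<in> carrier (C \<boxtimes>\<^bsub>K\<^esub> C)"
    and \<epsilon>: "linear_map K C (ground K) (counit C)"
    and eq: "sweedler C (\<lambda>c\<^sub>1 c\<^sub>2. counit C c\<^sub>1 \<odot>\<^bsub>C\<^esub> c\<^sub>2) (comult C c) = twist C c"
    using assms by (auto simp: hom_coalgebra_def intro: linear_map_closed)
  have c': "counit C x \<in> carrier K" if "x \<in> carrier C" for x
    using linear_map_closed[OF \<epsilon> that] by simp
  have "twist C c = tensor_lift K C C C (\<lambda>c\<^sub>1 c\<^sub>2. counit C c\<^sub>1 \<odot>\<^bsub>C\<^esub> c\<^sub>2) (comult C c)"
    using eq by (simp add: sweedler_eq_tensor_lift[OF \<Delta>])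
  then have "g (twist C c) = g (tensor_lift K C C C (\<lambda>c\<^sub>1 c\<^sub>2. counit C c\<^sub>1 \<odot>\<^bsub>C\<^esub> c\<^sub>2) (comult C c))"
    by simp
  also have "\<dots> = tensor_lift K C C U (\<lambda>c\<^sub>1 c\<^sub>2. g (counit C c\<^sub>1 \<odot>\<^bsub>C\<^esub> c\<^sub>2)) (comult C c)"
    by (rule linear_tensor_lift[OF _ U g]) (simp_all add: c')
  also have "\<dots> = tensor_lift K C C U (\<lambda>c\<^sub>1 c\<^sub>2. counit C c\<^sub>1 \<odot>\<^bsub>U\<^esub> g c\<^sub>2) (comult C c)"
    by (simp add: c' linear_map_smult[OF g])
  finally show ?thesis ..
qed

section \<open>Bialgebras\<close>

lemma sweedler_formal_product:
  assumes U: "module K U"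
    and f: "\<And>v w v' w'. v \<in> carrier V \<Longrightarrow> w \<in> carrier W \<Longrightarrow> v' \<in> carrier V \<Longrightarrow> w' \<in> carrier W \<Longrightarrow>
      f (mu v v') (nu w w') \<in> carrier U"
    and "set xs \<subseteq> carrier V \<times> carrier W" and ys: "set ys \<subseteq> carrier V \<times> carrier W"
  shows "sweedler U f (Formal [(mu v v', nu w w'). (v, w) \<leftarrow> xs, (v', w') \<leftarrow> ys]) =
    sweedler U (\<lambda>v w. sweedler U (\<lambda>v' w'. f (mu v v') (nu w w')) (Formal ys)) (Formal xs)"
  using assms(3)
proof (induction xs)
  case Nil
  show ?case by simp
next
  case (Cons p xs)
  obtain v w where p: "p = (v, w)" by (cases p)
  have m: "concat (map (\<lambda>(v', w'). [(mu v v', nu w w')]) ys) = map (\<lambda>(v', w'). (mu v v', nu w w')) ys"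
    for v w by (induction ys) auto
  have app: "sweedler U f (Formal (as @ bs)) = sweedler U f (Formal as) \<oplus>\<^bsub>U\<^esub> sweedler U f (Formal bs)"
    if "\<forall>(a, b)\<in>set as. f a b \<in> carrier U" "\<forall>(a, b)\<in>set bs. f a b \<in> carrier U" for as bs
  proof -
    interpret U: abelian_group U using U by (rule module.axioms)
    have cl: "sweedler U f (Formal cs) \<in> carrier U" if "\<forall>(a, b)\<in>set cs. f a b \<in> carrier U" for cs
      using that by (induction cs) auto
    show ?thesis using that(1)
      by (induction as) (use cl that(2) in \<open>auto simp: U.a_assoc\<close>)
  qed
  have "sweedler U f (Formal [(mu v v', nu w w'). (v, w) \<leftarrow> p # xs, (v', w') \<leftarrow> ys]) =
      sweedler U f (Formal (map (\<lambda>(v', w'). (mu v v', nu w w')) ys)) \<oplus>\<^bsub>U\<^esub>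
      sweedler U f (Formal [(mu v v', nu w w'). (v, w) \<leftarrow> xs, (v', w') \<leftarrow> ys])"
    unfolding p m list.map concat.simps prod.case
  proof (rule app)
    show "\<forall>(a, b)\<in>set (map (\<lambda>(v', w'). (mu v v', nu w w')) ys). f a b \<in> carrier U"
      using Cons.prems ys f p by auto
    have "f (mu x x') (nu y y') \<in> carrier U" if "(x, y) \<in> set xs" "(x', y') \<in> set ys" for x y x' y'
      using that Cons.prems ys by (intro f) auto
    then show "\<forall>(a, b)\<in>set [(mu v v', nu w w'). (v, w) \<leftarrow> xs, (v', w') \<leftarrow> ys]. f a b \<in> carrier U"
      by auto
  qed
  then show ?case
    using Cons by (simp add: p sweedler_formal_map[of U f "mu v" "nu w"])
qed

text \<open>
  The product on \<open>V \<otimes> W\<close> is defined by multiplying out two representatives. For bilinear products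
  this is a double Sweedler sum, and as such no longer depends on them.
\<close>

lemma tensor_mult:
  assumes [simp]: "module K V" "module K W" and s: "s \<in> carrier (V \<boxtimes>\<^bsub>K\<^esub> W)" and t: "t \<in> carrier (V \<boxtimes>\<^bsub>K\<^esub> W)"
    and V: "bilinear_map K V V V (mult V)" and W: "bilinear_map K W W W (mult W)"
  shows "s \<otimes>\<^bsub>V \<boxtimes>\<^bsub>K\<^esub> W\<^esub> t = tensor_lift K V W (V \<boxtimes>\<^bsub>K\<^esub> W) (\<lambda>v w. tensor_lift K V W (V \<boxtimes>\<^bsub>K\<^esub> W)
     (\<lambda>v' w'. pure_tensor K V W (v \<otimes>\<^bsub>V\<^esub> v') (w \<otimes>\<^bsub>W\<^esub> w')) t) s"
proof -
  note c = bilinear_map_closed[OF V] bilinear_map_closed[OF W]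
  have "s \<otimes>\<^bsub>V \<boxtimes>\<^bsub>K\<^esub> W\<^esub> t = sweedler (V \<boxtimes>\<^bsub>K\<^esub> W) (pure_tensor K V W)
      (Formal [(v \<otimes>\<^bsub>V\<^esub> v', w \<otimes>\<^bsub>W\<^esub> w'). (v, w) \<leftarrow> summands s, (v', w') \<leftarrow> summands t])"
    unfolding tensor_of_eq_sweedler[symmetric] by (simp add: tensor_def)
  also have "\<dots> = sweedler (V \<boxtimes>\<^bsub>K\<^esub> W) (\<lambda>v w. sweedler (V \<boxtimes>\<^bsub>K\<^esub> W)
     (\<lambda>v' w'. pure_tensor K V W (v \<otimes>\<^bsub>V\<^esub> v') (w \<otimes>\<^bsub>W\<^esub> w')) (Formal (summands t))) (Formal (summands s))"
    by (rule sweedler_formal_product[where V = V and W = W])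
      (simp_all add: c tensor_carrierD[OF _ _ s] tensor_carrierD[OF _ _ t])
  also have "\<dots> = sweedler (V \<boxtimes>\<^bsub>K\<^esub> W) (\<lambda>v w. sweedler (V \<boxtimes>\<^bsub>K\<^esub> W)
     (\<lambda>v' w'. pure_tensor K V W (v \<otimes>\<^bsub>V\<^esub> v') (w \<otimes>\<^bsub>W\<^esub> w')) t) s"
    by (simp add: sweedler_def)
  finally show ?thesis
    by (simp add: sweedler_eq_tensor_lift[OF s] sweedler_eq_tensor_lift[OF t])
qed

lemma bialgebra_facts:
  assumes "hom_bialgebra K B"
  shows bialgebra_algebra: "hom_algebra K B"
    and bialgebra_coalgebra: "hom_coalgebra K B"
    and bialgebra_hom_space: "hom_space K B"
    and bialgebra_mult: "bilinear_map K B B B (mult B)"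
    and bialgebra_one: "\<one>\<^bsub>B\<^esub> \<in> carrier B"
    and bialgebra_comult: "linear_map K B (B \<boxtimes>\<^bsub>K\<^esub> B) (comult B)"
    and bialgebra_counit: "linear_map K B (ground K) (counit B)"
  using assms by (auto simp: hom_bialgebra_def hom_algebra_def hom_coalgebra_def)

lemma bialgebra_comult_mult:
  assumes B: "hom_bialgebra K B" and U [simp]: "module K U" and f: "bilinear_map K B B U f"
    and ab: "a \<in> carrier B" "b \<in> carrier B"
  shows "tensor_lift K B B U f (comult B (a \<otimes>\<^bsub>B\<^esub> b)) =
    tensor_lift K B B U (\<lambda>a\<^sub>1 a\<^sub>2. tensor_lift K B B U (\<lambda>b\<^sub>1 b\<^sub>2. f (a\<^sub>1 \<otimes>\<^bsub>B\<^esub> b\<^sub>1) (a\<^sub>2 \<otimes>\<^bsub>B\<^esub> b\<^sub>2)) (comult B b)) (comult B a)"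
proof -
  have [simp]: "module K B" using bialgebra_hom_space[OF B] by simp
  note \<Delta> = linear_map_closed[OF bialgebra_comult[OF B]]
  have eq: "comult B (a \<otimes>\<^bsub>B\<^esub> b) = comult B a \<otimes>\<^bsub>B \<boxtimes>\<^bsub>K\<^esub> B\<^esub> comult B b"
    using B ab by (simp add: hom_bialgebra_def hom_algebra_map_def)
  note [simp] = linear_map_comp[OF bilinear_mapD1[OF f]] linear_map_comp[OF bilinear_mapD2[OF f]]
    bilinear_map_closed[OF bialgebra_mult[OF B]]
    linear_map_comp[OF bilinear_mapD1[OF bialgebra_mult[OF B]]]
    linear_map_comp[OF bilinear_mapD2[OF bialgebra_mult[OF B]]]
  from eq show ?thesis
    by (simp add: tensor_mult \<Delta> ab)
qed

lemma bialgebra_comult_one: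
  assumes B: "hom_bialgebra K B" and U [simp]: "module K U" and f: "bilinear_map K B B U f"
  shows "tensor_lift K B B U f (comult B \<one>\<^bsub>B\<^esub>) = f \<one>\<^bsub>B\<^esub> \<one>\<^bsub>B\<^esub>"
proof -
  have [simp]: "module K B" using bialgebra_hom_space[OF B] by simp
  note [simp] = linear_map_comp[OF bilinear_mapD1[OF f]] linear_map_comp[OF bilinear_mapD2[OF f]]
  have "comult B \<one>\<^bsub>B\<^esub> = pure_tensor K B B \<one>\<^bsub>B\<^esub> \<one>\<^bsub>B\<^esub>"
    using B by (simp add: hom_bialgebra_def hom_algebra_map_def tensor_def)
  then show ?thesis by (simp add: bialgebra_one[OF B])
qed

end

section \<open>Extending the record of a space\<close>

text \<open>
  The tensor product of two Doi-Hopf modules is a record that extends the space \<open>M \<otimes> N\<close> by an action and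
  a coaction. Linear maps and further tensor products only see the space, so the module may be replaced
  by it there. Iterated tensor products of modules become iterated tensor products of spaces.
\<close>

lemma extend_sel [simp]:
  "carrier (hom_space.extend V E) = carrier V"
  "add (hom_space.extend V E) = add V"
  "zero (hom_space.extend V E) = zero V"
  "smult (hom_space.extend V E) = smult V"
  "twist (hom_space.extend V E) = twist V"
  by (simp_all add: hom_space.defs)

lemma tensor_eq_operations:
  assumes "tensor_eq K V W xs ys"
    and "carrier V' = carrier V" "add V' = add V" "zero V' = zero V" "smult V' = smult V"
    and "carrier W' = carrier W" "add W' = add W" "smult W' = smult W"
  shows "tensor_eq K V' W' xs ys"
  using assms(1)
proof (induction rule: tensor_eq.induct)
  case (trans xs ys zs)
  show ?case by (rule tensor_eq.trans[OF trans.IH])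
next
  case (zero w)
  then show ?case using tensor_eq.zero[of w W' K V'] by (simp add: assms(2-))
next
  case (add_left v v' w)
  then show ?case using tensor_eq.add_left[of v V' v' w W' K] by (simp add: assms(2-))
next
  case (add_right v w w')
  then show ?case using tensor_eq.add_right[of v V' w W' w' K] by (simp add: assms(2-))
next
  case (balanced c v w)
  then show ?case using tensor_eq.balanced[of c K v V' w W'] by (simp add: assms(2-))
qed (auto intro: tensor_eq.refl tensor_eq.sym tensor_eq.append tensor_eq.comm)

lemma tensor_eq_extend [simp]:
  "tensor_eq K (hom_space.extend V E) W = tensor_eq K V W"
  "tensor_eq K W (hom_space.extend V E) = tensor_eq K W V"
  by (intro ext iffI; erule tensor_eq_operations; simp)+

lemma tensor_of_extend [simp]:
  "tensor_of K (hom_space.extend V E) W = tensor_of K V W"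
  "tensor_of K W (hom_space.extend V E) = tensor_of K W V"
  unfolding tensor_of_def by (simp_all add: fun_eq_iff)

lemma mult_one_extend:
  "mult (hom_space.extend V E) = mult V" "one (hom_space.extend V E) = one V"
  by (simp_all add: hom_space.defs)

lemma pure_tensor_extend [simp]:
  "pure_tensor K (hom_space.extend V E) W = pure_tensor K V W"
  "pure_tensor K W (hom_space.extend V E) = pure_tensor K W V"
  by (simp_all add: pure_tensor_def fun_eq_iff)

lemma tensor_extend [simp]:
  "hom_space.extend V E \<boxtimes>\<^bsub>K\<^esub> W = V \<boxtimes>\<^bsub>K\<^esub> W"
  "W \<boxtimes>\<^bsub>K\<^esub> hom_space.extend V E = W \<boxtimes>\<^bsub>K\<^esub> V"
  by (simp_all add: tensor_def mult_one_extend)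

lemma linear_map_extend [simp]:
  "linear_map K (hom_space.extend V E) W = linear_map K V W"
  "linear_map K W (hom_space.extend V E) = linear_map K W V"
  by (simp_all add: linear_map_def fun_eq_iff)

lemma sweedler_extend [simp]: "sweedler (hom_space.extend V E) = sweedler V"
  by (simp add: sweedler_def fun_eq_iff)

lemma twist_inv_extend [simp]: "twist_inv (hom_space.extend V E) = twist_inv V"
  by (simp add: twist_inv_def fun_eq_iff)

lemma module_extend [simp]: "module K (hom_space.extend V E) \<longleftrightarrow> module K V"
proof -
  have "abelian_group (hom_space.extend V E) \<longleftrightarrow> abelian_group V"
    by (simp add: abelian_group_def abelian_monoid_def abelian_group_axioms_def comm_group_def
        group_def group_axioms_def Units_def Group.comm_monoid_def Group.monoid_def
        Group.comm_monoid_axioms_def)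
  then show ?thesis
    by (simp add: module_def module_axioms_def)
qed

lemma hom_space_extend [simp]: "hom_space K (hom_space.extend V E) \<longleftrightarrow> hom_space K V"
  by (simp only: hom_space_def module_extend linear_map_extend extend_sel)

lemma tensor_lift_extend [simp]:
  "tensor_lift K (hom_space.extend V E) W U = tensor_lift K V W U"
  "tensor_lift K W (hom_space.extend V E) U = tensor_lift K W V U"
  "tensor_lift K W W' (hom_space.extend V E) = tensor_lift K W W' V"
  by (simp_all add: tensor_lift_def fun_eq_iff)

lemma reassoc_extend [simp]: "reassoc K (hom_space.extend V E) W W' = reassoc K V W W'"
  "tensor_map K (hom_space.extend V E) W = tensor_map K V W"
  "tensor_map K W (hom_space.extend V E) = tensor_map K W V"
  by (simp_all add: reassoc_def tensor_map_def fun_eq_iff)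

section \<open>Monoidal Doi-Hopf data\<close>

locale monoidal_datum = scalars K
  for K :: "('k, 'x) ring_scheme" +
  fixes H :: "('k, ('k, 'b) vec, 'y) hom_hopf_scheme"
    and A :: "('k, ('k, 'b) vec, 'z) datum_alg_scheme"
    and C :: "('k, ('k, 'b) vec, 't) datum_coalg_scheme"
  assumes datum: "monoidal_doi_hopf_datum K H A C"
begin

lemma bialgebras: "hom_bialgebra K H" "hom_bialgebra K A" "hom_bialgebra K C"
  using datum
  by (auto simp: monoidal_doi_hopf_datum_def doi_hopf_datum_def hom_hopf_algebra_def Let_def)

lemma algebras: "hom_algebra K A" "hom_algebra K C"
  and coalgebras: "hom_coalgebra K A" "hom_coalgebra K C"
  by (rule bialgebra_algebra bialgebra_coalgebra bialgebras)+

lemma comodule_A: "right_hom_comodule K H A (hcoact A)"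
  and module_C: "left_hom_module K H C (hact C)"
  using datum
  by (auto simp: monoidal_doi_hopf_datum_def doi_hopf_datum_def comodule_algebra_def
      module_coalgebra_def Let_def)

lemmas hom_spaces [simp] = bialgebras[THEN bialgebra_hom_space]
lemmas ones [simp] = bialgebras(2,3)[THEN bialgebra_one]
lemmas mult_closed [simp] = bialgebras(2,3)[THEN bialgebra_mult, THEN bilinear_map_closed]
lemmas linear_mult [simp] =
  bialgebras(2,3)[THEN bialgebra_mult, THEN bilinear_mapD1, THEN linear_map_comp]
  bialgebras(2,3)[THEN bialgebra_mult, THEN bilinear_mapD2, THEN linear_map_comp]
lemmas comult_closed [simp] = bialgebras(2,3)[THEN bialgebra_comult, THEN linear_map_closed]
lemmas linear_comult [simp] = bialgebras(2,3)[THEN bialgebra_comult, THEN linear_map_comp]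
lemmas counit_closed [simp] =
  bialgebras(2,3)[THEN bialgebra_counit, THEN linear_map_closed, unfolded carrier_ground]
lemmas linear_counit [simp] = bialgebras(2,3)[THEN bialgebra_counit, THEN linear_map_comp]
lemmas hcoact_closed [simp] = comodule_closed[OF comodule_A]

lemma bilinear_hact: "bilinear_map K H C C (hact C)"
  using module_C by (simp only: left_hom_module_def)

lemmas hact_closed [simp] = bilinear_map_closed[OF bilinear_hact]
lemmas linear_hact [simp] = bilinear_mapD1[OF bilinear_hact, THEN linear_map_comp]
  bilinear_mapD2[OF bilinear_hact, THEN linear_map_comp]

lemma sweedler_datum [simp]:
  "a \<in> carrier A \<Longrightarrow> sweedler U f (comult A a) = tensor_lift K A A U f (comult A a)"
  "c \<in> carrier C \<Longrightarrow> sweedler U f (comult C c) = tensor_lift K C C U f (comult C c)"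
  "a \<in> carrier A \<Longrightarrow> sweedler U f (hcoact A a) = tensor_lift K A H U f (hcoact A a)"
  by (rule sweedler_eq_tensor_lift; simp)+

lemma twist_mult [simp]:
  "c \<in> carrier C \<Longrightarrow> d \<in> carrier C \<Longrightarrow> twist C (c \<otimes>\<^bsub>C\<^esub> d) = twist C c \<otimes>\<^bsub>C\<^esub> twist C d"
  using algebras(2) by (simp only: hom_algebra_def)

lemma twist_inv_mult [simp]:
  assumes "c \<in> carrier C" "d \<in> carrier C"
  shows "twist_inv C (c \<otimes>\<^bsub>C\<^esub> d) = twist_inv C c \<otimes>\<^bsub>C\<^esub> twist_inv C d"
proof -
  have "twist_inv C (twist C (twist_inv C c \<otimes>\<^bsub>C\<^esub> twist_inv C d)) = twist_inv C c \<otimes>\<^bsub>C\<^esub> twist_inv C d"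
    using assms by (intro twist_inv_twist) auto
  then show ?thesis using assms by simp
qed

lemma mult_one_C [simp]:
  "c \<in> carrier C \<Longrightarrow> \<one>\<^bsub>C\<^esub> \<otimes>\<^bsub>C\<^esub> c = twist C c" "c \<in> carrier C \<Longrightarrow> c \<otimes>\<^bsub>C\<^esub> \<one>\<^bsub>C\<^esub> = twist C c"
  using algebras(2) by (simp_all only: hom_algebra_def)

lemma twist_one_C [simp]: "twist C \<one>\<^bsub>C\<^esub> = \<one>\<^bsub>C\<^esub>" "twist A \<one>\<^bsub>A\<^esub> = \<one>\<^bsub>A\<^esub>"
  using algebras by (simp_all only: hom_algebra_def)

lemma twist_inv_one_C [simp]: "twist_inv C \<one>\<^bsub>C\<^esub> = \<one>\<^bsub>C\<^esub>"
  using twist_inv_twist[OF hom_spaces(3) ones(2)] by simp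

lemma mult_assoc_C:
  "c \<in> carrier C \<Longrightarrow> d \<in> carrier C \<Longrightarrow> e \<in> carrier C \<Longrightarrow>
    twist C c \<otimes>\<^bsub>C\<^esub> (d \<otimes>\<^bsub>C\<^esub> e) = (c \<otimes>\<^bsub>C\<^esub> d) \<otimes>\<^bsub>C\<^esub> twist C e"
  using algebras(2) by (simp only: hom_algebra_def)

lemma counit_simps [simp]:
  "a \<in> carrier A \<Longrightarrow> counit A (twist A a) = counit A a"
  "c \<in> carrier C \<Longrightarrow> counit C (twist C c) = counit C c"
  "counit A \<one>\<^bsub>A\<^esub> = \<one>\<^bsub>K\<^esub>" "counit C \<one>\<^bsub>C\<^esub> = \<one>\<^bsub>K\<^esub>"
  "a \<in> carrier A \<Longrightarrow> b \<in> carrier A \<Longrightarrow> counit A (a \<otimes>\<^bsub>A\<^esub> b) = counit A a \<otimes>\<^bsub>K\<^esub> counit A b"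
  "c \<in> carrier C \<Longrightarrow> d \<in> carrier C \<Longrightarrow> counit C (c \<otimes>\<^bsub>C\<^esub> d) = counit C c \<otimes>\<^bsub>K\<^esub> counit C d"
  using bialgebras(2,3)
  by (simp_all add: hom_bialgebra_def hom_coalgebra_def hom_algebra_map_def ground_def)

lemma counit_twist_inv [simp]:
  "c \<in> carrier C \<Longrightarrow> counit C (twist_inv C c) = counit C c"
  using counit_simps(2)[of "twist_inv C c"] by (simp del: counit_simps)

lemma hact_twist [simp]:
  "h \<in> carrier H \<Longrightarrow> c \<in> carrier C \<Longrightarrow> twist C (hact C h c) = hact C (twist H h) (twist C c)"
  using module_C by (simp only: left_hom_module_def)

lemma hact_twist_inv [simp]:
  assumes "h \<in> carrier H" "c \<in> carrier C"
  shows "twist_inv C (hact C h c) = hact C (twist_inv H h) (twist_inv C c)"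
proof -
  have "twist_inv C (twist C (hact C (twist_inv H h) (twist_inv C c))) = hact C (twist_inv H h) (twist_inv C c)"
    using assms by (intro twist_inv_twist) auto
  then show ?thesis using assms by simp
qed

lemma comult_twist [simp]:
  assumes "module K U"
  shows "a \<in> carrier A \<Longrightarrow> bilinear_map K A A U f \<Longrightarrow> tensor_lift K A A U f (comult A (twist A a)) =
      tensor_lift K A A U (\<lambda>x y. f (twist A x) (twist A y)) (comult A a)"
    and "c \<in> carrier C \<Longrightarrow> bilinear_map K C C U g \<Longrightarrow> tensor_lift K C C U g (comult C (twist C c)) =
      tensor_lift K C C U (\<lambda>x y. g (twist C x) (twist C y)) (comult C c)"
    and "c \<in> carrier C \<Longrightarrow> bilinear_map K C C U g \<Longrightarrow> tensor_lift K C C U g (comult C (twist_inv C c)) =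
      tensor_lift K C C U (\<lambda>x y. g (twist_inv C x) (twist_inv C y)) (comult C c)"
  by (rule comodule_twist[OF coalgebra_comodule[OF coalgebras(1)]]
      comodule_twist[OF coalgebra_comodule[OF coalgebras(2)]]
      comodule_twist_inv[OF coalgebra_comodule[OF coalgebras(2)]]; simp add: assms)+

lemma comult_mult [simp]:
  assumes "module K U"
  shows "a \<in> carrier A \<Longrightarrow> b \<in> carrier A \<Longrightarrow> bilinear_map K A A U f \<Longrightarrow>
      tensor_lift K A A U f (comult A (a \<otimes>\<^bsub>A\<^esub> b)) =
      tensor_lift K A A U (\<lambda>a\<^sub>1 a\<^sub>2. tensor_lift K A A U (\<lambda>b\<^sub>1 b\<^sub>2. f (a\<^sub>1 \<otimes>\<^bsub>A\<^esub> b\<^sub>1) (a\<^sub>2 \<otimes>\<^bsub>A\<^esub> b\<^sub>2)) (comult A b)) (comult A a)"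
    and "c \<in> carrier C \<Longrightarrow> d \<in> carrier C \<Longrightarrow> bilinear_map K C C U g \<Longrightarrow>
      tensor_lift K C C U g (comult C (c \<otimes>\<^bsub>C\<^esub> d)) =
      tensor_lift K C C U (\<lambda>c\<^sub>1 c\<^sub>2. tensor_lift K C C U (\<lambda>d\<^sub>1 d\<^sub>2. g (c\<^sub>1 \<otimes>\<^bsub>C\<^esub> d\<^sub>1) (c\<^sub>2 \<otimes>\<^bsub>C\<^esub> d\<^sub>2)) (comult C d)) (comult C c)"
  by (rule bialgebra_comult_mult[OF bialgebras(2) assms] bialgebra_comult_mult[OF bialgebras(3) assms]; assumption)+

lemma comult_one [simp]:
  assumes "module K U"
  shows "bilinear_map K A A U f \<Longrightarrow> tensor_lift K A A U f (comult A \<one>\<^bsub>A\<^esub>) = f \<one>\<^bsub>A\<^esub> \<one>\<^bsub>A\<^esub>"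
    and "bilinear_map K C C U g \<Longrightarrow> tensor_lift K C C U g (comult C \<one>\<^bsub>C\<^esub>) = g \<one>\<^bsub>C\<^esub> \<one>\<^bsub>C\<^esub>"
  by (rule bialgebra_comult_one[OF bialgebras(2) assms] bialgebra_comult_one[OF bialgebras(3) assms]; assumption)+

section \<open>Doi-Hopf modules\<close>

abbreviation dh where "dh \<equiv> doi_hopf_module K A C"

lemma dh_module: "dh M \<Longrightarrow> left_hom_module K A M (act M)"
  and dh_comodule: "dh M \<Longrightarrow> right_hom_comodule K C M (coact M)"
  by (simp_all only: doi_hopf_module_def)

lemma dh_hom_space [simp]: "dh M \<Longrightarrow> hom_space K M"
  by (rule comodule_hom_space[OF dh_comodule])

lemma bilinear_act: "dh M \<Longrightarrow> bilinear_map K A M M (act M)"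
  using dh_module[of M] by (simp only: left_hom_module_def)

lemmas act_closed [simp] = bilinear_act[THEN bilinear_map_closed]
lemmas linear_act1 [simp] = bilinear_act[THEN bilinear_mapD1, THEN linear_map_comp]
lemmas linear_act2 [simp] = bilinear_act[THEN bilinear_mapD2, THEN linear_map_comp]
lemmas coact_closed [simp] = dh_comodule[THEN comodule_closed]
lemmas linear_coact [simp] = dh_comodule[THEN comodule_linear, THEN linear_map_comp]

lemma act_simps [simp]:
  assumes "dh M" "m \<in> carrier M"
  shows "act M \<one>\<^bsub>A\<^esub> m = twist M m"
    and "a \<in> carrier A \<Longrightarrow> twist M (act M a m) = act M (twist A a) (twist M m)"
    and "a \<in> carrier A \<Longrightarrow> b \<in> carrier A \<Longrightarrow> act M (twist A a) (act M b m) = act M (a \<otimes>\<^bsub>A\<^esub> b) (twist M m)"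
  using dh_module[OF assms(1)] assms(2) by (simp_all only: left_hom_module_def)

lemma act_twist_inv [simp]:
  assumes "dh M" "m \<in> carrier M" "a \<in> carrier A"
  shows "twist_inv M (act M a m) = act M (twist_inv A a) (twist_inv M m)"
proof -
  have "twist_inv M (twist M (act M (twist_inv A a) (twist_inv M m))) = act M (twist_inv A a) (twist_inv M m)"
    using assms by (intro twist_inv_twist) auto
  then show ?thesis using assms by simp
qed

lemma act_tensor_lift [simp]:
  assumes "dh M"
  shows "a \<in> carrier A \<Longrightarrow> (\<And>x y. x \<in> carrier X \<Longrightarrow> y \<in> carrier Y \<Longrightarrow> h x y \<in> carrier M) \<Longrightarrow>
      act M a (tensor_lift K X Y M h t) = tensor_lift K X Y M (\<lambda>x y. act M a (h x y)) t"
    and "m \<in> carrier M \<Longrightarrow> (\<And>x y. x \<in> carrier X \<Longrightarrow> y \<in> carrier Y \<Longrightarrow> g x y \<in> carrier A) \<Longrightarrow>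
      act M (tensor_lift K X Y A g t) m = tensor_lift K X Y M (\<lambda>x y. act M (g x y) m) t"
  using assms
  by (auto intro!: linear_tensor_lift[OF _ _ bilinear_mapD1[OF bilinear_act]]
      linear_tensor_lift[OF _ _ bilinear_mapD2[OF bilinear_act]])

lemma coact_tensor_lift [simp]:
  assumes "dh M" and "\<And>x y. x \<in> carrier X \<Longrightarrow> y \<in> carrier Y \<Longrightarrow> h x y \<in> carrier M"
  shows "coact M (tensor_lift K X Y M h t) = tensor_lift K X Y (M \<boxtimes>\<^bsub>K\<^esub> C) (\<lambda>x y. coact M (h x y)) t"
  using assms by (intro linear_tensor_lift[OF _ _ comodule_linear[OF dh_comodule]]) auto

lemma sweedler_coact [simp]:
  "dh M \<Longrightarrow> m \<in> carrier M \<Longrightarrow> sweedler U f (coact M m) = tensor_lift K M C U f (coact M m)"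
  by (rule sweedler_eq_tensor_lift) auto

lemma coact_twist [simp]:
  assumes "module K U" "dh M" "m \<in> carrier M" "bilinear_map K M C U f"
  shows "tensor_lift K M C U f (coact M (twist M m)) =
      tensor_lift K M C U (\<lambda>x y. f (twist M x) (twist C y)) (coact M m)"
    and "tensor_lift K M C U f (coact M (twist_inv M m)) =
      tensor_lift K M C U (\<lambda>x y. f (twist_inv M x) (twist_inv C y)) (coact M m)"
  using assms
  by (auto intro!: comodule_twist[OF dh_comodule] comodule_twist_inv[OF dh_comodule] simp del: bilinear_map_iff)

lemma coact_act:
  assumes "dh M" "a \<in> carrier A" "m \<in> carrier M"
  shows "coact M (act M a m) =
    tensor_lift K A H (M \<boxtimes>\<^bsub>K\<^esub> C) (\<lambda>a\<^sub>0 a\<^sub>1. tensor_lift K M C (M \<boxtimes>\<^bsub>K\<^esub> C)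
      (\<lambda>m\<^sub>0 m\<^sub>1. pure_tensor K M C (act M a\<^sub>0 m\<^sub>0) (hact C a\<^sub>1 m\<^sub>1)) (coact M m)) (hcoact A a)"
proof -
  from assms have "coact M (act M a m) =
    sweedler (M \<boxtimes>\<^bsub>K\<^esub> C) (\<lambda>a\<^sub>0 a\<^sub>1. sweedler (M \<boxtimes>\<^bsub>K\<^esub> C)
      (\<lambda>m\<^sub>0 m\<^sub>1. pure_tensor K M C (act M a\<^sub>0 m\<^sub>0) (hact C a\<^sub>1 m\<^sub>1)) (coact M m)) (hcoact A a)"
    by (simp only: doi_hopf_module_def)
  with assms show ?thesis by simp
qed

section \<open>The tensor product of two Doi-Hopf modules\<close>

lemma dh_tensor_space:
  obtains E where "dh_tensor K A C M N = hom_space.extend (M \<boxtimes>\<^bsub>K\<^esub> N) E"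
  by (simp add: dh_tensor_def Let_def)

lemma dh_tensor_simps [simp]:
  "carrier (dh_tensor K A C M N) = carrier (M \<boxtimes>\<^bsub>K\<^esub> N)"
  "twist (dh_tensor K A C M N) = twist (M \<boxtimes>\<^bsub>K\<^esub> N)"
  "twist_inv (dh_tensor K A C M N) = twist_inv (M \<boxtimes>\<^bsub>K\<^esub> N)"
  "smult (dh_tensor K A C M N) = smult (M \<boxtimes>\<^bsub>K\<^esub> N)"
  "dh_tensor K A C M N \<boxtimes>\<^bsub>K\<^esub> W = (M \<boxtimes>\<^bsub>K\<^esub> N) \<boxtimes>\<^bsub>K\<^esub> W"
  "W \<boxtimes>\<^bsub>K\<^esub> dh_tensor K A C M N = W \<boxtimes>\<^bsub>K\<^esub> (M \<boxtimes>\<^bsub>K\<^esub> N)"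
  "pure_tensor K (dh_tensor K A C M N) W = pure_tensor K (M \<boxtimes>\<^bsub>K\<^esub> N) W"
  "pure_tensor K W (dh_tensor K A C M N) = pure_tensor K W (M \<boxtimes>\<^bsub>K\<^esub> N)"
  "linear_map K (dh_tensor K A C M N) W = linear_map K (M \<boxtimes>\<^bsub>K\<^esub> N) W"
  "linear_map K W (dh_tensor K A C M N) = linear_map K W (M \<boxtimes>\<^bsub>K\<^esub> N)"
  "module K (dh_tensor K A C M N) = module K (M \<boxtimes>\<^bsub>K\<^esub> N)"
  "hom_space K (dh_tensor K A C M N) = hom_space K (M \<boxtimes>\<^bsub>K\<^esub> N)"
  "sweedler (dh_tensor K A C M N) = sweedler (M \<boxtimes>\<^bsub>K\<^esub> N)"
  "reassoc K (dh_tensor K A C M N) W W' = reassoc K (M \<boxtimes>\<^bsub>K\<^esub> N) W W'"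
  "tensor_map K (dh_tensor K A C M N) W = tensor_map K (M \<boxtimes>\<^bsub>K\<^esub> N) W"
  "tensor_map K W (dh_tensor K A C M N) = tensor_map K W (M \<boxtimes>\<^bsub>K\<^esub> N)"
  "tensor_lift K (dh_tensor K A C M N) W U = tensor_lift K (M \<boxtimes>\<^bsub>K\<^esub> N) W U"
  "tensor_lift K W (dh_tensor K A C M N) U = tensor_lift K W (M \<boxtimes>\<^bsub>K\<^esub> N) U"
  "tensor_lift K W W' (dh_tensor K A C M N) = tensor_lift K W W' (M \<boxtimes>\<^bsub>K\<^esub> N)"
  by (rule dh_tensor_space[of M N]; simp)+

lemma act_dh_tensor:
  assumes "dh M" "dh N" "a \<in> carrier A" "t \<in> carrier (M \<boxtimes>\<^bsub>K\<^esub> N)"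
  shows "act (dh_tensor K A C M N) a t = tensor_lift K M N (M \<boxtimes>\<^bsub>K\<^esub> N) (\<lambda>m n.
    tensor_lift K A A (M \<boxtimes>\<^bsub>K\<^esub> N) (\<lambda>a\<^sub>1 a\<^sub>2. pure_tensor K M N (act M a\<^sub>1 m) (act N a\<^sub>2 n)) (comult A a)) t"
  using assms
  by (simp add: dh_tensor_def Let_def hom_space.defs dh_module.defs sweedler_eq_tensor_lift[OF assms(4)])

lemma coact_dh_tensor:
  assumes "dh M" "dh N" "t \<in> carrier (M \<boxtimes>\<^bsub>K\<^esub> N)"
  shows "coact (dh_tensor K A C M N) t =
    tensor_lift K M N ((M \<boxtimes>\<^bsub>K\<^esub> N) \<boxtimes>\<^bsub>K\<^esub> C) (\<lambda>m n. tensor_lift K M C ((M \<boxtimes>\<^bsub>K\<^esub> N) \<boxtimes>\<^bsub>K\<^esub> C) (\<lambda>m\<^sub>0 m\<^sub>1.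
      tensor_lift K N C ((M \<boxtimes>\<^bsub>K\<^esub> N) \<boxtimes>\<^bsub>K\<^esub> C) (\<lambda>n\<^sub>0 n\<^sub>1.
        pure_tensor K (M \<boxtimes>\<^bsub>K\<^esub> N) C (pure_tensor K M N m\<^sub>0 n\<^sub>0) (twist_inv C (twist_inv C (m\<^sub>1 \<otimes>\<^bsub>C\<^esub> n\<^sub>1))))
       (coact N n)) (coact M m)) t"
  using assms
  by (simp add: dh_tensor_def Let_def hom_space.defs dh_module.defs sweedler_eq_tensor_lift[OF assms(3)]
      del: twist_inv_mult)

text \<open>
  When \<open>M\<close> or \<open>N\<close> is itself a tensor product of modules, terms about \<open>M \<otimes> N\<close> mention its underlying
  space instead. So the rules below speak of any spaces that give the same tensor product.
\<close>

lemma act_dh_tensor_pure [simp]: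
  assumes "pure_tensor K M N = pure_tensor K V W"
    and "dh M" "dh N" "a \<in> carrier A" "m \<in> carrier M" "n \<in> carrier N"
  shows "act (dh_tensor K A C M N) a (pure_tensor K V W m n) =
    tensor_lift K A A (M \<boxtimes>\<^bsub>K\<^esub> N) (\<lambda>a\<^sub>1 a\<^sub>2. pure_tensor K M N (act M a\<^sub>1 m) (act N a\<^sub>2 n)) (comult A a)"
  unfolding assms(1)[symmetric] using assms(2-) by (simp add: act_dh_tensor)

lemma coact_dh_tensor_pure [simp]:
  assumes "pure_tensor K M N = pure_tensor K V W"
    and "dh M" "dh N" "m \<in> carrier M" "n \<in> carrier N"
  shows "coact (dh_tensor K A C M N) (pure_tensor K V W m n) =
    tensor_lift K M C ((M \<boxtimes>\<^bsub>K\<^esub> N) \<boxtimes>\<^bsub>K\<^esub> C) (\<lambda>m\<^sub>0 m\<^sub>1. tensor_lift K N C ((M \<boxtimes>\<^bsub>K\<^esub> N) \<boxtimes>\<^bsub>K\<^esub> C) (\<lambda>n\<^sub>0 n\<^sub>1.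
        pure_tensor K (M \<boxtimes>\<^bsub>K\<^esub> N) C (pure_tensor K M N m\<^sub>0 n\<^sub>0) (twist_inv C (twist_inv C (m\<^sub>1 \<otimes>\<^bsub>C\<^esub> n\<^sub>1))))
       (coact N n)) (coact M m)"
  unfolding assms(1)[symmetric] using assms(2-) by (simp add: coact_dh_tensor)

lemma linear_act_dh_tensor:
  assumes "dh M" "dh N"
  shows "a \<in> carrier A \<Longrightarrow> linear_map K (M \<boxtimes>\<^bsub>K\<^esub> N) (M \<boxtimes>\<^bsub>K\<^esub> N) (\<lambda>t. act (dh_tensor K A C M N) a t)"
    and "t \<in> carrier (M \<boxtimes>\<^bsub>K\<^esub> N) \<Longrightarrow> linear_map K A (M \<boxtimes>\<^bsub>K\<^esub> N) (\<lambda>a. act (dh_tensor K A C M N) a t)"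
  by (rule linear_map_eqI[OF _ act_dh_tensor[OF assms]]; simp add: assms)+

lemma linear_coact_dh_tensor:
  assumes "dh M" "dh N"
  shows "linear_map K (M \<boxtimes>\<^bsub>K\<^esub> N) ((M \<boxtimes>\<^bsub>K\<^esub> N) \<boxtimes>\<^bsub>K\<^esub> C) (\<lambda>t. coact (dh_tensor K A C M N) t)"
  by (rule linear_map_eqI[OF _ coact_dh_tensor[OF assms]]; simp add: assms)

lemma linear_dh_tensor_comp [simp]:
  assumes "dh M" "dh N" and V: "M \<boxtimes>\<^bsub>K\<^esub> N = V"
  shows "a \<in> carrier A \<Longrightarrow> linear_map K X V f \<Longrightarrow> linear_map K X V (\<lambda>x. act (dh_tensor K A C M N) a (f x))"
    and "t \<in> carrier V \<Longrightarrow> linear_map K X A g \<Longrightarrow> linear_map K X V (\<lambda>x. act (dh_tensor K A C M N) (g x) t)"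
  unfolding V[symmetric]
  by (rule linear_map_comp[OF linear_act_dh_tensor(1)] linear_map_comp[OF linear_act_dh_tensor(2)];
      simp add: assms(1,2))+

lemma linear_coact_dh_tensor_comp [simp]:
  assumes "dh M" "dh N" and V: "(M \<boxtimes>\<^bsub>K\<^esub> N) \<boxtimes>\<^bsub>K\<^esub> C = V" and "linear_map K X (M \<boxtimes>\<^bsub>K\<^esub> N) f"
  shows "linear_map K X V (\<lambda>x. coact (dh_tensor K A C M N) (f x))"
  unfolding V[symmetric] using assms by (intro linear_map_comp[OF linear_coact_dh_tensor])

lemma act_dh_tensor_closed [simp]:
  "dh M \<Longrightarrow> dh N \<Longrightarrow> M \<boxtimes>\<^bsub>K\<^esub> N = V \<Longrightarrow> a \<in> carrier A \<Longrightarrow> t \<in> carrier V \<Longrightarrow>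
    act (dh_tensor K A C M N) a t \<in> carrier V"
  using linear_map_closed[OF linear_act_dh_tensor(1)] by blast

lemma coact_dh_tensor_closed [simp]:
  "dh M \<Longrightarrow> dh N \<Longrightarrow> (M \<boxtimes>\<^bsub>K\<^esub> N) \<boxtimes>\<^bsub>K\<^esub> C = V \<Longrightarrow> t \<in> carrier (M \<boxtimes>\<^bsub>K\<^esub> N) \<Longrightarrow>
    coact (dh_tensor K A C M N) t \<in> carrier V"
  using linear_map_closed[OF linear_coact_dh_tensor] by blast

lemma dh_tensor_tensor_lift [simp]:
  assumes MN: "dh M" "dh N" and V: "M \<boxtimes>\<^bsub>K\<^esub> N = V"
    and h: "\<And>x y. x \<in> carrier X \<Longrightarrow> y \<in> carrier Y \<Longrightarrow> h x y \<in> carrier V"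
  shows "a \<in> carrier A \<Longrightarrow> act (dh_tensor K A C M N) a (tensor_lift K X Y V h t) =
      tensor_lift K X Y V (\<lambda>x y. act (dh_tensor K A C M N) a (h x y)) t"
    and "coact (dh_tensor K A C M N) (tensor_lift K X Y V h t) =
      tensor_lift K X Y (V \<boxtimes>\<^bsub>K\<^esub> C) (\<lambda>x y. coact (dh_tensor K A C M N) (h x y)) t"
proof -
  note h' = h[folded V]
  show "a \<in> carrier A \<Longrightarrow> act (dh_tensor K A C M N) a (tensor_lift K X Y V h t) =
      tensor_lift K X Y V (\<lambda>x y. act (dh_tensor K A C M N) a (h x y)) t"
    unfolding V[symmetric] using MN h'
    by (intro linear_tensor_lift[OF _ _ linear_act_dh_tensor(1)]) auto
  show "coact (dh_tensor K A C M N) (tensor_lift K X Y V h t) =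
      tensor_lift K X Y (V \<boxtimes>\<^bsub>K\<^esub> C) (\<lambda>x y. coact (dh_tensor K A C M N) (h x y)) t"
    unfolding V[symmetric] using MN h'
    by (intro linear_tensor_lift[OF _ _ linear_coact_dh_tensor]) auto
qed

text \<open>
  \<open>A \<otimes> A\<close> acts on \<open>M \<otimes> N\<close> componentwise, and \<open>A\<close> acts through \<open>\<Delta>\<close>. So the three axioms follow from
  \<open>\<Delta>(1) = 1 \<otimes> 1\<close>, \<open>\<Delta>(\<alpha>(a)) = \<alpha>(a\<^sub>1) \<otimes> \<alpha>(a\<^sub>2)\<close> and \<open>\<Delta>(a b) = a\<^sub>1 b\<^sub>1 \<otimes> a\<^sub>2 b\<^sub>2\<close>; in the last one the sums over
  \<open>\<Delta>(a)\<close> and \<open>\<Delta>(b)\<close> appear in different orders on the two sides.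
\<close>

lemma left_hom_module_tensor:
  assumes [simp]: "dh M" "dh N"
  shows "left_hom_module K A (dh_tensor K A C M N) (act (dh_tensor K A C M N))"
proof -
  let ?T = "dh_tensor K A C M N" and ?MN = "M \<boxtimes>\<^bsub>K\<^esub> N"
  have one: "act ?T \<one>\<^bsub>A\<^esub> t = twist ?MN t" if "t \<in> carrier ?MN" for t
    by (rule linear_map_eq_on_tensor[where U = ?MN, OF _ _ _ _ _ _ that]) simp_all
  have tw: "twist ?MN (act ?T a t) = act ?T (twist A a) (twist ?MN t)"
    if "a \<in> carrier A" "t \<in> carrier ?MN" for a t
    by (rule linear_map_eq_on_tensor[where U = ?MN, OF _ _ _ _ _ _ that(2)]) (simp_all add: that)
  have assoc: "act ?T (twist A a) (act ?T b t) = act ?T (a \<otimes>\<^bsub>A\<^esub> b) (twist ?MN t)"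
    if [simp]: "a \<in> carrier A" "b \<in> carrier A" and t: "t \<in> carrier ?MN" for a b t
  proof (rule linear_map_eq_on_tensor[where U = ?MN, OF _ _ _ _ _ _ t])
    fix m n assume [simp]: "m \<in> carrier M" "n \<in> carrier N"
    show "act ?T (twist A a) (act ?T b (pure_tensor K M N m n)) =
        act ?T (a \<otimes>\<^bsub>A\<^esub> b) (twist ?MN (pure_tensor K M N m n))"
      by simp (rule tensor_lift_swap; simp)
  qed simp_all
  show ?thesis
    unfolding left_hom_module_def using one tw assoc
    by (auto simp: linear_act_dh_tensor)
qed

lemma coact_coassoc:
  assumes "dh M" "module K U"
    and "\<And>y z. y \<in> carrier C \<Longrightarrow> z \<in> carrier C \<Longrightarrow> linear_map K M U (\<lambda>x. f x y z)"
      "\<And>x z. x \<in> carrier M \<Longrightarrow> z \<in> carrier C \<Longrightarrow> linear_map K C U (\<lambda>y. f x y z)"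
      "\<And>x y. x \<in> carrier M \<Longrightarrow> y \<in> carrier C \<Longrightarrow> linear_map K C U (\<lambda>z. f x y z)"
    and "m \<in> carrier M"
  shows "tensor_lift K M C U (\<lambda>m\<^sub>0 m\<^sub>1. tensor_lift K M C U (\<lambda>x y. f x y (twist C m\<^sub>1)) (coact M m\<^sub>0)) (coact M m) =
    tensor_lift K M C U (\<lambda>m\<^sub>0 m\<^sub>1. tensor_lift K C C U (\<lambda>x y. f (twist M m\<^sub>0) x y) (comult C m\<^sub>1)) (coact M m)"
  using assms
  by (intro comodule_coassoc[OF dh_comodule hom_spaces(3) bialgebra_comult[OF bialgebras(3)]])

lemma coact_counit:
  assumes "dh M" "module K U" "linear_map K M U g" "m \<in> carrier M"
  shows "tensor_lift K M C U (\<lambda>m\<^sub>0 m\<^sub>1. counit C m\<^sub>1 \<odot>\<^bsub>U\<^esub> g m\<^sub>0) (coact M m) = g (twist M m)"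
  using assms by (intro comodule_counit[OF dh_comodule hom_spaces(3) bialgebra_counit[OF bialgebras(3)]])

lemma pure_tensor_comult [simp]:
  assumes "module K V" "v \<in> carrier V" "c \<in> carrier C"
  shows "pure_tensor K V (C \<boxtimes>\<^bsub>K\<^esub> C) v (comult C c) =
    tensor_lift K C C (V \<boxtimes>\<^bsub>K\<^esub> (C \<boxtimes>\<^bsub>K\<^esub> C)) (\<lambda>x y. pure_tensor K V (C \<boxtimes>\<^bsub>K\<^esub> C) v (pure_tensor K C C x y)) (comult C c)"
  using assms by (subst tensor_lift_pure_ident[of K C C "comult C c", symmetric]) simp_all

text \<open>
  Coassociativity of \<open>\<rho>\<close> on \<open>m \<otimes> n\<close>, after the identification of \<open>(M \<otimes> N \<otimes> C) \<otimes> C\<close> with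
  \<open>(M \<otimes> N) \<otimes> (C \<otimes> C)\<close>. The left-hand side involves \<open>\<alpha>(\<phi>(m\<^sub>1, n\<^sub>1)) = \<phi>(\<alpha>(m\<^sub>1), \<alpha>(n\<^sub>1))\<close>, which is what
  coassociativity of \<open>M\<close> and of \<open>N\<close> needs. Once the sums over \<open>m\<close> and over \<open>n\<close> are separated, both can be
  applied, and the result is \<open>\<Delta>(\<phi>(m\<^sub>1, n\<^sub>1))\<close> because \<open>\<Delta>\<close> is multiplicative.
\<close>

lemma coassoc_tensor_pure:
  assumes [simp]: "dh M" "dh N" "m \<in> carrier M" "n \<in> carrier N"
  defines "T \<equiv> dh_tensor K A C M N"
  defines "U \<equiv> (M \<boxtimes>\<^bsub>K\<^esub> N) \<boxtimes>\<^bsub>K\<^esub> (C \<boxtimes>\<^bsub>K\<^esub> C)"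
  shows "tensor_lift K (M \<boxtimes>\<^bsub>K\<^esub> N) C U (\<lambda>s c. tensor_lift K (M \<boxtimes>\<^bsub>K\<^esub> N) C U (\<lambda>u v.
       pure_tensor K (M \<boxtimes>\<^bsub>K\<^esub> N) (C \<boxtimes>\<^bsub>K\<^esub> C) u (pure_tensor K C C v (twist C c))) (coact T s)) (coact T (pure_tensor K M N m n)) =
     tensor_lift K (M \<boxtimes>\<^bsub>K\<^esub> N) C U (\<lambda>s c.
       pure_tensor K (M \<boxtimes>\<^bsub>K\<^esub> N) (C \<boxtimes>\<^bsub>K\<^esub> C) (twist (M \<boxtimes>\<^bsub>K\<^esub> N) s) (comult C c)) (coact T (pure_tensor K M N m n))"
    (is "?L = ?R")
proof -
  define f where "f x y z u v w = pure_tensor K (M \<boxtimes>\<^bsub>K\<^esub> N) (C \<boxtimes>\<^bsub>K\<^esub> C) (pure_tensor K M N x u)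
     (pure_tensor K C C (twist_inv C (twist_inv C (y \<otimes>\<^bsub>C\<^esub> v))) (twist_inv C (twist_inv C (z \<otimes>\<^bsub>C\<^esub> w))))"
    for x y z u v w
  have [simp]: "module K U" by (simp add: U_def)
  have cl: "f x y z u v w \<in> carrier U"
    if "x \<in> carrier M" "y \<in> carrier C" "z \<in> carrier C" "u \<in> carrier N" "v \<in> carrier C" "w \<in> carrier C" for x y z u v w
    using that by (simp add: f_def U_def)
  have lin:
    "\<lbrakk>y \<in> carrier C; z \<in> carrier C; u \<in> carrier N; v \<in> carrier C; w \<in> carrier C; linear_map K X M g\<rbrakk>
      \<Longrightarrow> linear_map K X U (\<lambda>x. f (g x) y z u v w)"
    "\<lbrakk>x \<in> carrier M; z \<in> carrier C; u \<in> carrier N; v \<in> carrier C; w \<in> carrier C; linear_map K X C h\<rbrakk>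
      \<Longrightarrow> linear_map K X U (\<lambda>y. f x (h y) z u v w)"
    "\<lbrakk>x \<in> carrier M; y \<in> carrier C; u \<in> carrier N; v \<in> carrier C; w \<in> carrier C; linear_map K X C h\<rbrakk>
      \<Longrightarrow> linear_map K X U (\<lambda>z. f x y (h z) u v w)"
    "\<lbrakk>x \<in> carrier M; y \<in> carrier C; z \<in> carrier C; v \<in> carrier C; w \<in> carrier C; linear_map K X N k\<rbrakk>
      \<Longrightarrow> linear_map K X U (\<lambda>u. f x y z (k u) v w)"
    "\<lbrakk>x \<in> carrier M; y \<in> carrier C; z \<in> carrier C; u \<in> carrier N; w \<in> carrier C; linear_map K X C h\<rbrakk>
      \<Longrightarrow> linear_map K X U (\<lambda>v. f x y z u (h v) w)"
    "\<lbrakk>x \<in> carrier M; y \<in> carrier C; z \<in> carrier C; u \<in> carrier N; v \<in> carrier C; linear_map K X C h\<rbrakk>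
      \<Longrightarrow> linear_map K X U (\<lambda>w. f x y z u v (h w))"
    for X :: "('k, 'c, 'd) module_scheme" and g h k x y z u v w
    unfolding U_def f_def by simp_all
  have "?L = tensor_lift K M C U (\<lambda>m\<^sub>0 m\<^sub>1. tensor_lift K N C U (\<lambda>n\<^sub>0 n\<^sub>1. tensor_lift K M C U (\<lambda>x y.
      tensor_lift K N C U (\<lambda>u v. f x y (twist C m\<^sub>1) u v (twist C n\<^sub>1)) (coact N n\<^sub>0)) (coact M m\<^sub>0)) (coact N n)) (coact M m)"
    unfolding T_def U_def by (simp add: f_def)
  also have "\<dots> = tensor_lift K M C U (\<lambda>m\<^sub>0 m\<^sub>1. tensor_lift K M C U (\<lambda>x y. tensor_lift K N C U (\<lambda>n\<^sub>0 n\<^sub>1.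
      tensor_lift K N C U (\<lambda>u v. f x y (twist C m\<^sub>1) u v (twist C n\<^sub>1)) (coact N n\<^sub>0)) (coact N n)) (coact M m\<^sub>0)) (coact M m)"
    by (rule tensor_lift_cong[OF HOL.refl], rule tensor_lift_swap) (simp_all add: cl)
  also have "\<dots> = tensor_lift K M C U (\<lambda>m\<^sub>0 m\<^sub>1. tensor_lift K M C U (\<lambda>x y. tensor_lift K N C U (\<lambda>n\<^sub>0 n\<^sub>1.
      tensor_lift K C C U (\<lambda>u v. f x y (twist C m\<^sub>1) (twist N n\<^sub>0) u v) (comult C n\<^sub>1)) (coact N n)) (coact M m\<^sub>0)) (coact M m)"
    by (rule tensor_lift_cong[OF HOL.refl], rule tensor_lift_cong[OF HOL.refl], rule coact_coassoc)
      (simp_all add: lin)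
  also have "\<dots> = tensor_lift K M C U (\<lambda>m\<^sub>0 m\<^sub>1. tensor_lift K C C U (\<lambda>x y. tensor_lift K N C U (\<lambda>n\<^sub>0 n\<^sub>1.
      tensor_lift K C C U (\<lambda>u v. f (twist M m\<^sub>0) x y (twist N n\<^sub>0) u v) (comult C n\<^sub>1)) (coact N n)) (comult C m\<^sub>1)) (coact M m)"
    by (rule coact_coassoc) (simp_all add: lin)
  also have "\<dots> = tensor_lift K M C U (\<lambda>m\<^sub>0 m\<^sub>1. tensor_lift K N C U (\<lambda>n\<^sub>0 n\<^sub>1. tensor_lift K C C U (\<lambda>x y.
      tensor_lift K C C U (\<lambda>u v. f (twist M m\<^sub>0) x y (twist N n\<^sub>0) u v) (comult C n\<^sub>1)) (comult C m\<^sub>1)) (coact N n)) (coact M m)"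
    by (rule tensor_lift_cong[OF HOL.refl], rule tensor_lift_swap) (simp_all add: cl)
  also have "\<dots> = ?R"
    unfolding T_def U_def by (simp add: f_def)
  finally show ?thesis .
qed

text \<open>
  The counit law uses \<open>\<epsilon>(\<phi>(c, d)) = \<epsilon>(c) \<epsilon>(d)\<close>, which lets the two counits act one after the other.
\<close>

lemma right_hom_comodule_tensor:
  assumes [simp]: "dh M" "dh N"
  shows "right_hom_comodule K C (dh_tensor K A C M N) (coact (dh_tensor K A C M N))"
proof -
  let ?T = "dh_tensor K A C M N" and ?MN = "M \<boxtimes>\<^bsub>K\<^esub> N"
  have counit: "sweedler ?MN (\<lambda>s c. counit C c \<odot>\<^bsub>?MN\<^esub> s) (coact ?T t) = twist ?MN t"
    if t: "t \<in> carrier ?MN" for t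
  proof -
    have "tensor_lift K ?MN C ?MN (\<lambda>s c. counit C c \<odot>\<^bsub>?MN\<^esub> s) (coact ?T t) = twist ?MN t"
    proof (rule linear_map_eq_on_tensor[where U = ?MN, OF _ _ _ _ _ _ t])
      fix m n assume [simp]: "m \<in> carrier M" "n \<in> carrier N"
      have "tensor_lift K ?MN C ?MN (\<lambda>s c. counit C c \<odot>\<^bsub>?MN\<^esub> s) (coact ?T (pure_tensor K M N m n)) =
          tensor_lift K M C ?MN (\<lambda>m\<^sub>0 m\<^sub>1. tensor_lift K N C ?MN (\<lambda>n\<^sub>0 n\<^sub>1.
            counit C n\<^sub>1 \<odot>\<^bsub>?MN\<^esub> (counit C m\<^sub>1 \<odot>\<^bsub>?MN\<^esub> pure_tensor K M N m\<^sub>0 n\<^sub>0)) (coact N n)) (coact M m)"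
        by (simp add: module.smult_assoc1[of K, symmetric] cring.cring_simprules(14)[OF cring])
      also have "\<dots> = tensor_lift K M C ?MN (\<lambda>m\<^sub>0 m\<^sub>1.
            counit C m\<^sub>1 \<odot>\<^bsub>?MN\<^esub> pure_tensor K M N m\<^sub>0 (twist N n)) (coact M m)"
        by (rule tensor_lift_cong[OF HOL.refl], rule coact_counit) simp_all
      also have "\<dots> = pure_tensor K M N (twist M m) (twist N n)"
        by (rule coact_counit) simp_all
      finally show "tensor_lift K ?MN C ?MN (\<lambda>s c. counit C c \<odot>\<^bsub>?MN\<^esub> s) (coact ?T (pure_tensor K M N m n)) =
          twist ?MN (pure_tensor K M N m n)" by simp
    qed simp_all
    then show ?thesis
      using t by (simp add: sweedler_eq_tensor_lift[where V = ?MN and W = C and K = K])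
  qed
  have tw: "tensor_map K ?MN C (twist ?MN) (twist C) (coact ?T t) = coact ?T (twist ?MN t)"
    if t: "t \<in> carrier ?MN" for t
  proof -
    have "tensor_lift K ?MN C (?MN \<boxtimes>\<^bsub>K\<^esub> C) (\<lambda>s c. pure_tensor K ?MN C (twist ?MN s) (twist C c)) (coact ?T t) =
        coact ?T (twist ?MN t)"
      by (rule linear_map_eq_on_tensor[where U = "?MN \<boxtimes>\<^bsub>K\<^esub> C", OF _ _ _ _ _ _ t]) simp_all
    then show ?thesis using t by (simp add: tensor_map_eq_lift[of K ?MN C])
  qed
  have coassoc: "reassoc K ?T C C (tensor_map K (?MN \<boxtimes>\<^bsub>K\<^esub> C) C (coact ?T) (twist C) (coact ?T t)) =
      tensor_map K ?T (C \<boxtimes>\<^bsub>K\<^esub> C) (twist ?MN) (comult C) (coact ?T t)"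
    if t: "t \<in> carrier ?MN" for t
  proof -
    let ?U = "?MN \<boxtimes>\<^bsub>K\<^esub> (C \<boxtimes>\<^bsub>K\<^esub> C)"
    have "tensor_lift K (M \<boxtimes>\<^bsub>K\<^esub> N) C ?U (\<lambda>s c. tensor_lift K (M \<boxtimes>\<^bsub>K\<^esub> N) C ?U (\<lambda>u v.
       pure_tensor K (M \<boxtimes>\<^bsub>K\<^esub> N) (C \<boxtimes>\<^bsub>K\<^esub> C) u (pure_tensor K C C v (twist C c))) (coact ?T s)) (coact ?T t) =
      tensor_lift K (M \<boxtimes>\<^bsub>K\<^esub> N) C ?U (\<lambda>s c.
       pure_tensor K (M \<boxtimes>\<^bsub>K\<^esub> N) (C \<boxtimes>\<^bsub>K\<^esub> C) (twist (M \<boxtimes>\<^bsub>K\<^esub> N) s) (comult C c)) (coact ?T t)"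
    proof (rule linear_map_eq_on_tensor[where U = ?U, OF _ _ _ _ _ _ t], goal_cases)
      case (6 m n)
      then show ?case by (rule coassoc_tensor_pure[OF assms])
    qed (simp_all del: pure_tensor_comult)
    then show ?thesis using t
      by (simp add: tensor_map_eq_lift[of K ?MN C] reassoc_eq_lift del: pure_tensor_comult)
  qed
  show ?thesis
    unfolding right_hom_comodule_def using counit tw coassoc
    by (auto simp: linear_coact_dh_tensor)
qed

text \<open>
  The first axiom of a monoidal datum is an equation in \<open>A \<otimes> (A \<otimes> C)\<close>; this is its image under the linear
  map induced by a trilinear \<open>f\<close>.
\<close>

lemma datum_compatible:
  assumes U [simp]: "module K U" and [simp]: "a \<in> carrier A" "c \<in> carrier C" "d \<in> carrier C"
    and f: "\<And>y z. y \<in> carrier A \<Longrightarrow> z \<in> carrier C \<Longrightarrow> linear_map K A U (\<lambda>x. f x y z)"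
      "\<And>x z. x \<in> carrier A \<Longrightarrow> z \<in> carrier C \<Longrightarrow> linear_map K A U (\<lambda>y. f x y z)"
      "\<And>x y. x \<in> carrier A \<Longrightarrow> y \<in> carrier A \<Longrightarrow> linear_map K C U (\<lambda>z. f x y z)"
  shows "tensor_lift K A H U (\<lambda>a\<^sub>0 a\<^sub>1. tensor_lift K A A U (\<lambda>x y.
      f x y (hact C (twist H (twist H a\<^sub>1)) (c \<otimes>\<^bsub>C\<^esub> d))) (comult A a\<^sub>0)) (hcoact A a) =
    tensor_lift K A A U (\<lambda>a\<^sub>1 a\<^sub>2. tensor_lift K A H U (\<lambda>x h. tensor_lift K A H U (\<lambda>y g.
      f x y (hact C h c \<otimes>\<^bsub>C\<^esub> hact C g d)) (hcoact A a\<^sub>2)) (hcoact A a\<^sub>1)) (comult A a)"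
proof -
  let ?AC = "A \<boxtimes>\<^bsub>K\<^esub> C"
  let ?AAC = "A \<boxtimes>\<^bsub>K\<^esub> ?AC"
  let ?t = "\<lambda>x y z. pure_tensor K A ?AC x (pure_tensor K A C y z)"
  note [simp] = f[THEN linear_map_comp]
  have ax: "sweedler ?AAC (\<lambda>a\<^sub>0 a\<^sub>1. sweedler ?AAC (\<lambda>a\<^sub>0\<^sub>1 a\<^sub>0\<^sub>2.
        ?t a\<^sub>0\<^sub>1 a\<^sub>0\<^sub>2 (hact C (twist H (twist H a\<^sub>1)) (c \<otimes>\<^bsub>C\<^esub> d))) (comult A a\<^sub>0)) (hcoact A a) =
      sweedler ?AAC (\<lambda>a\<^sub>1 a\<^sub>2. sweedler ?AAC (\<lambda>a\<^sub>1\<^sub>0 a\<^sub>1\<^sub>1. sweedler ?AAC (\<lambda>a\<^sub>2\<^sub>0 a\<^sub>2\<^sub>1.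
        ?t a\<^sub>1\<^sub>0 a\<^sub>2\<^sub>0 (hact C a\<^sub>1\<^sub>1 c \<otimes>\<^bsub>C\<^esub> hact C a\<^sub>2\<^sub>1 d)) (hcoact A a\<^sub>2)) (hcoact A a\<^sub>1)) (comult A a)"
    using datum by (simp only: monoidal_doi_hopf_datum_def Let_def assms)
  let ?F = "tensor_lift K A ?AC U (\<lambda>x s. tensor_lift K A C U (\<lambda>y z. f x y z) s)"
  from ax have "?F (tensor_lift K A H ?AAC (\<lambda>a\<^sub>0 a\<^sub>1. tensor_lift K A A ?AAC (\<lambda>a\<^sub>0\<^sub>1 a\<^sub>0\<^sub>2.
        ?t a\<^sub>0\<^sub>1 a\<^sub>0\<^sub>2 (hact C (twist H (twist H a\<^sub>1)) (c \<otimes>\<^bsub>C\<^esub> d))) (comult A a\<^sub>0)) (hcoact A a)) =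
      ?F (tensor_lift K A A ?AAC (\<lambda>a\<^sub>1 a\<^sub>2. tensor_lift K A H ?AAC (\<lambda>a\<^sub>1\<^sub>0 a\<^sub>1\<^sub>1. tensor_lift K A H ?AAC (\<lambda>a\<^sub>2\<^sub>0 a\<^sub>2\<^sub>1.
        ?t a\<^sub>1\<^sub>0 a\<^sub>2\<^sub>0 (hact C a\<^sub>1\<^sub>1 c \<otimes>\<^bsub>C\<^esub> hact C a\<^sub>2\<^sub>1 d)) (hcoact A a\<^sub>2)) (hcoact A a\<^sub>1)) (comult A a))"
    by simp
  then show ?thesis by simp
qed

text \<open>
  The compatibility of action and coaction on \<open>m \<otimes> n\<close>. The left-hand side is a sum over \<open>\<Delta>(a)\<close>,
  \<open>\<rho>(a\<^sub>1)\<close>, \<open>\<rho>(m)\<close>, \<open>\<rho>(a\<^sub>2)\<close>, \<open>\<rho>(n)\<close>, in this order. Moving the sums over \<open>\<rho>(m)\<close> and \<open>\<rho>(n)\<close> to the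
  outside leaves the right-hand side of the first axiom of a monoidal datum with \<open>c = m\<^sub>1\<close> and \<open>d = n\<^sub>1\<close>.
\<close>

lemma coact_act_tensor_pure:
  assumes [simp]: "dh M" "dh N" "a \<in> carrier A" "m \<in> carrier M" "n \<in> carrier N"
  defines "T \<equiv> dh_tensor K A C M N" and "U \<equiv> (M \<boxtimes>\<^bsub>K\<^esub> N) \<boxtimes>\<^bsub>K\<^esub> C"
  shows "coact T (act T a (pure_tensor K M N m n)) =
    tensor_lift K A H U (\<lambda>a\<^sub>0 a\<^sub>1. tensor_lift K (M \<boxtimes>\<^bsub>K\<^esub> N) C U (\<lambda>m\<^sub>0 m\<^sub>1.
        pure_tensor K (M \<boxtimes>\<^bsub>K\<^esub> N) C (act T a\<^sub>0 m\<^sub>0) (hact C a\<^sub>1 m\<^sub>1)) (coact T (pure_tensor K M N m n))) (hcoact A a)"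
proof -
  define f where "f p q x y z = pure_tensor K (M \<boxtimes>\<^bsub>K\<^esub> N) C
     (pure_tensor K M N (act M x p) (act N y q)) (twist_inv C (twist_inv C z))" for p q x y z
  have [simp]: "module K U" by (simp add: U_def)
  have cl: "f p q x y z \<in> carrier U"
    if "p \<in> carrier M" "q \<in> carrier N" "x \<in> carrier A" "y \<in> carrier A" "z \<in> carrier C" for p q x y z
    using that by (simp add: f_def U_def)
  have lin:
    "\<lbrakk>p \<in> carrier M; q \<in> carrier N; y \<in> carrier A; z \<in> carrier C; linear_map K X A g\<rbrakk>
      \<Longrightarrow> linear_map K X U (\<lambda>x. f p q (g x) y z)"
    "\<lbrakk>p \<in> carrier M; q \<in> carrier N; x \<in> carrier A; z \<in> carrier C; linear_map K X A g\<rbrakk>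
      \<Longrightarrow> linear_map K X U (\<lambda>y. f p q x (g y) z)"
    "\<lbrakk>p \<in> carrier M; q \<in> carrier N; x \<in> carrier A; y \<in> carrier A; linear_map K X C h\<rbrakk>
      \<Longrightarrow> linear_map K X U (\<lambda>z. f p q x y (h z))"
    for X :: "('k, 'c, 'd) module_scheme" and g h p q x y z
    unfolding U_def f_def by simp_all
  have "coact T (act T a (pure_tensor K M N m n)) =
      tensor_lift K A A U (\<lambda>a\<^sub>1 a\<^sub>2. tensor_lift K A H U (\<lambda>x h. tensor_lift K M C U (\<lambda>m\<^sub>0 m\<^sub>1.
        tensor_lift K A H U (\<lambda>y g. tensor_lift K N C U (\<lambda>n\<^sub>0 n\<^sub>1.
          f m\<^sub>0 n\<^sub>0 x y (hact C h m\<^sub>1 \<otimes>\<^bsub>C\<^esub> hact C g n\<^sub>1))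
        (coact N n)) (hcoact A a\<^sub>2)) (coact M m)) (hcoact A a\<^sub>1)) (comult A a)"
    unfolding T_def U_def by (simp add: f_def coact_act)
  also have "\<dots> =
      tensor_lift K A A U (\<lambda>a\<^sub>1 a\<^sub>2. tensor_lift K M C U (\<lambda>m\<^sub>0 m\<^sub>1. tensor_lift K A H U (\<lambda>x h.
        tensor_lift K N C U (\<lambda>n\<^sub>0 n\<^sub>1. tensor_lift K A H U (\<lambda>y g.
          f m\<^sub>0 n\<^sub>0 x y (hact C h m\<^sub>1 \<otimes>\<^bsub>C\<^esub> hact C g n\<^sub>1))
        (hcoact A a\<^sub>2)) (coact N n)) (hcoact A a\<^sub>1)) (coact M m)) (comult A a)"
    apply (rule tensor_lift_cong[OF HOL.refl])
    apply (subst tensor_lift_swap[of K U A H M C])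
    apply (simp_all add: cl)
    apply (rule tensor_lift_cong[OF HOL.refl])
    apply (rule tensor_lift_cong[OF HOL.refl])
    apply (rule tensor_lift_swap; simp add: cl)
    done
  also have "\<dots> =
      tensor_lift K M C U (\<lambda>m\<^sub>0 m\<^sub>1. tensor_lift K A A U (\<lambda>a\<^sub>1 a\<^sub>2. tensor_lift K N C U (\<lambda>n\<^sub>0 n\<^sub>1.
        tensor_lift K A H U (\<lambda>x h. tensor_lift K A H U (\<lambda>y g.
          f m\<^sub>0 n\<^sub>0 x y (hact C h m\<^sub>1 \<otimes>\<^bsub>C\<^esub> hact C g n\<^sub>1))
        (hcoact A a\<^sub>2)) (hcoact A a\<^sub>1)) (coact N n)) (comult A a)) (coact M m)"
    apply (subst tensor_lift_swap[of K U A A M C])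
    apply (simp_all add: cl)
    apply (rule tensor_lift_cong[OF HOL.refl])
    apply (rule tensor_lift_cong[OF HOL.refl])
    apply (rule tensor_lift_swap; simp add: cl)
    done
  also have "\<dots> =
      tensor_lift K M C U (\<lambda>m\<^sub>0 m\<^sub>1. tensor_lift K N C U (\<lambda>n\<^sub>0 n\<^sub>1. tensor_lift K A A U (\<lambda>a\<^sub>1 a\<^sub>2.
        tensor_lift K A H U (\<lambda>x h. tensor_lift K A H U (\<lambda>y g.
          f m\<^sub>0 n\<^sub>0 x y (hact C h m\<^sub>1 \<otimes>\<^bsub>C\<^esub> hact C g n\<^sub>1))
        (hcoact A a\<^sub>2)) (hcoact A a\<^sub>1)) (comult A a)) (coact N n)) (coact M m)"
    by (rule tensor_lift_cong[OF HOL.refl], rule tensor_lift_swap) (simp_all add: cl)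
  \<comment> \<open>Now the outer two sums fix the elements of \<open>C\<close> in the axiom.\<close>
  also have "\<dots> =
      tensor_lift K M C U (\<lambda>m\<^sub>0 m\<^sub>1. tensor_lift K N C U (\<lambda>n\<^sub>0 n\<^sub>1. tensor_lift K A H U (\<lambda>a\<^sub>0 a\<^sub>1.
        tensor_lift K A A U (\<lambda>x y. f m\<^sub>0 n\<^sub>0 x y (hact C (twist H (twist H a\<^sub>1)) (m\<^sub>1 \<otimes>\<^bsub>C\<^esub> n\<^sub>1)))
        (comult A a\<^sub>0)) (hcoact A a)) (coact N n)) (coact M m)"
    by (rule tensor_lift_cong[OF HOL.refl], rule tensor_lift_cong[OF HOL.refl], rule datum_compatible[symmetric])
      (simp_all add: lin)
  also have "\<dots> =
      tensor_lift K A H U (\<lambda>a\<^sub>0 a\<^sub>1. tensor_lift K M C U (\<lambda>m\<^sub>0 m\<^sub>1. tensor_lift K N C U (\<lambda>n\<^sub>0 n\<^sub>1.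
        tensor_lift K A A U (\<lambda>x y. f m\<^sub>0 n\<^sub>0 x y (hact C (twist H (twist H a\<^sub>1)) (m\<^sub>1 \<otimes>\<^bsub>C\<^esub> n\<^sub>1)))
        (comult A a\<^sub>0)) (coact N n)) (coact M m)) (hcoact A a)"
    apply (subst tensor_lift_swap[of K U A H M C])
    apply (simp_all add: cl)
    apply (rule tensor_lift_cong[OF HOL.refl])
    apply (rule tensor_lift_swap; simp add: cl)
    done
  also have "\<dots> = tensor_lift K A H U (\<lambda>a\<^sub>0 a\<^sub>1. tensor_lift K (M \<boxtimes>\<^bsub>K\<^esub> N) C U (\<lambda>m\<^sub>0 m\<^sub>1.
        pure_tensor K (M \<boxtimes>\<^bsub>K\<^esub> N) C (act T a\<^sub>0 m\<^sub>0) (hact C a\<^sub>1 m\<^sub>1)) (coact T (pure_tensor K M N m n))) (hcoact A a)"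
    unfolding T_def U_def by (simp add: f_def)
  finally show ?thesis .
qed

lemma doi_hopf_module_tensor:
  assumes [simp]: "dh M" "dh N"
  shows "dh (dh_tensor K A C M N)"
proof -
  let ?T = "dh_tensor K A C M N" and ?MN = "M \<boxtimes>\<^bsub>K\<^esub> N"
  let ?U = "?MN \<boxtimes>\<^bsub>K\<^esub> C"
  have "coact ?T (act ?T a t) = sweedler ?U (\<lambda>a\<^sub>0 a\<^sub>1. sweedler ?U (\<lambda>m\<^sub>0 m\<^sub>1.
        pure_tensor K ?MN C (act ?T a\<^sub>0 m\<^sub>0) (hact C a\<^sub>1 m\<^sub>1)) (coact ?T t)) (hcoact A a)"
    if [simp]: "a \<in> carrier A" and t: "t \<in> carrier ?MN" for a t
  proof -
    have "coact ?T (act ?T a t) = tensor_lift K A H ?U (\<lambda>a\<^sub>0 a\<^sub>1. tensor_lift K ?MN C ?U (\<lambda>m\<^sub>0 m\<^sub>1.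
        pure_tensor K ?MN C (act ?T a\<^sub>0 m\<^sub>0) (hact C a\<^sub>1 m\<^sub>1)) (coact ?T t)) (hcoact A a)"
    proof (rule linear_map_eq_on_tensor[where U = ?U, OF _ _ _ _ _ _ t], goal_cases)
      case (6 m n)
      with that(1) show ?case by (rule coact_act_tensor_pure[OF assms])
    qed simp_all
    then show ?thesis
      using t by (simp add: sweedler_eq_tensor_lift[where V = ?MN and W = C and K = K])
  qed
  then show ?thesis
    unfolding doi_hopf_module_def
    by (auto intro: left_hom_module_tensor right_hom_comodule_tensor)
qed

end

context scalars
begin

section \<open>The unit object\<close>

lemma unit_space_simps [simp]:
  "twist (unit_space K) t = t"
  "one (unit_space K) = Scalar \<one>\<^bsub>K\<^esub>"
  "c \<odot>\<^bsub>unit_space K\<^esub> t = Scalar (c \<otimes>\<^bsub>K\<^esub> scal t)"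
  by (simp_all add: unit_space_def)

lemma unit_space_carrier: "carrier (unit_space K) = Scalar ` carrier K"
  by (simp add: unit_space_def)

lemma module_unit_space: "module K (unit_space K)"
proof -
  interpret cring K by (rule cring)
  have "abelian_group (unit_space K)"
    by (rule abelian_groupI) (auto simp: unit_space_def a_ac intro: a_inv_closed l_neg)
  then show ?thesis
    by (intro moduleI) (auto simp: unit_space_def l_distr r_distr m_assoc intro: cring)
qed

lemma hom_space_unit_space [simp]: "hom_space K (unit_space K)"
proof -
  have t: "twist (unit_space K) = (\<lambda>t. t)" by (simp add: fun_eq_iff)
  show ?thesis
    unfolding hom_space_def t by (auto simp: module_unit_space bij_betw_def)
qed

lemma twist_inv_unit_space [simp]: "t \<in> carrier (unit_space K) \<Longrightarrow> twist_inv (unit_space K) t = t"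
  using twist_inv_twist[OF hom_space_unit_space, of t] by simp

lemma scal_closed [simp]: "t \<in> carrier (unit_space K) \<Longrightarrow> scal t \<in> carrier K"
  by (auto simp: unit_space_carrier)

lemma Scalar_closed [simp]: "c \<in> carrier K \<Longrightarrow> Scalar c \<in> carrier (unit_space K)"
  by (auto simp: unit_space_carrier)

lemma linear_scal: "linear_map K (unit_space K) (ground K) scal"
  by (auto simp: linear_map_def unit_space_def ground_def)

lemmas linear_scal_comp [simp] = linear_map_comp[OF linear_scal]

lemma scalar_one_closed [simp]: "\<one>\<^bsub>K\<^esub> \<in> carrier K"
  using cring by (simp add: cring.cring_simprules(6))

lemma Scalar_scal [simp]: "t \<in> carrier (unit_space K) \<Longrightarrow> Scalar (scal t) = t"
  by (auto simp: unit_space_carrier)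

lemma scalar_mult_closed [simp]: "c \<in> carrier K \<Longrightarrow> d \<in> carrier K \<Longrightarrow> c \<otimes>\<^bsub>K\<^esub> d \<in> carrier K"
  using cring by (simp add: cring.cring_simprules(5))

lemma scalar_one_mult [simp]:
  "c \<in> carrier K \<Longrightarrow> \<one>\<^bsub>K\<^esub> \<otimes>\<^bsub>K\<^esub> c = c" "c \<in> carrier K \<Longrightarrow> c \<otimes>\<^bsub>K\<^esub> \<one>\<^bsub>K\<^esub> = c"
  by (simp_all add: cring.axioms(1)[OF cring] ring.axioms monoid.l_one monoid.r_one)

lemma smult_one [simp]: "module K V \<Longrightarrow> v \<in> carrier V \<Longrightarrow> \<one>\<^bsub>K\<^esub> \<odot>\<^bsub>V\<^esub> v = v"
  by (rule module.smult_one)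

lemma smult_smult [simp]:
  "module K V \<Longrightarrow> c \<in> carrier K \<Longrightarrow> d \<in> carrier K \<Longrightarrow> v \<in> carrier V \<Longrightarrow>
    (c \<otimes>\<^bsub>K\<^esub> d) \<odot>\<^bsub>V\<^esub> v = c \<odot>\<^bsub>V\<^esub> (d \<odot>\<^bsub>V\<^esub> v)"
  by (rule module.smult_assoc1)

lemma smult_tensor_lift [simp]:
  "module K U \<Longrightarrow> c \<in> carrier K \<Longrightarrow> (\<And>x y. x \<in> carrier X \<Longrightarrow> y \<in> carrier Y \<Longrightarrow> h x y \<in> carrier U) \<Longrightarrow>
    c \<odot>\<^bsub>U\<^esub> tensor_lift K X Y U h t = tensor_lift K X Y U (\<lambda>x y. c \<odot>\<^bsub>U\<^esub> h x y) t"
  by (rule linear_tensor_lift[OF _ _ linear_map_smult_const])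

lemma tensor_lift_twist_tensor [simp]:
  assumes [simp]: "hom_space K V" "hom_space K W" "module K U" and t [simp]: "t \<in> carrier (V \<boxtimes>\<^bsub>K\<^esub> W)"
    and f: "bilinear_map K V W U f"
  shows "tensor_lift K V W U f (twist (V \<boxtimes>\<^bsub>K\<^esub> W) t) = tensor_lift K V W U (\<lambda>v w. f (twist V v) (twist W w)) t"
    and "tensor_lift K V W U f (twist_inv (V \<boxtimes>\<^bsub>K\<^esub> W) t) = tensor_lift K V W U (\<lambda>v w. f (twist_inv V v) (twist_inv W w)) t"
proof -
  note [simp] = linear_map_comp[OF bilinear_mapD1[OF f]] linear_map_comp[OF bilinear_mapD2[OF f]]
  show "tensor_lift K V W U f (twist (V \<boxtimes>\<^bsub>K\<^esub> W) t) = tensor_lift K V W U (\<lambda>v w. f (twist V v) (twist W w)) t"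
    by (rule linear_map_eq_on_tensor[where U = U, OF _ _ _ _ _ _ t]) simp_all
  show "tensor_lift K V W U f (twist_inv (V \<boxtimes>\<^bsub>K\<^esub> W) t) = tensor_lift K V W U (\<lambda>v w. f (twist_inv V v) (twist_inv W w)) t"
    by (rule linear_map_eq_on_tensor[where U = U, OF _ _ _ _ _ _ t]) simp_all
qed

declare tensor_lift_pure_ident [simp]

lemma linear_map_eq_on_tensor3:
  assumes [simp]: "module K V" "module K W" "module K X" "module K U"
    and F: "linear_map K ((V \<boxtimes>\<^bsub>K\<^esub> W) \<boxtimes>\<^bsub>K\<^esub> X) U F" and G: "linear_map K ((V \<boxtimes>\<^bsub>K\<^esub> W) \<boxtimes>\<^bsub>K\<^esub> X) U G"
    and eq: "\<And>v w x. v \<in> carrier V \<Longrightarrow> w \<in> carrier W \<Longrightarrow> x \<in> carrier X \<Longrightarrow>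
      F (pure_tensor K (V \<boxtimes>\<^bsub>K\<^esub> W) X (pure_tensor K V W v w) x) =
      G (pure_tensor K (V \<boxtimes>\<^bsub>K\<^esub> W) X (pure_tensor K V W v w) x)"
    and t: "t \<in> carrier ((V \<boxtimes>\<^bsub>K\<^esub> W) \<boxtimes>\<^bsub>K\<^esub> X)"
  shows "F t = G t"
proof (rule linear_map_eq_on_tensor[OF _ _ _ F G _ t])
  fix s x assume s: "s \<in> carrier (V \<boxtimes>\<^bsub>K\<^esub> W)" and x: "x \<in> carrier X"
  show "F (pure_tensor K (V \<boxtimes>\<^bsub>K\<^esub> W) X s x) = G (pure_tensor K (V \<boxtimes>\<^bsub>K\<^esub> W) X s x)"
    by (rule linear_map_eq_on_tensor[where U = U, OF _ _ _ linear_map_comp[OF F] linear_map_comp[OF G] _ s])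
      (simp_all add: x eq)
qed simp_all

end

context monoidal_datum
begin

lemma dh_unit_space:
  obtains E where "dh_unit K A C = hom_space.extend (unit_space K) E"
  by (simp add: dh_unit_def)

lemma dh_unit_simps [simp]:
  "carrier (dh_unit K A C) = carrier (unit_space K)"
  "twist (dh_unit K A C) t = t"
  "t \<in> carrier (unit_space K) \<Longrightarrow> twist_inv (dh_unit K A C) t = t"
  "smult (dh_unit K A C) = smult (unit_space K)"
  "dh_unit K A C \<boxtimes>\<^bsub>K\<^esub> W = unit_space K \<boxtimes>\<^bsub>K\<^esub> W"
  "W \<boxtimes>\<^bsub>K\<^esub> dh_unit K A C = W \<boxtimes>\<^bsub>K\<^esub> unit_space K"
  "pure_tensor K (dh_unit K A C) W = pure_tensor K (unit_space K) W"
  "pure_tensor K W (dh_unit K A C) = pure_tensor K W (unit_space K)"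
  "linear_map K (dh_unit K A C) W = linear_map K (unit_space K) W"
  "linear_map K W (dh_unit K A C) = linear_map K W (unit_space K)"
  "module K (dh_unit K A C)"
  "hom_space K (dh_unit K A C)"
  "sweedler (dh_unit K A C) = sweedler (unit_space K)"
  "reassoc K (dh_unit K A C) W W' = reassoc K (unit_space K) W W'"
  "tensor_map K (dh_unit K A C) W = tensor_map K (unit_space K) W"
  "tensor_map K W (dh_unit K A C) = tensor_map K W (unit_space K)"
  "tensor_lift K (dh_unit K A C) W U = tensor_lift K (unit_space K) W U"
  "tensor_lift K W (dh_unit K A C) U = tensor_lift K W (unit_space K) U"
  "tensor_lift K W W' (dh_unit K A C) = tensor_lift K W W' (unit_space K)"
  by (rule dh_unit_space; simp)+

lemma dh_unit_act [simp]: "act (dh_unit K A C) a t = counit A a \<odot>\<^bsub>unit_space K\<^esub> t"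
  and dh_unit_coact [simp]: "coact (dh_unit K A C) t = pure_tensor K (unit_space K) C t \<one>\<^bsub>C\<^esub>"
  by (simp_all add: dh_unit_def hom_space.defs dh_module.defs)

lemma datum_counit:
  assumes "a \<in> carrier A"
  shows "tensor_lift K A H C (\<lambda>a\<^sub>0 a\<^sub>1. counit A a\<^sub>0 \<odot>\<^bsub>C\<^esub> hact C a\<^sub>1 \<one>\<^bsub>C\<^esub>) (hcoact A a) = counit A a \<odot>\<^bsub>C\<^esub> \<one>\<^bsub>C\<^esub>"
proof -
  have "counit A a \<odot>\<^bsub>C\<^esub> \<one>\<^bsub>C\<^esub> = sweedler C (\<lambda>a\<^sub>0 a\<^sub>1. counit A a\<^sub>0 \<odot>\<^bsub>C\<^esub> hact C a\<^sub>1 \<one>\<^bsub>C\<^esub>) (hcoact A a)"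
    using datum assms by (simp only: monoidal_doi_hopf_datum_def Let_def)
  then show ?thesis using assms by simp
qed

text \<open>
  The compatibility of action and coaction says that
  \<open>\<lambda> \<otimes> \<epsilon>(a) 1 = \<epsilon>(a\<^sub>0) \<lambda> \<otimes> a\<^sub>1 \<cdot> 1\<close>, which is the second axiom of a monoidal datum.
\<close>

lemma doi_hopf_module_unit: "dh (dh_unit K A C)"
proof -
  let ?I = "dh_unit K A C" and ?k = "unit_space K :: ('k, ('k, 'b) vec) hom_space"
  have coact: "coact ?I = (\<lambda>t. pure_tensor K ?k C t \<one>\<^bsub>C\<^esub>)"
    by (simp add: fun_eq_iff)
  have "left_hom_module K A ?I (act ?I)"
    unfolding left_hom_module_def
    by (auto simp del: unit_space_simps(3) simp: bilinear_map_def simp flip: smult_smult)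
  moreover have "right_hom_comodule K C ?I (coact ?I)"
    unfolding right_hom_comodule_def coact
    by (auto simp: sweedler_eq_tensor_lift[of _ ?k K C] tensor_map_eq_lift[of K ?k C]
       reassoc_eq_lift simp del: unit_space_simps(3))
  moreover have "coact ?I (act ?I a t) = sweedler (?I \<boxtimes>\<^bsub>K\<^esub> C) (\<lambda>a\<^sub>0 a\<^sub>1. sweedler (?I \<boxtimes>\<^bsub>K\<^esub> C) (\<lambda>m\<^sub>0 m\<^sub>1.
        pure_tensor K ?I C (act ?I a\<^sub>0 m\<^sub>0) (hact C a\<^sub>1 m\<^sub>1)) (coact ?I t)) (hcoact A a)"
    if [simp]: "a \<in> carrier A" "t \<in> carrier ?k" for a t
  proof -
    have "coact ?I (act ?I a t) = pure_tensor K ?k C t (counit A a \<odot>\<^bsub>C\<^esub> \<one>\<^bsub>C\<^esub>)"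
      by (simp del: unit_space_simps(3))
    also have "\<dots> = tensor_lift K A H (?k \<boxtimes>\<^bsub>K\<^esub> C) (\<lambda>a\<^sub>0 a\<^sub>1.
        counit A a\<^sub>0 \<odot>\<^bsub>?k \<boxtimes>\<^bsub>K\<^esub> C\<^esub> pure_tensor K ?k C t (hact C a\<^sub>1 \<one>\<^bsub>C\<^esub>)) (hcoact A a)"
      by (simp flip: datum_counit del: unit_space_simps(3))
    also have "\<dots> = tensor_lift K A H (?k \<boxtimes>\<^bsub>K\<^esub> C) (\<lambda>a\<^sub>0 a\<^sub>1. tensor_lift K ?k C (?k \<boxtimes>\<^bsub>K\<^esub> C) (\<lambda>m\<^sub>0 m\<^sub>1.
        pure_tensor K ?k C (act ?I a\<^sub>0 m\<^sub>0) (hact C a\<^sub>1 m\<^sub>1)) (coact ?I t)) (hcoact A a)"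
      by (simp del: unit_space_simps(3))
    finally show ?thesis
      by (simp add: sweedler_eq_tensor_lift[of _ ?k K C] del: unit_space_simps(3))
  qed
  ultimately show ?thesis
    unfolding doi_hopf_module_def by simp
qed

declare doi_hopf_module_tensor [simp] doi_hopf_module_unit [simp]

section \<open>Morphisms\<close>

lemma coact_twist_lift [simp]:
  assumes [simp]: "dh M" "m \<in> carrier M"
  shows "coact M (twist M m) = tensor_lift K M C (M \<boxtimes>\<^bsub>K\<^esub> C) (\<lambda>x y. pure_tensor K M C (twist M x) (twist C y)) (coact M m)"
    and "coact M (twist_inv M m) = tensor_lift K M C (M \<boxtimes>\<^bsub>K\<^esub> C) (\<lambda>x y. pure_tensor K M C (twist_inv M x) (twist_inv C y)) (coact M m)"
  using coact_twist[of "M \<boxtimes>\<^bsub>K\<^esub> C" M m "pure_tensor K M C"] by simp_all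

lemma act_smult [simp]:
  assumes "dh M" "a \<in> carrier A" "m \<in> carrier M" "c \<in> carrier K"
  shows "act M a (c \<odot>\<^bsub>M\<^esub> m) = c \<odot>\<^bsub>M\<^esub> act M a m"
    and "act M (c \<odot>\<^bsub>A\<^esub> a) m = c \<odot>\<^bsub>M\<^esub> act M a m"
  using linear_map_smult[OF bilinear_mapD1[OF bilinear_act]] linear_map_smult[OF bilinear_mapD2[OF bilinear_act]] assms
  by auto

lemma coact_smult [simp]:
  assumes "dh M" "m \<in> carrier M" "c \<in> carrier K"
  shows "coact M (c \<odot>\<^bsub>M\<^esub> m) = c \<odot>\<^bsub>M \<boxtimes>\<^bsub>K\<^esub> C\<^esub> coact M m"
  using linear_map_smult[OF comodule_linear[OF dh_comodule]] assms by auto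

lemma dh_homI:
  assumes "dh M" "dh N" and F: "linear_map K M N F"
    and "\<And>m. m \<in> carrier M \<Longrightarrow> F (twist M m) = twist N (F m)"
    and "\<And>a m. a \<in> carrier A \<Longrightarrow> m \<in> carrier M \<Longrightarrow> F (act M a m) = act N a (F m)"
    and "\<And>m. m \<in> carrier M \<Longrightarrow>
      coact N (F m) = tensor_lift K M C (N \<boxtimes>\<^bsub>K\<^esub> C) (\<lambda>x y. pure_tensor K N C (F x) y) (coact M m)"
  shows "restrict F (carrier M) \<in> dh_hom K A C M N"
proof -
  have "linear_map K M N (restrict F (carrier M))"
    by (rule linear_map_eqI[OF F]) (use assms(1) in auto)
  then show ?thesis
    using assms by (simp add: dh_hom_def tensor_map_eq_lift[of K M C])
qed

lemma dh_hom_facts: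
  assumes f: "f \<in> dh_hom K A C M N" and M [simp]: "dh M" and N [simp]: "dh N"
  shows dh_hom_linear: "linear_map K M N f"
    and dh_hom_comp: "linear_map K X M g \<Longrightarrow> linear_map K X N (\<lambda>x. f (g x))"
    and dh_hom_closed: "m \<in> carrier M \<Longrightarrow> f m \<in> carrier N"
    and dh_hom_tensor_lift: "(\<And>x y. x \<in> carrier V \<Longrightarrow> y \<in> carrier W \<Longrightarrow> h x y \<in> carrier M) \<Longrightarrow>
      f (tensor_lift K V W M h t) = tensor_lift K V W N (\<lambda>x y. f (h x y)) t"
    and dh_hom_twist: "m \<in> carrier M \<Longrightarrow> f (twist M m) = twist N (f m)"
    and dh_hom_twist_inv: "m \<in> carrier M \<Longrightarrow> f (twist_inv M m) = twist_inv N (f m)"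
    and dh_hom_act: "a \<in> carrier A \<Longrightarrow> m \<in> carrier M \<Longrightarrow> f (act M a m) = act N a (f m)"
    and dh_hom_coact: "m \<in> carrier M \<Longrightarrow>
      coact N (f m) = tensor_lift K M C (N \<boxtimes>\<^bsub>K\<^esub> C) (\<lambda>x y. pure_tensor K N C (f x) y) (coact M m)"
    and dh_hom_smult: "c \<in> carrier K \<Longrightarrow> m \<in> carrier M \<Longrightarrow> f (c \<odot>\<^bsub>M\<^esub> m) = c \<odot>\<^bsub>N\<^esub> f m"
    and dh_hom_extensional: "f \<in> extensional (carrier M)"
proof -
  show lin: "linear_map K M N f" and ext: "f \<in> extensional (carrier M)"
    using f by (simp_all add: dh_hom_def)
  show cl: "f m \<in> carrier N" if "m \<in> carrier M" for m
    using linear_map_closed[OF lin that] .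
  show tw: "f (twist M m) = twist N (f m)" if "m \<in> carrier M" for m
    using f that by (simp add: dh_hom_def)
  show "f (twist_inv M m) = twist_inv N (f m)" if "m \<in> carrier M" for m
    using twist_inv_twist[of N "f (twist_inv M m)"] tw[of "twist_inv M m"] that cl by simp
  show "f (act M a m) = act N a (f m)" if "a \<in> carrier A" "m \<in> carrier M" for a m
    using f that by (simp add: dh_hom_def)
  show "coact N (f m) = tensor_lift K M C (N \<boxtimes>\<^bsub>K\<^esub> C) (\<lambda>x y. pure_tensor K N C (f x) y) (coact M m)"
    if "m \<in> carrier M" for m
    using f that by (simp add: dh_hom_def tensor_map_eq_lift[of K M C])
  show "f (tensor_lift K V W M h t) = tensor_lift K V W N (\<lambda>x y. f (h x y)) t"
    if "\<And>x y. x \<in> carrier V \<Longrightarrow> y \<in> carrier W \<Longrightarrow> h x y \<in> carrier M"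
    by (rule linear_tensor_lift[OF _ _ lin that]) simp_all
  show "f (c \<odot>\<^bsub>M\<^esub> m) = c \<odot>\<^bsub>N\<^esub> f m" if "c \<in> carrier K" "m \<in> carrier M"
    by (rule linear_map_smult[OF lin that])
  show "linear_map K X N (\<lambda>x. f (g x))" if "linear_map K X M g"
    by (rule linear_map_comp[OF lin that])
qed

lemmas dh_hom_rules = dh_hom_comp dh_hom_closed dh_hom_tensor_lift dh_hom_twist dh_hom_twist_inv
  dh_hom_act dh_hom_coact dh_hom_smult

text \<open>
  Colinearity of the inverse: the colinearity of \<open>f\<close> at \<open>g(n)\<close> expresses \<open>\<rho>(n)\<close> as the image of
  \<open>\<rho>(g(n))\<close> under \<open>f \<otimes> id\<close>, and \<open>g \<otimes> id\<close> undoes this.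
\<close>

lemma dh_hom_inverse:
  assumes f: "f \<in> dh_hom K A C M N" and M [simp]: "dh M" and N [simp]: "dh N"
    and g: "linear_map K N M g"
    and gf [simp]: "\<And>m. m \<in> carrier M \<Longrightarrow> g (f m) = m" and fg [simp]: "\<And>n. n \<in> carrier N \<Longrightarrow> f (g n) = n"
  shows "restrict g (carrier N) \<in> dh_hom K A C N M"
proof (rule dh_homI[OF N M g])
  note [simp] = dh_hom_rules[OF f M N] linear_map_closed[OF g] linear_map_comp[OF g]
  fix n assume [simp]: "n \<in> carrier N"
  have "g (twist N (f (g n))) = twist M (g n)"
    by (simp add: dh_hom_twist[OF f M N, symmetric] del: dh_hom_twist[OF f M N] fg)
  then show "g (twist N n) = twist M (g n)" by simp
  have "g (act N a (f (g n))) = act M a (g n)" if "a \<in> carrier A" for a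
    using that by (simp add: dh_hom_act[OF f M N, symmetric] del: dh_hom_act[OF f M N] fg)
  then show "g (act N a n) = act M a (g n)" if "a \<in> carrier A" for a
    using that by simp
  have "tensor_lift K N C (M \<boxtimes>\<^bsub>K\<^esub> C) (\<lambda>x y. pure_tensor K M C (g x) y) (coact N (f (g n))) = coact M (g n)"
    by (simp del: fg)
  then show "coact M (g n) = tensor_lift K N C (M \<boxtimes>\<^bsub>K\<^esub> C) (\<lambda>x y. pure_tensor K M C (g x) y) (coact N n)"
    by simp
qed

section \<open>Tensor products of morphisms\<close>

lemma tensor_hom:
  assumes f: "f \<in> dh_hom K A C M M'" and g: "g \<in> dh_hom K A C N N'"
    and [simp]: "dh M" "dh M'" "dh N" "dh N'"
  shows "restrict (tensor_lift K M N (M' \<boxtimes>\<^bsub>K\<^esub> N') (\<lambda>m n. pure_tensor K M' N' (f m) (g n))) (carrier (M \<boxtimes>\<^bsub>K\<^esub> N))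
    \<in> dh_hom K A C (dh_tensor K A C M N) (dh_tensor K A C M' N')"
proof -
  let ?F = "tensor_lift K M N (M' \<boxtimes>\<^bsub>K\<^esub> N') (\<lambda>m n. pure_tensor K M' N' (f m) (g n))"
  let ?T = "dh_tensor K A C M N" and ?T' = "dh_tensor K A C M' N'"
  note [simp] = dh_hom_rules[OF f] dh_hom_rules[OF g]
  have "restrict ?F (carrier ?T) \<in> dh_hom K A C ?T ?T'"
  proof (rule dh_homI, goal_cases)
    case (4 t)
    then have t: "t \<in> carrier (M \<boxtimes>\<^bsub>K\<^esub> N)" by simp
    show ?case
      by (rule linear_map_eq_on_tensor[where U = "M' \<boxtimes>\<^bsub>K\<^esub> N'", OF _ _ _ _ _ _ t]) simp_all
  next
    case (5 a t)
    then have t: "t \<in> carrier (M \<boxtimes>\<^bsub>K\<^esub> N)" by simp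
    show ?case
      by (rule linear_map_eq_on_tensor[where U = "M' \<boxtimes>\<^bsub>K\<^esub> N'", OF _ _ _ _ _ _ t]) (simp_all add: 5)
  next
    case (6 t)
    then have t: "t \<in> carrier (M \<boxtimes>\<^bsub>K\<^esub> N)" by simp
    show ?case
      by (rule linear_map_eq_on_tensor[where U = "(M' \<boxtimes>\<^bsub>K\<^esub> N') \<boxtimes>\<^bsub>K\<^esub> C", OF _ _ _ _ _ _ t]) simp_all
  qed simp_all
  then show ?thesis by simp
qed

section \<open>The constraints\<close>

lemma comult_coassoc_A:
  assumes "module K U"
    and "\<And>y z. y \<in> carrier A \<Longrightarrow> z \<in> carrier A \<Longrightarrow> linear_map K A U (\<lambda>x. f x y z)"
      "\<And>x z. x \<in> carrier A \<Longrightarrow> z \<in> carrier A \<Longrightarrow> linear_map K A U (\<lambda>y. f x y z)"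
      "\<And>x y. x \<in> carrier A \<Longrightarrow> y \<in> carrier A \<Longrightarrow> linear_map K A U (\<lambda>z. f x y z)"
    and "a \<in> carrier A"
  shows "tensor_lift K A A U (\<lambda>a\<^sub>1 a\<^sub>2. tensor_lift K A A U (\<lambda>x y. f x y (twist A a\<^sub>2)) (comult A a\<^sub>1)) (comult A a) =
    tensor_lift K A A U (\<lambda>a\<^sub>1 a\<^sub>2. tensor_lift K A A U (\<lambda>x y. f (twist A a\<^sub>1) x y) (comult A a\<^sub>2)) (comult A a)"
  using assms
  by (intro comodule_coassoc[OF coalgebra_comodule[OF coalgebras(1)] hom_spaces(2) bialgebra_comult[OF bialgebras(2)]])

text \<open>
  Linearity: on \<open>(m \<otimes> n) \<otimes> p\<close> the two sides are the values of one trilinear expression at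
  \<open>a\<^sub>1\<^sub>1 \<otimes> a\<^sub>1\<^sub>2 \<otimes> \<alpha>(a\<^sub>2)\<close> and at \<open>\<alpha>(a\<^sub>1) \<otimes> a\<^sub>2\<^sub>1 \<otimes> a\<^sub>2\<^sub>2\<close>: the \<open>\<alpha>\<^sup>-\<^sup>1\<close> on \<open>m\<close> and the \<open>\<alpha>\<close> on \<open>p\<close> in the
  constraint supply the structure maps in the coassociativity of \<open>A\<close>. Colinearity is the
  Hom-associativity of \<open>C\<close> applied to \<open>m\<^sub>1\<close>, \<open>n\<^sub>1\<close>, \<open>p\<^sub>1\<close>, up to powers of \<open>\<alpha>\<close>.
\<close>

lemma assoc_hom:
  assumes [simp]: "dh M" "dh N" "dh P"
  shows "restrict (tensor_lift K (M \<boxtimes>\<^bsub>K\<^esub> N) P (M \<boxtimes>\<^bsub>K\<^esub> (N \<boxtimes>\<^bsub>K\<^esub> P)) (\<lambda>t p. tensor_lift K M N (M \<boxtimes>\<^bsub>K\<^esub> (N \<boxtimes>\<^bsub>K\<^esub> P)) (\<lambda>m n.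
      pure_tensor K M (N \<boxtimes>\<^bsub>K\<^esub> P) (twist_inv M m) (pure_tensor K N P n (twist P p))) t)) (carrier ((M \<boxtimes>\<^bsub>K\<^esub> N) \<boxtimes>\<^bsub>K\<^esub> P))
    \<in> dh_hom K A C (dh_tensor K A C (dh_tensor K A C M N) P) (dh_tensor K A C M (dh_tensor K A C N P))"
proof -
  let ?S = "dh_tensor K A C (dh_tensor K A C M N) P" and ?T = "dh_tensor K A C M (dh_tensor K A C N P)"
  let ?U = "M \<boxtimes>\<^bsub>K\<^esub> (N \<boxtimes>\<^bsub>K\<^esub> P)"
  let ?F = "tensor_lift K (M \<boxtimes>\<^bsub>K\<^esub> N) P ?U (\<lambda>t p. tensor_lift K M N ?U (\<lambda>m n.
      pure_tensor K M (N \<boxtimes>\<^bsub>K\<^esub> P) (twist_inv M m) (pure_tensor K N P n (twist P p))) t)"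
  have "restrict ?F (carrier ?S) \<in> dh_hom K A C ?S ?T"
  proof (rule dh_homI, goal_cases)
    case (4 t)
    then have t: "t \<in> carrier ((M \<boxtimes>\<^bsub>K\<^esub> N) \<boxtimes>\<^bsub>K\<^esub> P)" by simp
    show ?case
      by (rule linear_map_eq_on_tensor3[where U = "?U", OF _ _ _ _ _ _ _ t]) simp_all
  next
    case (5 a t)
    then have [simp]: "a \<in> carrier A" and t: "t \<in> carrier ((M \<boxtimes>\<^bsub>K\<^esub> N) \<boxtimes>\<^bsub>K\<^esub> P)" by simp_all
    show ?case
    proof (rule linear_map_eq_on_tensor3[where U = "?U", OF _ _ _ _ _ _ _ t], goal_cases)
      case (7 m n p)
      note [simp] = this
      have "?F (act ?S a (pure_tensor K (M \<boxtimes>\<^bsub>K\<^esub> N) P (pure_tensor K M N m n) p)) =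
          tensor_lift K A A ?U (\<lambda>a\<^sub>1 a\<^sub>2. tensor_lift K A A ?U (\<lambda>x y.
            pure_tensor K M (N \<boxtimes>\<^bsub>K\<^esub> P) (act M (twist_inv A x) (twist_inv M m))
              (pure_tensor K N P (act N y n) (act P (twist A a\<^sub>2) (twist P p)))) (comult A a\<^sub>1)) (comult A a)"
        by simp
      also have "\<dots> = tensor_lift K A A ?U (\<lambda>a\<^sub>1 a\<^sub>2. tensor_lift K A A ?U (\<lambda>x y.
            pure_tensor K M (N \<boxtimes>\<^bsub>K\<^esub> P) (act M (twist_inv A (twist A a\<^sub>1)) (twist_inv M m))
              (pure_tensor K N P (act N x n) (act P y (twist P p)))) (comult A a\<^sub>2)) (comult A a)"
        by (rule comult_coassoc_A) simp_all
      also have "\<dots> = act ?T a (?F (pure_tensor K (M \<boxtimes>\<^bsub>K\<^esub> N) P (pure_tensor K M N m n) p))"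
        by simp
      finally show ?case .
    qed simp_all
  next
    case (6 t)
    then have t: "t \<in> carrier ((M \<boxtimes>\<^bsub>K\<^esub> N) \<boxtimes>\<^bsub>K\<^esub> P)" by simp
    \<comment> \<open>Hom-associativity, oriented so that products nest to the left; the powers of \<open>\<alpha>\<close> then agree.\<close>
    have assoc: "c \<otimes>\<^bsub>C\<^esub> (d \<otimes>\<^bsub>C\<^esub> e) = (twist_inv C c \<otimes>\<^bsub>C\<^esub> d) \<otimes>\<^bsub>C\<^esub> twist C e"
      if "c \<in> carrier C" "d \<in> carrier C" "e \<in> carrier C" for c d e
      using mult_assoc_C[of "twist_inv C c" d e] that by simp
    show ?case
      by (rule linear_map_eq_on_tensor3[where U = "?U \<boxtimes>\<^bsub>K\<^esub> C", OF _ _ _ _ _ _ _ t]) (simp_all add: assoc)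
  qed simp_all
  then show ?thesis by simp
qed

text \<open>
  Linearity is the counit law \<open>\<epsilon>(a\<^sub>1) a\<^sub>2 = \<alpha>(a)\<close>, whose \<open>\<alpha>\<close> cancels the \<open>\<alpha>\<^sup>-\<^sup>1\<close> of the constraint;
  colinearity is \<open>\<alpha>\<^sup>-\<^sup>2(1 c) = \<alpha>\<^sup>-\<^sup>1(c)\<close>.
\<close>

lemma lunit_hom:
  assumes [simp]: "dh M"
  shows "restrict (tensor_lift K (unit_space K) M M (\<lambda>l m. scal l \<odot>\<^bsub>M\<^esub> twist_inv M m)) (carrier (unit_space K \<boxtimes>\<^bsub>K\<^esub> M))
    \<in> dh_hom K A C (dh_tensor K A C (dh_unit K A C) M) M"
proof -
  let ?k = "unit_space K :: ('k, ('k, 'b) vec) hom_space"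
  let ?S = "dh_tensor K A C (dh_unit K A C) M"
  let ?F = "tensor_lift K ?k M M (\<lambda>l m. scal l \<odot>\<^bsub>M\<^esub> twist_inv M m)"
  have "restrict ?F (carrier ?S) \<in> dh_hom K A C ?S M"
  proof (rule dh_homI, goal_cases)
    case (4 t)
    then have t: "t \<in> carrier (?k \<boxtimes>\<^bsub>K\<^esub> M)" by simp
    show ?case
      by (rule linear_map_eq_on_tensor[where U = M, OF _ _ _ _ _ _ t]) simp_all
  next
    case (5 a t)
    then have [simp]: "a \<in> carrier A" and t: "t \<in> carrier (?k \<boxtimes>\<^bsub>K\<^esub> M)" by simp_all
    show ?case
    proof (rule linear_map_eq_on_tensor[where U = M, OF _ _ _ _ _ _ t], goal_cases)
      case (6 l m)
      note [simp] = this
      have "?F (act ?S a (pure_tensor K ?k M l m)) =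
          tensor_lift K A A M (\<lambda>a\<^sub>1 a\<^sub>2. counit A a\<^sub>1 \<odot>\<^bsub>M\<^esub> (scal l \<odot>\<^bsub>M\<^esub> act M (twist_inv A a\<^sub>2) (twist_inv M m))) (comult A a)"
        by simp
      also have "\<dots> = scal l \<odot>\<^bsub>M\<^esub> act M (twist_inv A (twist A a)) (twist_inv M m)"
        by (rule coalgebra_counit_left[OF coalgebras(1)]) simp_all
      finally show ?case by simp
    qed simp_all
  next
    case (6 t)
    then have t: "t \<in> carrier (?k \<boxtimes>\<^bsub>K\<^esub> M)" by simp
    show ?case
      by (rule linear_map_eq_on_tensor[where U = "M \<boxtimes>\<^bsub>K\<^esub> C", OF _ _ _ _ _ _ t]) simp_all
  qed simp_all
  then show ?thesis by simp
qed

lemma runit_hom: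
  assumes [simp]: "dh M"
  shows "restrict (tensor_lift K M (unit_space K) M (\<lambda>m l. scal l \<odot>\<^bsub>M\<^esub> twist_inv M m)) (carrier (M \<boxtimes>\<^bsub>K\<^esub> unit_space K))
    \<in> dh_hom K A C (dh_tensor K A C M (dh_unit K A C)) M"
proof -
  let ?k = "unit_space K :: ('k, ('k, 'b) vec) hom_space"
  let ?S = "dh_tensor K A C M (dh_unit K A C)"
  let ?F = "tensor_lift K M ?k M (\<lambda>m l. scal l \<odot>\<^bsub>M\<^esub> twist_inv M m)"
  have "restrict ?F (carrier ?S) \<in> dh_hom K A C ?S M"
  proof (rule dh_homI, goal_cases)
    case (4 t)
    then have t: "t \<in> carrier (M \<boxtimes>\<^bsub>K\<^esub> ?k)" by simp
    show ?case
      by (rule linear_map_eq_on_tensor[where U = M, OF _ _ _ _ _ _ t]) simp_all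
  next
    case (5 a t)
    then have [simp]: "a \<in> carrier A" and t: "t \<in> carrier (M \<boxtimes>\<^bsub>K\<^esub> ?k)" by simp_all
    show ?case
    proof (rule linear_map_eq_on_tensor[where U = M, OF _ _ _ _ _ _ t], goal_cases)
      case (6 m l)
      note [simp] = this
      have "?F (act ?S a (pure_tensor K M ?k m l)) =
          tensor_lift K A A M (\<lambda>a\<^sub>1 a\<^sub>2. counit A a\<^sub>2 \<odot>\<^bsub>M\<^esub> (scal l \<odot>\<^bsub>M\<^esub> act M (twist_inv A a\<^sub>1) (twist_inv M m))) (comult A a)"
        by simp
      also have "\<dots> = scal l \<odot>\<^bsub>M\<^esub> act M (twist_inv A (twist A a)) (twist_inv M m)"
        by (rule comodule_counit[OF coalgebra_comodule[OF coalgebras(1)] hom_spaces(2) bialgebra_counit[OF bialgebras(2)]])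
          simp_all
      finally show ?case by simp
    qed simp_all
  next
    case (6 t)
    then have t: "t \<in> carrier (M \<boxtimes>\<^bsub>K\<^esub> ?k)" by simp
    show ?case
      by (rule linear_map_eq_on_tensor[where U = "M \<boxtimes>\<^bsub>K\<^esub> C", OF _ _ _ _ _ _ t]) simp_all
  qed simp_all
  then show ?thesis by simp
qed

section \<open>The monoidal category\<close>

abbreviation cat where "cat \<equiv> dh_category K A C"

lemma dh_category_simps [simp]:
  "Obj cat = {M. dh M}" "Hom cat = dh_hom K A C" "Ident cat M = restrict (\<lambda>m. m) (carrier M)"
  "Comp cat L M N g f = compose (carrier L) g f" "TObj cat = dh_tensor K A C" "UnitObj cat = dh_unit K A C"
  by (simp_all add: dh_category_def)

lemma TArr_eq [simp]:
  assumes "dh M" "dh N"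
  shows "TArr cat M M' N N' f g =
    restrict (tensor_lift K M N (M' \<boxtimes>\<^bsub>K\<^esub> N') (\<lambda>m n. pure_tensor K M' N' (f m) (g n))) (carrier (M \<boxtimes>\<^bsub>K\<^esub> N))"
  using assms by (auto simp: dh_category_def tensor_map_eq_lift[of K M N] intro!: restrict_ext)

lemma Assoc_eq [simp]:
  assumes [simp]: "dh M" "dh N" "dh P"
  shows "Assoc cat M N P = restrict (tensor_lift K (M \<boxtimes>\<^bsub>K\<^esub> N) P (M \<boxtimes>\<^bsub>K\<^esub> (N \<boxtimes>\<^bsub>K\<^esub> P)) (\<lambda>t p.
      tensor_lift K M N (M \<boxtimes>\<^bsub>K\<^esub> (N \<boxtimes>\<^bsub>K\<^esub> P)) (\<lambda>m n.
      pure_tensor K M (N \<boxtimes>\<^bsub>K\<^esub> P) (twist_inv M m) (pure_tensor K N P n (twist P p))) t)) (carrier ((M \<boxtimes>\<^bsub>K\<^esub> N) \<boxtimes>\<^bsub>K\<^esub> P))"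
proof -
  have "sweedler (M \<boxtimes>\<^bsub>K\<^esub> (N \<boxtimes>\<^bsub>K\<^esub> P)) (\<lambda>t p. sweedler (M \<boxtimes>\<^bsub>K\<^esub> (N \<boxtimes>\<^bsub>K\<^esub> P)) (\<lambda>m n.
      pure_tensor K M (N \<boxtimes>\<^bsub>K\<^esub> P) (twist_inv M m) (pure_tensor K N P n (twist P p))) t) s =
    tensor_lift K (M \<boxtimes>\<^bsub>K\<^esub> N) P (M \<boxtimes>\<^bsub>K\<^esub> (N \<boxtimes>\<^bsub>K\<^esub> P)) (\<lambda>t p. tensor_lift K M N (M \<boxtimes>\<^bsub>K\<^esub> (N \<boxtimes>\<^bsub>K\<^esub> P)) (\<lambda>m n.
      pure_tensor K M (N \<boxtimes>\<^bsub>K\<^esub> P) (twist_inv M m) (pure_tensor K N P n (twist P p))) t) s"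
    if "s \<in> carrier ((M \<boxtimes>\<^bsub>K\<^esub> N) \<boxtimes>\<^bsub>K\<^esub> P)" for s
    by (simp add: sweedler_eq_tensor_lift[OF that] sweedler_eq_tensor_lift[of _ M K N])
  then show ?thesis
    by (auto simp: dh_category_def intro!: restrict_ext)
qed

lemma LUnit_eq [simp]:
  assumes [simp]: "dh M"
  shows "LUnit cat M = restrict (tensor_lift K (unit_space K) M M (\<lambda>l m. scal l \<odot>\<^bsub>M\<^esub> twist_inv M m))
    (carrier (unit_space K \<boxtimes>\<^bsub>K\<^esub> M))"
  by (auto simp: dh_category_def sweedler_eq_tensor_lift[of _ "unit_space K" K M] intro!: restrict_ext)

lemma RUnit_eq [simp]:
  assumes [simp]: "dh M"
  shows "RUnit cat M = restrict (tensor_lift K M (unit_space K) M (\<lambda>m l. scal l \<odot>\<^bsub>M\<^esub> twist_inv M m))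
    (carrier (M \<boxtimes>\<^bsub>K\<^esub> unit_space K))"
  by (auto simp: dh_category_def sweedler_eq_tensor_lift[of _ M K "unit_space K"] intro!: restrict_ext)

lemma ident_hom [simp]:
  assumes [simp]: "dh M"
  shows "restrict (\<lambda>m. m) (carrier M) \<in> dh_hom K A C M M"
  by (rule dh_homI) simp_all

lemma comp_hom:
  assumes f: "f \<in> dh_hom K A C L M" and g: "g \<in> dh_hom K A C M N" and [simp]: "dh L" "dh M" "dh N"
  shows "compose (carrier L) g f \<in> dh_hom K A C L N"
proof -
  note [simp] = dh_hom_rules[OF f] dh_hom_rules[OF g]
  show ?thesis
    unfolding compose_def by (rule dh_homI) (simp_all add: dh_hom_linear[OF g])
qed

lemma category_cat: "category cat"
  unfolding category_def
proof (intro conjI ballI, goal_cases)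
  case (2 X Y Z f g)
  then show ?case by (simp add: comp_hom)
next
  case (3 X Y f)
  then have "f \<in> extensional (carrier X)" by (simp add: dh_hom_extensional[of f X Y])
  then show ?case by (auto simp: compose_def extensional_def)
next
  case (4 X Y f)
  then have "f \<in> extensional (carrier X)" "\<And>x. x \<in> carrier X \<Longrightarrow> f x \<in> carrier Y"
    by (simp_all add: dh_hom_extensional[of f X Y] dh_hom_closed[of f X Y])
  then show ?case by (auto simp: compose_def extensional_def)
next
  case (5 W X Y Z f g h)
  then have "\<And>x. x \<in> carrier W \<Longrightarrow> f x \<in> carrier X"
    by (simp add: dh_hom_closed[of f W X])
  then show ?case by (auto simp: compose_def)
qed simp_all

lemma tensor_bifunctor_cat: "tensor_bifunctor cat"
  unfolding tensor_bifunctor_def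
proof (intro conjI ballI, goal_cases)
  case (2 X X' Y Y' f g)
  then show ?case by (simp add: tensor_hom)
next
  case (3 X Y)
  then show ?case by (auto intro!: restrict_ext)
next
  case (4 X X' X'' Y Y' Y'' f f' g g')
  then have [simp]: "dh X" "dh X'" "dh X''" "dh Y" "dh Y'" "dh Y''" and
    f: "f \<in> dh_hom K A C X X'" and f': "f' \<in> dh_hom K A C X' X''" and
    g: "g \<in> dh_hom K A C Y Y'" and g': "g' \<in> dh_hom K A C Y' Y''" by simp_all
  note [simp] = dh_hom_rules[OF f] dh_hom_rules[OF f'] dh_hom_rules[OF g] dh_hom_rules[OF g']
  show ?case by (auto simp: compose_def intro!: restrict_ext)
qed simp_all

lemma cat_isoI:
  assumes f: "f \<in> dh_hom K A C M N" and [simp]: "dh M" "dh N"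
    and g: "linear_map K N M g"
    and gf [simp]: "\<And>m. m \<in> carrier M \<Longrightarrow> g (f m) = m" and fg [simp]: "\<And>n. n \<in> carrier N \<Longrightarrow> f (g n) = n"
  shows "cat_iso cat M N f"
proof -
  have "restrict g (carrier N) \<in> dh_hom K A C N M"
    by (rule dh_hom_inverse[OF f _ _ g]) simp_all
  moreover have "compose (carrier M) (restrict g (carrier N)) f = restrict (\<lambda>m. m) (carrier M)"
    "compose (carrier N) f (restrict g (carrier N)) = restrict (\<lambda>m. m) (carrier N)"
    using dh_hom_closed[OF f] linear_map_closed[OF g]
    by (auto simp: compose_def intro!: restrict_ext)
  ultimately show ?thesis
    using f unfolding cat_iso_def by (auto intro!: bexI[of _ "restrict g (carrier N)"])
qed

text \<open>
  The inverse is \<open>m \<otimes> (n \<otimes> p) \<mapsto> (\<alpha>(m) \<otimes> n) \<otimes> \<alpha>\<^sup>-\<^sup>1(p)\<close>.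
\<close>

lemma assoc_iso:
  assumes [simp]: "dh M" "dh N" "dh P"
  shows "cat_iso cat (dh_tensor K A C (dh_tensor K A C M N) P) (dh_tensor K A C M (dh_tensor K A C N P)) (Assoc cat M N P)"
proof -
  let ?V = "(M \<boxtimes>\<^bsub>K\<^esub> N) \<boxtimes>\<^bsub>K\<^esub> P" and ?U = "M \<boxtimes>\<^bsub>K\<^esub> (N \<boxtimes>\<^bsub>K\<^esub> P)"
  define F where "F = tensor_lift K (M \<boxtimes>\<^bsub>K\<^esub> N) P ?U (\<lambda>t p. tensor_lift K M N ?U (\<lambda>m n.
      pure_tensor K M (N \<boxtimes>\<^bsub>K\<^esub> P) (twist_inv M m) (pure_tensor K N P n (twist P p))) t)"
  define G where "G = tensor_lift K M (N \<boxtimes>\<^bsub>K\<^esub> P) ?V (\<lambda>m s. tensor_lift K N P ?V (\<lambda>n p.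
      pure_tensor K (M \<boxtimes>\<^bsub>K\<^esub> N) P (pure_tensor K M N (twist M m) n) (twist_inv P p)) s)"
  have F: "linear_map K ?V ?U F" and G: "linear_map K ?U ?V G"
    unfolding F_def G_def by (rule linear_map_tensor_lift; simp)+
  have GF: "G (F t) = t" if t: "t \<in> carrier ?V" for t
    by (rule linear_map_eq_on_tensor3[where U = ?V, OF _ _ _ _ linear_map_comp[OF G F] linear_map_ident _ t])
      (simp_all add: F_def G_def)
  have FG: "F (G t) = t" if t: "t \<in> carrier ?U" for t
  proof (rule linear_map_eq_on_tensor[where U = ?U, OF _ _ _ linear_map_comp[OF F G] linear_map_ident _ t], goal_cases)
    case (4 m s)
    note [simp] = 4(1)
    show ?case
      by (rule linear_map_eq_on_tensor[where U = ?U, OF _ _ _ _ _ _ 4(2)]) (simp_all add: F_def G_def)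
  qed simp_all
  have "restrict F (carrier ?V) \<in> dh_hom K A C (dh_tensor K A C (dh_tensor K A C M N) P) (dh_tensor K A C M (dh_tensor K A C N P))"
    unfolding F_def by (rule assoc_hom) simp_all
  then have "cat_iso cat (dh_tensor K A C (dh_tensor K A C M N) P) (dh_tensor K A C M (dh_tensor K A C N P)) (restrict F (carrier ?V))"
    by (rule cat_isoI[where g = G]) (simp_all add: G GF FG linear_map_closed[OF G])
  then show ?thesis by (simp add: F_def)
qed

text \<open>
  The inverse is \<open>m \<mapsto> 1 \<otimes> \<alpha>(m)\<close>.
\<close>

lemma lunit_iso:
  assumes [simp]: "dh M"
  shows "cat_iso cat (dh_tensor K A C (dh_unit K A C) M) M (LUnit cat M)"
proof -
  let ?k = "unit_space K :: ('k, ('k, 'b) vec) hom_space"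
  define G where "G = (\<lambda>m. pure_tensor K ?k M (Scalar \<one>\<^bsub>K\<^esub>) (twist M m))"
  have GF: "G (tensor_lift K ?k M M (\<lambda>l m. scal l \<odot>\<^bsub>M\<^esub> twist_inv M m) t) = t"
    if t: "t \<in> carrier (?k \<boxtimes>\<^bsub>K\<^esub> M)" for t
  proof (rule linear_map_eq_on_tensor[where U = "?k \<boxtimes>\<^bsub>K\<^esub> M", OF _ _ _ _ _ _ t], goal_cases)
    case (6 l m)
    then have "G (tensor_lift K ?k M M (\<lambda>l m. scal l \<odot>\<^bsub>M\<^esub> twist_inv M m) (pure_tensor K ?k M l m)) =
        pure_tensor K ?k M (scal l \<odot>\<^bsub>?k\<^esub> Scalar \<one>\<^bsub>K\<^esub>) m"
      by (simp add: G_def del: unit_space_simps(3))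
    \<comment> \<open>The scalar moves across the tensor sign, and \<open>l 1 = l\<close>.\<close>
    with 6 show ?case by simp
  qed (simp_all add: G_def)
  show ?thesis
    unfolding LUnit_eq[OF assms]
    by (rule cat_isoI[OF lunit_hom, where g = G]) (simp_all add: GF, simp_all add: G_def)
qed

lemma runit_iso:
  assumes [simp]: "dh M"
  shows "cat_iso cat (dh_tensor K A C M (dh_unit K A C)) M (RUnit cat M)"
proof -
  let ?k = "unit_space K :: ('k, ('k, 'b) vec) hom_space"
  define G where "G = (\<lambda>m. pure_tensor K M ?k (twist M m) (Scalar \<one>\<^bsub>K\<^esub>))"
  have GF: "G (tensor_lift K M ?k M (\<lambda>m l. scal l \<odot>\<^bsub>M\<^esub> twist_inv M m) t) = t"
    if t: "t \<in> carrier (M \<boxtimes>\<^bsub>K\<^esub> ?k)" for t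
  proof (rule linear_map_eq_on_tensor[where U = "M \<boxtimes>\<^bsub>K\<^esub> ?k", OF _ _ _ _ _ _ t], goal_cases)
    case (6 m l)
    then have "G (tensor_lift K M ?k M (\<lambda>m l. scal l \<odot>\<^bsub>M\<^esub> twist_inv M m) (pure_tensor K M ?k m l)) =
        pure_tensor K M ?k m (scal l \<odot>\<^bsub>?k\<^esub> Scalar \<one>\<^bsub>K\<^esub>)"
      by (simp add: G_def del: unit_space_simps(3))
    with 6 show ?case by simp
  qed (simp_all add: G_def)
  show ?thesis
    unfolding RUnit_eq[OF assms]
    by (rule cat_isoI[OF runit_hom, where g = G]) (simp_all add: GF, simp_all add: G_def)
qed

text \<open>
  Morphisms commute with \<open>\<alpha>\<close> and hence with \<open>\<alpha>\<^sup>-\<^sup>1\<close>, which gives the naturality of all three constraints.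
\<close>

lemma constraints_natural_iso_cat: "constraints_natural_iso cat"
  unfolding constraints_natural_iso_def
proof (intro conjI ballI, goal_cases)
  case (1 X Y Z)
  then show ?case using assoc_iso by simp
next
  case (2 X)
  then show ?case using lunit_iso by simp
next
  case (3 X)
  then show ?case using runit_iso by simp
next
  case (4 X X' Y Y' Z Z' f g h)
  then have [simp]: "dh X" "dh X'" "dh Z" "dh Y" "dh Y'" "dh Z'" and
    f: "f \<in> dh_hom K A C X X'" and g: "g \<in> dh_hom K A C Y Y'" and h: "h \<in> dh_hom K A C Z Z'" by simp_all
  note [simp] = dh_hom_rules[OF f] dh_hom_rules[OF g] dh_hom_rules[OF h]
  show ?case by (auto simp: compose_def intro!: restrict_ext)
next
  case (5 X Y f)
  then have [simp]: "dh X" "dh Y" and f: "f \<in> dh_hom K A C X Y" by simp_all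
  note [simp] = dh_hom_rules[OF f]
  show ?case by (auto simp: compose_def intro!: restrict_ext)
next
  case (6 X Y f)
  then have [simp]: "dh X" "dh Y" and f: "f \<in> dh_hom K A C X Y" by simp_all
  note [simp] = dh_hom_rules[OF f]
  show ?case by (auto simp: compose_def intro!: restrict_ext)
qed

text \<open>
  Both sides send \<open>((w \<otimes> x) \<otimes> y) \<otimes> z\<close> to \<open>\<alpha>\<^sup>-\<^sup>2(w) \<otimes> (\<alpha>\<^sup>-\<^sup>1(x) \<otimes> (\<alpha>(y) \<otimes> \<alpha>\<^sup>2(z)))\<close>.
\<close>

lemma pentagon_cat: "pentagon cat"
  unfolding pentagon_def Let_def
proof (intro ballI, goal_cases)
  case (1 W X Y Z)
  then have [simp]: "dh W" "dh X" "dh Y" "dh Z" by simp_all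
  show ?case by (auto simp: compose_def intro!: restrict_ext)
qed

text \<open>
  Both sides send \<open>(m \<otimes> \<lambda>) \<otimes> n\<close> to \<open>\<lambda> \<alpha>\<^sup>-\<^sup>1(m) \<otimes> n\<close>: on the left-hand side the \<open>\<alpha>\<close> of the
  associativity constraint cancels the \<open>\<alpha>\<^sup>-\<^sup>1\<close> of the unit constraint.
\<close>

lemma triangle_cat: "triangle cat"
  unfolding triangle_def
proof (intro ballI, goal_cases)
  case (1 X Y)
  then have [simp]: "dh X" "dh Y" by simp_all
  show ?case by (auto simp: compose_def intro!: restrict_ext)
qed

lemma monoidal_category_cat: "monoidal_category cat"
  unfolding monoidal_category_def
  using category_cat tensor_bifunctor_cat constraints_natural_iso_cat pentagon_cat triangle_cat by simp

lemma truncate_dh_tensor: "hom_space.truncate (dh_tensor K A C M N) = M \<boxtimes>\<^bsub>K\<^esub> N"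
  by (simp add: dh_tensor_def Let_def hom_space.defs)

end

theorem proposition2p3:
  fixes K :: "('k, 'x) ring_scheme"
    and H :: "('k, ('k, 'b) vec, 'y) hom_hopf_scheme"
    and A :: "('k, ('k, 'b) vec, 'z) datum_alg_scheme"
    and C :: "('k, ('k, 'b) vec, 't) datum_coalg_scheme"
  assumes "field K"
    and "monoidal_doi_hopf_datum K H A C"
  shows "(\<forall>M N. doi_hopf_module K A C M \<longrightarrow> doi_hopf_module K A C N \<longrightarrow>
      (let MN = M \<boxtimes>\<^bsub>K\<^esub> N; MNC = MN \<boxtimes>\<^bsub>K\<^esub> C; T = dh_tensor K A C M N in
        doi_hopf_module K A C T \<and>
        hom_space.truncate T = MN \<and>
        (\<forall>m\<in>carrier M. \<forall>n\<in>carrier N.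
          twist T (pure_tensor K M N m n) = pure_tensor K M N (twist M m) (twist N n) \<and>
          (\<forall>a\<in>carrier A. act T a (pure_tensor K M N m n) =
            sweedler MN (\<lambda>a\<^sub>1 a\<^sub>2. pure_tensor K M N (act M a\<^sub>1 m) (act N a\<^sub>2 n)) (comult A a)) \<and>
          coact T (pure_tensor K M N m n) =
            sweedler MNC (\<lambda>m\<^sub>0 m\<^sub>1. sweedler MNC (\<lambda>n\<^sub>0 n\<^sub>1.
              pure_tensor K MN C (pure_tensor K M N m\<^sub>0 n\<^sub>0)
                (twist_inv C (twist_inv C (m\<^sub>1 \<otimes>\<^bsub>C\<^esub> n\<^sub>1)))) (coact N n)) (coact M m))))
    \<and> monoidal_category (dh_category K A C)"
proof -
  interpret field K by fact
  interpret monoidal_datum K H A C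
    by unfold_locales (rule assms)
  show ?thesis
    using monoidal_category_cat by (simp add: Let_def truncate_dh_tensor)
qed

end
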